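(* Let the weight $\mu$ be of one of the following two types. (D) Discrete distribution: $\mu(\beta)=\delta(\beta-\alpha)+\sum_{j=1}^m b_j\,\delta(\beta-\alpha_j)$, where $m\ge 0$, $1>\alpha>\alpha_1>\dots>\alpha_m>0$, $b_j>0$ for $j=1,\dots,m$, and $\delta$ is the Dirac delta. (C) Continuous distribution: $\mu\in C[0,1]$, $\mu(\beta)\ge 0$ for $\beta\in[0,1]$, $\mu\ne 0$ on a set of positive measure, and in addition $\mu\in C^3[0,1]$, $\mu(1)\neq 0$, and either $\mu(0)\ne 0$ or there are constants $c,\nu>0$ such that $\mu(\beta)=c\beta^\nu$ as $\beta\to 0$ (i.e. for all sufficiently small $\beta\ge 0$). Let $X$ be an ordered Banach space and let $A$ be the generator of a bounded $C_0$-semigroup $T(t)$ on $X$, $\|T(t)\|\le M$ for $t\ge0$. Assume that $T(t)$, the solution operator of the classical Cauchy problem $u'(t)=Au(t)$, $t>0$, $u(0)=a$, is positive. Then the solution operators $S(t)$ of the distributed order problem in the Caputo sense and of the distributed order problem in the Riemann-Liouville sense (both defined in the context) are positive.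
   Context: An ordered Banach space is a Banach space with a compatible partial order $\ge$ whose positive cone $\{a: a\ge 0\}$ is closed (e.g. $L^p(\Omega)$ or $C_0(\Omega)$ with the canonical pointwise (a.e.) ordering). A solution operator $S(t)$ is called positive if $a\ge 0$ implies $S(t)a\ge 0$ for any $t\ge 0$. Problems. With initial condition $u(0)=a\in X$, the Caputo problem is $$\int_0^1\mu(\beta)\,{}^{C}\!D_t^\beta u(t)\,d\beta=Au(t),\quad t>0,$$ and the Riemann-Liouville problem is $$u'(t)=\int_0^1\mu(\beta)\,D_t^\beta Au(t)\,d\beta,\quad t>0.$$ Here $J_t^\gamma f(t)=\frac1{\Gamma(\gamma)}\int_0^t(t-\tau)^{\gamma-1}f(\tau)\,d\tau$ for $\gamma>0$, ${}^{C}\!D_t^\beta=J_t^{1-\beta}\frac{d}{dt}$ and $D_t^\beta=\frac{d}{dt}J_t^{1-\beta}$ for $\beta\in(0,1)$, ${}^{C}\!D_t^0=D_t^0=I$, ${}^{C}\!D_t^1=D_t^1=d/dt$. Kernels. Let $h(s)=\int_0^1\mu(\beta)s^\beta\,d\beta$ (in case (D), $h(s)=s^\alpha+\sum_{j=1}^m b_js^{\alpha_j}$). $k_1,k_2\in L^1_{loc}(\mathbb{R}_+)$, $\mathbb{R}_+=[0,\infty)$, are the functions with Laplace transforms $\widehat{k_1}(s)=1/h(s)$ and $\widehat{k_2}(s)=h(s)/s$ for $s>0$, where $\widehat f(s)=\int_0^\infty e^{-st}f(t)\,dt$. Solution operators. For $k\in L^1_{loc}(\mathbb{R}_+)$ consider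 the Volterra equation $$u(t)=a+\int_0^tk(t-\tau)Au(\tau)\,d\tau,\quad t\ge 0.\qquad (\mathrm V_k)$$ A strong solution is a function $u\in C(\mathbb{R}_+;D(A))$ ($D(A)$ with the graph norm) for which $(\mathrm V_k)$ holds on $\mathbb{R}_+$. Equation $(\mathrm V_k)$ is well-posed if for each $a\in D(A)$ there is a unique strong solution $u(t;a)$, and $a_n\in D(A)$, $a_n\to 0$ imply $u(t;a_n)\to 0$ in $X$ uniformly on compact intervals. Its solution operator is $S(t)a=u(t;a)$, $a\in D(A)$, $t\ge 0$, extended by continuity to $X$. By definition, the Caputo (resp. Riemann-Liouville) problem is well-posed if $(\mathrm V_k)$ with $k=k_1$ (resp. $k=k_2$) is well-posed, and its solution operator is the solution operator of the corresponding equation $(\mathrm V_k)$. Under the hypotheses on $\mu$ and $A$ in the claim, both problems are well-posed. *)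

theory Defs
  imports "HOL-Analysis.Analysis"
begin

section \<open>Ordered Banach spaces\<close>

class ordered_banach = banach + ordered_real_vector +
  assumes closed_positive_cone: "closed {a. 0 \<le> a}"

definition positive_family :: "(real \<Rightarrow> 'a::ordered_banach \<Rightarrow> 'a) \<Rightarrow> bool" where
  "positive_family S \<longleftrightarrow> (\<forall>t\<ge>0. \<forall>a. 0 \<le> a \<longrightarrow> 0 \<le> S t a)"


section \<open>Semigroups and generators\<close>

definition C0_semigroup :: "(real \<Rightarrow> 'a::banach \<Rightarrow>\<^sub>L 'a) \<Rightarrow> bool" where
  "C0_semigroup T \<longleftrightarrow>
     T 0 = id_blinfun \<and>
     (\<forall>s\<ge>0. \<forall>t\<ge>0. T (s + t) = T s o\<^sub>L T t) \<and>
     (\<forall>x. ((\<lambda>t. blinfun_apply (T t) x) \<longlongrightarrow> x) (at_right 0))"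

text \<open>An unbounded operator is given by its domain \<open>D\<close> and a function \<open>A\<close> whose values
  outside \<open>D\<close> are irrelevant.\<close>

definition is_generator :: "(real \<Rightarrow> 'a::banach \<Rightarrow>\<^sub>L 'a) \<Rightarrow> 'a set \<Rightarrow> ('a \<Rightarrow> 'a) \<Rightarrow> bool" where
  "is_generator T D A \<longleftrightarrow>
     D = {x. \<exists>y. ((\<lambda>t. (blinfun_apply (T t) x - x) /\<^sub>R t) \<longlongrightarrow> y) (at_right 0)} \<and>
     (\<forall>x\<in>D. ((\<lambda>t. (blinfun_apply (T t) x - x) /\<^sub>R t) \<longlongrightarrow> A x) (at_right 0))"


section \<open>Volterra equations and their solution operators\<close>

text \<open>Continuity with respect to the graph norm of \<open>A\<close> is continuity of both \<open>u\<close> and \<open>A u\<close>.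
  The integral is the Henstock-Kurzweil one, since the Bochner integral of the library is
  restricted to separable spaces. The integrands here are products of a locally integrable scalar
  kernel and a continuous function; they are Bochner integrable, and both integrals agree.\<close>

definition strong_solution ::
  "'a::banach set \<Rightarrow> ('a \<Rightarrow> 'a) \<Rightarrow> (real \<Rightarrow> real) \<Rightarrow> 'a \<Rightarrow> (real \<Rightarrow> 'a) \<Rightarrow> bool" where
  "strong_solution D A k a u \<longleftrightarrow>
     (\<forall>t\<ge>0. u t \<in> D) \<and>
     continuous_on {0..} u \<and> continuous_on {0..} (\<lambda>t. A (u t)) \<and>
     (\<forall>t\<ge>0. ((\<lambda>\<tau>. k (t - \<tau>) *\<^sub>R A (u \<tau>)) has_integral (u t - a)) {0..t})"

text \<open>The value \<open>u(t;a)\<close>; functions on \<open>[0,\<infinity>)\<close> are total functions on the reals, so the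
  solution is determined only at times \<open>t \<ge> 0\<close>.\<close>

definition the_strong_solution ::
  "'a::banach set \<Rightarrow> ('a \<Rightarrow> 'a) \<Rightarrow> (real \<Rightarrow> real) \<Rightarrow> 'a \<Rightarrow> real \<Rightarrow> 'a" where
  "the_strong_solution D A k a t = (THE y. \<exists>u. strong_solution D A k a u \<and> u t = y)"

definition well_posed :: "'a::banach set \<Rightarrow> ('a \<Rightarrow> 'a) \<Rightarrow> (real \<Rightarrow> real) \<Rightarrow> bool" where
  "well_posed D A k \<longleftrightarrow>
     (\<forall>a\<in>D. (\<exists>u. strong_solution D A k a u) \<and>
        (\<forall>u v. strong_solution D A k a u \<longrightarrow> strong_solution D A k a v \<longrightarrow> (\<forall>t\<ge>0. u t = v t))) \<and>
     (\<forall>a :: nat \<Rightarrow> 'a. (\<forall>n. a n \<in> D) \<longrightarrow> a \<longlonglongrightarrow> 0 \<longrightarrow>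
        (\<forall>R\<ge>0. uniform_limit {0..R} (\<lambda>n t. the_strong_solution D A k (a n) t) (\<lambda>_. 0) sequentially))"

definition solution_operator ::
  "'a::banach set \<Rightarrow> ('a \<Rightarrow> 'a) \<Rightarrow> (real \<Rightarrow> real) \<Rightarrow> real \<Rightarrow> 'a \<Rightarrow> 'a" where
  "solution_operator D A k t a =
     (if \<not> well_posed D A k then undefined
      else if a \<in> D then the_strong_solution D A k a t
      else Lim (at a within D) (\<lambda>x. the_strong_solution D A k x t))"


section \<open>Weights and kernels\<close>

text \<open>\<open>Discrete \<alpha> m b \<alpha>s\<close> stands for the weight
  \<open>\<delta>(\<beta> - \<alpha>) + (\<Sum>j=1..m. b j * \<delta>(\<beta> - \<alpha>s j))\<close>; the values of \<open>b\<close> and \<open>\<alpha>s\<close>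
  outside \<open>{1..m}\<close> are irrelevant. \<open>Continuous \<mu>\<close> stands for the density \<open>\<mu>\<close> on \<open>[0,1]\<close>.\<close>

datatype weight =
    Discrete real nat "nat \<Rightarrow> real" "nat \<Rightarrow> real"
  | Continuous "real \<Rightarrow> real"

definition C_k_on :: "nat \<Rightarrow> (real \<Rightarrow> real) \<Rightarrow> real set \<Rightarrow> bool" where
  "C_k_on n f S \<longleftrightarrow>
     (\<exists>F :: nat \<Rightarrow> real \<Rightarrow> real. F 0 = f \<and>
        (\<forall>i<n. \<forall>x\<in>S. (F i has_real_derivative F (Suc i) x) (at x within S)) \<and>
        (\<forall>i\<le>n. continuous_on S (F i)))"

fun admissible_weight :: "weight \<Rightarrow> bool" where
  "admissible_weight (Discrete \<alpha> m b \<alpha>s) \<longleftrightarrow>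
     0 < \<alpha> \<and> \<alpha> < 1 \<and>
     (\<forall>j\<in>{1..m}. 0 < \<alpha>s j \<and> \<alpha>s j < \<alpha> \<and> 0 < b j) \<and>
     (\<forall>i\<in>{1..m}. \<forall>j\<in>{1..m}. i < j \<longrightarrow> \<alpha>s j < \<alpha>s i)"
| "admissible_weight (Continuous \<mu>) \<longleftrightarrow>
     continuous_on {0..1} \<mu> \<and>
     (\<forall>\<beta>\<in>{0..1}. 0 \<le> \<mu> \<beta>) \<and>
     0 < emeasure lborel {\<beta>\<in>{0..1}. \<mu> \<beta> \<noteq> 0} \<and>
     C_k_on 3 \<mu> {0..1} \<and>
     \<mu> 1 \<noteq> 0 \<and>
     (\<mu> 0 \<noteq> 0 \<or>
      (\<exists>c>0. \<exists>\<nu>>0. \<exists>\<epsilon>>0. \<forall>\<beta>\<in>{0..1}. \<beta> < \<epsilon> \<longrightarrow> \<mu> \<beta> = c * \<beta> powr \<nu>))"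

text \<open>The function \<open>h(s) = \<integral>\<^sub>0\<^sup>1 \<mu>(\<beta>) s\<^sup>\<beta> d\<beta>\<close>, used for \<open>s > 0\<close> only.\<close>

fun weight_symbol :: "weight \<Rightarrow> real \<Rightarrow> real" where
  "weight_symbol (Discrete \<alpha> m b \<alpha>s) s = s powr \<alpha> + (\<Sum>j=1..m. b j * s powr \<alpha>s j)"
| "weight_symbol (Continuous \<mu>) s = integral {0..1} (\<lambda>\<beta>. \<mu> \<beta> * s powr \<beta>)"

definition locally_integrable :: "(real \<Rightarrow> real) \<Rightarrow> bool" where
  "locally_integrable k \<longleftrightarrow> (\<forall>R\<ge>0. k absolutely_integrable_on {0..R})"

definition has_laplace_transform :: "(real \<Rightarrow> real) \<Rightarrow> (real \<Rightarrow> real) \<Rightarrow> bool" where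
  "has_laplace_transform k K \<longleftrightarrow>
     (\<forall>s>0. (\<lambda>t. exp (- s * t) * k t) absolutely_integrable_on {0..} \<and>
            integral {0..} (\<lambda>t. exp (- s * t) * k t) = K s)"

text \<open>The kernels are determined by their Laplace transforms up to null sets only.\<close>

definition caputo_kernel :: "weight \<Rightarrow> (real \<Rightarrow> real) \<Rightarrow> bool" where
  "caputo_kernel w k \<longleftrightarrow>
     locally_integrable k \<and> has_laplace_transform k (\<lambda>s. 1 / weight_symbol w s)"

definition riemann_liouville_kernel :: "weight \<Rightarrow> (real \<Rightarrow> real) \<Rightarrow> bool" where
  "riemann_liouville_kernel w k \<longleftrightarrow>
     locally_integrable k \<and> has_laplace_transform k (\<lambda>s. weight_symbol w s / s)"

end

theory Submission
  imports Defs
begin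

text \<open>Write the kernel as \<open>k\<close> with Laplace transform \<open>1/g\<close>; here \<open>g = h\<close> or \<open>g(s) = s/h(s)\<close>.
  Both choices are Bernstein functions. For \<open>h\<close> this is read off the binomial series. For
  \<open>s/h(s)\<close> it is Kaluza's theorem: the Taylor coefficients of \<open>h(s)/s\<close> in the variable
  \<open>1 - s/l\<close> form a log-convex sequence, so those of the reciprocal are nonpositive from index 1 on.
  Hence \<open>1/(g + \<mu>)\<close> has nonnegative coefficients, and the resolvent kernel \<open>r\<close> of \<open>k\<close>, given by
  \<open>r + \<mu> k * r = k\<close> for \<open>\<mu> > 0\<close>, is nonnegative.

  Replace \<open>A\<close> by the bounded operator \<open>\<mu> (T(1/\<mu>) - I)\<close>. The Volterra equation becomes
  \<open>u = (1 - \<mu> 1 * r) a + \<mu> r * T(1/\<mu>) u\<close>, whose solution is a series of powers of \<open>T(1/\<mu>)\<close> with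
  nonnegative scalar coefficients of sum 1; it is positive and bounded by \<open>M \<parallel>a\<parallel>\<close>. In the
  equivalent norm \<open>N x = sup\<^sub>t \<parallel>T(t) x\<parallel>\<close> the positivity of \<open>r\<close> and \<open>k\<close> gives the estimate
  \<open>N(w) \<le> k * N(g)\<close> for solutions of \<open>w = k * (\<mu> (T(1/\<mu>) - I) w + g)\<close>. It yields convergence as
  \<open>\<mu> \<rightarrow> \<infinity>\<close> as well as uniqueness of strong solutions, so the limit is the solution operator.\<close>

section \<open>Convolution of a kernel with a continuous function\<close>

text \<open>Several obstacles shape the proof. The kernel is known only through its Laplace
  transform and up to null sets, so every sign has to be read off the transform. Complete
  monotonicity is therefore expressed by Taylor coefficients in z = 1 - s/l: for the transform of f
  they are l^n/n! times the moments of exp(-l t) f(t), and nonnegative moments force f \<ge> 0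
  almost everywhere. The space may be non-separable, so integrals are interchanged only for scalar
  functions. The semigroup is bounded but not contractive: in the original norm each application of
  T(1/\<mu>) would cost a factor M, which the norm N removes. Finally, the solution operator has a
  meaningful value only for a well-posed equation, so well-posedness is proved along the way, from
  bounds that do not depend on \<mu>. The series has a probabilistic reading. \<mu> r is a (possibly
  defective) waiting time density, and the approximate solution at time t averages T(n/\<mu>) a over
  the number n of renewals up to t.\<close>

lemma partition_approx:
  fixes f :: "real \<Rightarrow> 'a::real_normed_vector"
  assumes f: "continuous_on {0..R} f" and R: "0 \<le> R" and e: "0 < e"
  obtains P and \<phi> :: "real \<Rightarrow> real \<Rightarrow> real" where
    "finite P" "\<And>p. p \<in> P \<Longrightarrow> continuous_on UNIV (\<phi> p)"
    "\<And>p t. p \<in> P \<Longrightarrow> 0 \<le> \<phi> p t \<and> \<phi> p t \<le> 1"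
    "\<And>t. t \<in> {0..R} \<Longrightarrow> norm (f t - (\<Sum>p\<in>P. \<phi> p t *\<^sub>R f p)) \<le> e"
proof -
  have "uniformly_continuous_on {0..R} f"
    by (intro compact_uniformly_continuous f) auto
  then obtain d where d: "d > 0" "\<And>x y. x \<in> {0..R} \<Longrightarrow> y \<in> {0..R} \<Longrightarrow> dist y x < d \<Longrightarrow> dist (f y) (f x) < e"
    using e unfolding uniformly_continuous_on_def by metis
  obtain P where P: "finite P" "P \<subseteq> {0..R}" "{0..R} \<subseteq> (\<Union>p\<in>P. ball p d)"
    using seq_compact_imp_totally_bounded[OF compact_imp_seq_compact[OF compact_Icc[of 0 R]], rule_format, OF d(1)]
    by (elim exE conjE)
  \<comment> \<open>Clamping the argument to \<open>{0..R}\<close> keeps it within distance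
    \<open>d\<close> of the net, so the sum \<open>\<sigma>\<close> of the tents is positive
    everywhere and the weights are continuous on the whole line.\<close>
  define c where "c t = min R (max 0 t)" for t :: real
  have c: "c t \<in> {0..R}" for t using R by (auto simp: c_def)
  have c_id: "c t = t" if "t \<in> {0..R}" for t using that by (auto simp: c_def)
  define \<psi> where "\<psi> p t = max 0 (d - \<bar>c t - p\<bar>)" for p t
  define \<sigma> where "\<sigma> t = (\<Sum>p\<in>P. \<psi> p t)" for t
  have \<psi>0: "0 \<le> \<psi> p t" for p t by (simp add: \<psi>_def)
  have \<sigma>: "\<sigma> t > 0" for t
  proof -
    obtain p where "p \<in> P" "dist p (c t) < d" using P(3) c[of t] by auto
    then have "0 < \<psi> p t" by (auto simp: \<psi>_def dist_real_def)
    then show ?thesis unfolding \<sigma>_def using \<open>p \<in> P\<close> P(1) \<psi>0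
      by (intro sum_pos2[where i = p]) auto
  qed
  have c_cont: "continuous_on UNIV c" unfolding c_def by (intro continuous_intros)
  show thesis
  proof (rule that[of P "\<lambda>p t. \<psi> p t / \<sigma> t"])
    show "finite P" by fact
    show "continuous_on UNIV (\<lambda>t. \<psi> p t / \<sigma> t)" for p
      unfolding \<psi>_def \<sigma>_def by (intro continuous_intros c_cont) (use \<sigma> in \<open>auto simp: \<sigma>_def \<psi>_def less_le\<close>)
    show "0 \<le> \<psi> p t / \<sigma> t \<and> \<psi> p t / \<sigma> t \<le> 1" if "p \<in> P" for p t
      using \<psi>0[of p t] \<sigma>[of t] member_le_sum[of p P "\<lambda>p. \<psi> p t"] that P(1) \<psi>0
      by (auto simp: \<sigma>_def)
    fix t assume t: "t \<in> {0..R}"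
    have s1: "(\<Sum>p\<in>P. \<psi> p t / \<sigma> t) = 1"
      using \<sigma>[of t] by (simp flip: sum_divide_distrib \<sigma>_def)
    have "f t - (\<Sum>p\<in>P. (\<psi> p t / \<sigma> t) *\<^sub>R f p) = (\<Sum>p\<in>P. (\<psi> p t / \<sigma> t) *\<^sub>R (f t - f p))"
      using s1 by (simp add: scaleR_diff_right sum_subtractf flip: scaleR_left.sum)
    also have "norm \<dots> \<le> (\<Sum>p\<in>P. (\<psi> p t / \<sigma> t) * e)"
    proof (rule sum_norm_le)
      fix p assume p: "p \<in> P"
      show "norm ((\<psi> p t / \<sigma> t) *\<^sub>R (f t - f p)) \<le> \<psi> p t / \<sigma> t * e"
      proof (cases "\<psi> p t = 0")
        case False
        then have "dist t p < d" using c_id[OF t] by (auto simp: \<psi>_def dist_real_def max_def split: if_splits)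
        then have "norm (f t - f p) \<le> e" using d(2)[of p t] p P(2) t by (auto simp: dist_norm)
        then show ?thesis using \<psi>0[of p t] \<sigma>[of t] by (simp add: divide_right_mono mult_left_mono)
      qed auto
    qed
    also have "\<dots> = e" using s1 by (simp only: mult_1_left flip: sum_distrib_right)
    finally show "norm (f t - (\<Sum>p\<in>P. (\<psi> p t / \<sigma> t) *\<^sub>R f p)) \<le> e" .
  qed
qed

text \<open>The integrands to come have a possibly unbounded factor \<open>k (t - \<tau>)\<close>,
  so a uniform error is out of reach; the error is measured relative to an integrable
  \<open>k\<close> instead. The Cauchy criterion still applies, because Riemann sums of
  \<open>k\<close> over fine divisions stay below \<open>I + 1\<close>.\<close>

lemma integrable_on_dominated_approx:
  fixes f :: "real \<Rightarrow> 'a::banach"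
  assumes k: "k integrable_on {a..b}" and k0: "\<And>x. x \<in> {a..b} \<Longrightarrow> (0::real) \<le> k x"
    and app: "\<And>e. e > 0 \<Longrightarrow> \<exists>g. g integrable_on {a..b} \<and> (\<forall>x\<in>{a..b}. norm (f x - g x) \<le> e * k x)"
  shows "f integrable_on {a..b}"
proof -
  define I where "I = integral {a..b} k"
  have kI: "(k has_integral I) (cbox a b)" using k by (simp add: I_def has_integral_integral)
  have I0: "0 \<le> I" unfolding I_def using k k0 by (intro integral_nonneg) auto
  have "f integrable_on cbox a b"
  proof (subst integrable_Cauchy, intro allI impI)
    fix e :: real assume e: "0 < e"
    \<comment> \<open>Replacing \<open>f\<close> by \<open>g\<close> then costs at most e/4 in each
      of the two Riemann sums, and the sums of \<open>g\<close> differ by less than e/2. The summand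
      1 covers the case \<open>I = 0\<close>.\<close>
    define \<delta> where "\<delta> = e / (4 * (I + 1))"
    have \<delta>: "\<delta> > 0" using e I0 by (simp add: \<delta>_def)
    obtain g where g: "g integrable_on {a..b}" "\<And>x. x \<in> {a..b} \<Longrightarrow> norm (f x - g x) \<le> \<delta> * k x"
      using app[OF \<delta>] by auto
    have "g integrable_on cbox a b" using g(1) by simp
    then obtain \<gamma>1 where g1: "gauge \<gamma>1"
      "\<And>D1 D2. D1 tagged_division_of (cbox a b) \<and> \<gamma>1 fine D1 \<and> D2 tagged_division_of (cbox a b) \<and> \<gamma>1 fine D2 \<Longrightarrow>
         norm ((\<Sum>(x,K)\<in>D1. measure lborel K *\<^sub>R g x) - (\<Sum>(x,K)\<in>D2. measure lborel K *\<^sub>R g x)) < e/2"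
      using integrable_Cauchy[of g a b] half_gt_zero[OF e] by meson
    have "\<exists>\<gamma>. gauge \<gamma> \<and> (\<forall>D. D tagged_division_of (cbox a b) \<and> \<gamma> fine D \<longrightarrow> norm ((\<Sum>(x,K)\<in>D. measure lborel K *\<^sub>R k x) - I) < 1)"
      using kI[unfolded has_integral, rule_format, of 1] by simp
    then obtain \<gamma>2 where g2: "gauge \<gamma>2"
      "\<And>D. D tagged_division_of (cbox a b) \<Longrightarrow> \<gamma>2 fine D \<Longrightarrow> norm ((\<Sum>(x,K)\<in>D. measure lborel K *\<^sub>R k x) - I) < 1"
      by (elim exE conjE) simp
    have key: "norm ((\<Sum>(x,K)\<in>D. measure lborel K *\<^sub>R f x) - (\<Sum>(x,K)\<in>D. measure lborel K *\<^sub>R g x)) \<le> e/4"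
      if D: "D tagged_division_of (cbox a b)" "\<gamma>2 fine D" for D
    proof -
      have "(\<Sum>(x,K)\<in>D. measure lborel K *\<^sub>R f x) - (\<Sum>(x,K)\<in>D. measure lborel K *\<^sub>R g x) = (\<Sum>(x,K)\<in>D. measure lborel K *\<^sub>R (f x - g x))"
        by (simp add: sum_subtractf[symmetric] scaleR_diff_right case_prod_unfold)
      also have "norm \<dots> \<le> (\<Sum>(x,K)\<in>D. \<delta> * (measure lborel K *\<^sub>R k x))"
      proof (rule sum_norm_le, clarify)
        fix x K assume "(x,K) \<in> D"
        then have "x \<in> {a..b}" using tag_in_interval[OF D(1)] by auto
        then have "norm (f x - g x) \<le> \<delta> * k x" by (rule g(2))
        then show "norm (measure lborel K *\<^sub>R (f x - g x)) \<le> \<delta> * (measure lborel K *\<^sub>R k x)"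
          using mult_left_mono[of "norm (f x - g x)" "\<delta> * k x" "measure lborel K"] by (simp add: mult.left_commute)
      qed
      also have "\<dots> = \<delta> * (\<Sum>(x,K)\<in>D. measure lborel K *\<^sub>R k x)" by (simp add: sum_distrib_left case_prod_unfold)
      also have "\<dots> \<le> \<delta> * (I + 1)" using g2(2)[OF D] \<delta> by (intro mult_left_mono) (auto simp: abs_if split: if_splits)
      also have "\<dots> = e/4" using I0 by (simp add: \<delta>_def field_simps)
      finally show ?thesis .
    qed
    show "\<exists>\<gamma>. gauge \<gamma> \<and> (\<forall>\<D>1 \<D>2. \<D>1 tagged_division_of cbox a b \<and> \<gamma> fine \<D>1 \<and>
              \<D>2 tagged_division_of cbox a b \<and> \<gamma> fine \<D>2 \<longrightarrow>
              norm ((\<Sum>(x, K)\<in>\<D>1. measure lborel K *\<^sub>R f x) - (\<Sum>(x, K)\<in>\<D>2. measure lborel K *\<^sub>R f x)) < e)"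
    proof (intro exI[of _ "\<lambda>x. \<gamma>1 x \<inter> \<gamma>2 x"] conjI allI impI gauge_Int g1(1) g2(1))
      fix D1 D2
      assume *: "D1 tagged_division_of cbox a b \<and> (\<lambda>x. \<gamma>1 x \<inter> \<gamma>2 x) fine D1 \<and>
              D2 tagged_division_of cbox a b \<and> (\<lambda>x. \<gamma>1 x \<inter> \<gamma>2 x) fine D2"
      then have f: "\<gamma>1 fine D1" "\<gamma>2 fine D1" "\<gamma>1 fine D2" "\<gamma>2 fine D2" by (auto simp: fine_Int)
      show "norm ((\<Sum>(x, K)\<in>D1. measure lborel K *\<^sub>R f x) - (\<Sum>(x, K)\<in>D2. measure lborel K *\<^sub>R f x)) < e"
      proof -
        define F where "F D = (\<Sum>(x, K)\<in>D. measure lborel K *\<^sub>R f x)" for D :: "(real \<times> real set) set"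
        define G where "G D = (\<Sum>(x, K)\<in>D. measure lborel K *\<^sub>R g x)" for D :: "(real \<times> real set) set"
        have "norm (F D1 - G D1) \<le> e/4" "norm (F D2 - G D2) \<le> e/4"
          using key[of D1] key[of D2] * f by (auto simp: F_def G_def)
        moreover have "norm (G D1 - G D2) < e/2"
          using g1(2)[of D1 D2] * f by (auto simp: G_def)
        moreover have "F D1 - F D2 = (F D1 - G D1) + ((G D1 - G D2) - (F D2 - G D2))" by simp
        ultimately have "norm (F D1 - F D2) < e"
          using norm_triangle_ineq[of "F D1 - G D1" "(G D1 - G D2) - (F D2 - G D2)"]
            norm_triangle_ineq4[of "G D1 - G D2" "F D2 - G D2"] by simp
        then show ?thesis by (simp add: F_def)
      qed
    qed
  qed
  then show ?thesis by simp
qed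

section \<open>Scalar convolution and kernels with a Laplace transform\<close>

definition convolution :: "(real \<Rightarrow> real) \<Rightarrow> (real \<Rightarrow> real) \<Rightarrow> real \<Rightarrow> real" where
  "convolution f g t = (\<integral>\<tau>. f (t - \<tau>) * g \<tau> \<partial>lborel)"

lemma integrable_reflect_shift:
  fixes f :: "real \<Rightarrow> real"
  shows "integrable lborel f \<Longrightarrow> integrable lborel (\<lambda>\<tau>. f (t - \<tau>))"
  using lborel_integrable_real_affine[of f "-1" t] by simp

lemma integral_reflect_shift:
  fixes f :: "real \<Rightarrow> real"
  shows "(\<integral>\<tau>. f (t - \<tau>) \<partial>lborel) = integral\<^sup>L lborel f"
  using lborel_integral_real_affine[of "-1" f t] by simp

lemma integrable_shift:
  fixes f :: "real \<Rightarrow> real"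
  shows "integrable lborel f \<Longrightarrow> integrable lborel (\<lambda>t. f (t - \<tau>))"
  using lborel_integrable_real_affine[of f 1 "-\<tau>"] by simp

lemma integral_shift:
  fixes f :: "real \<Rightarrow> real"
  shows "(\<integral>t. f (t - \<tau>) \<partial>lborel) = integral\<^sup>L lborel f"
  using lborel_integral_real_affine[of 1 f "-\<tau>"] by simp

lemma borel_measurable_convolution [measurable]:
  assumes [measurable]: "f \<in> borel_measurable borel" "g \<in> borel_measurable borel"
  shows "convolution f g \<in> borel_measurable borel"
proof -
  have "(\<lambda>t. \<integral>\<tau>. f (t - \<tau>) * g \<tau> \<partial>lborel) \<in> borel_measurable lborel" by measurable
  then show ?thesis unfolding convolution_def[abs_def] by simp
qed

lemma convolution_L1:
  assumes f: "integrable lborel f" and g: "integrable lborel g"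
  shows "integrable lborel (convolution f g)" "integral\<^sup>L lborel (convolution f g) = integral\<^sup>L lborel f * integral\<^sup>L lborel g"
proof -
  have [measurable]: "f \<in> borel_measurable borel" "g \<in> borel_measurable borel"
    using f g by auto
  have *: "(\<integral>t. norm (f (t - \<tau>) * g \<tau>) \<partial>lborel) = (\<integral>t. \<bar>f t\<bar> \<partial>lborel) * \<bar>g \<tau>\<bar>" for \<tau>
    using integral_shift[of "\<lambda>t. \<bar>f t\<bar>" \<tau>] by (simp add: abs_mult)
  have int: "integrable (lborel \<Otimes>\<^sub>M lborel) (\<lambda>(\<tau>, t). f (t - \<tau>) * g \<tau>)"
  proof (rule lborel_pair.Fubini_integrable)
    show "(\<lambda>(\<tau>, t). f (t - \<tau>) * g \<tau>) \<in> borel_measurable (lborel \<Otimes>\<^sub>M lborel)" by measurable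
    show "integrable lborel (\<lambda>\<tau>. \<integral>t. norm (case (\<tau>, t) of (\<tau>, t) \<Rightarrow> f (t - \<tau>) * g \<tau>) \<partial>lborel)"
      using * g by simp
    show "AE \<tau> in lborel. integrable lborel (\<lambda>t. case (\<tau>, t) of (\<tau>, t) \<Rightarrow> f (t - \<tau>) * g \<tau>)"
      using integrable_shift[OF f] by simp
  qed
  show "integrable lborel (convolution f g)"
    using lborel_pair.integrable_snd[OF int] unfolding convolution_def[abs_def] .
  show "integral\<^sup>L lborel (convolution f g) = integral\<^sup>L lborel f * integral\<^sup>L lborel g"
    using lborel_pair.Fubini_integral[OF int] by (simp add: convolution_def[abs_def] integral_shift)
qed

text \<open>Fubini's theorem for the triple product. Two integrable factors and a bounded third one
  already make the integrand absolutely integrable on the plane.\<close>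

lemma convolution_assoc:
  assumes f: "integrable lborel f" and g: "integrable lborel g"
    and [measurable]: "\<phi> \<in> borel_measurable borel" and B: "\<And>t. \<bar>\<phi> t\<bar> \<le> B"
  shows "convolution f (convolution g \<phi>) t = convolution (convolution f g) \<phi> t"
proof -
  have [measurable]: "f \<in> borel_measurable borel" "g \<in> borel_measurable borel"
    using f g by auto
  have B0: "0 \<le> B" using B[of 0] by linarith
  have ig: "integrable lborel (\<lambda>\<sigma>. g (\<tau> - \<sigma>) * \<phi> \<sigma>)" for \<tau>
    by (rule Bochner_Integration.integrable_bound[OF integrable_mult_right[OF integrable_reflect_shift[OF g, of \<tau>], of B]])
       (use B in \<open>auto simp: abs_mult mult.commute[of B] intro!: AE_I2 mult_left_mono order_trans[OF B] abs_ge_self\<close>)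
  have bd: "(\<integral>\<sigma>. \<bar>g (\<tau> - \<sigma>)\<bar> * \<bar>\<phi> \<sigma>\<bar> \<partial>lborel) \<le> (\<integral>\<sigma>. \<bar>g \<sigma>\<bar> \<partial>lborel) * B" for \<tau>
  proof -
    have "(\<integral>\<sigma>. \<bar>g (\<tau> - \<sigma>)\<bar> * \<bar>\<phi> \<sigma>\<bar> \<partial>lborel) \<le> (\<integral>\<sigma>. \<bar>g (\<tau> - \<sigma>)\<bar> * B \<partial>lborel)"
      using integrable_norm[OF ig[of \<tau>]] integrable_reflect_shift[OF g, of \<tau>] B
      by (intro integral_mono mult_left_mono) (auto simp: abs_mult)
    also have "\<dots> = (\<integral>\<sigma>. \<bar>g \<sigma>\<bar> \<partial>lborel) * B"
      using integral_reflect_shift[of "\<lambda>t. \<bar>g t\<bar>" \<tau>] by simp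
    finally show ?thesis .
  qed
  have int: "integrable (lborel \<Otimes>\<^sub>M lborel) (\<lambda>(\<tau>, \<sigma>). f (t - \<tau>) * (g (\<tau> - \<sigma>) * \<phi> \<sigma>))"
  proof (rule lborel_pair.Fubini_integrable)
    show "(\<lambda>(\<tau>, \<sigma>). f (t - \<tau>) * (g (\<tau> - \<sigma>) * \<phi> \<sigma>)) \<in> borel_measurable (lborel \<Otimes>\<^sub>M lborel)" by measurable
    show "integrable lborel (\<lambda>\<tau>. \<integral>\<sigma>. norm (case (\<tau>, \<sigma>) of (\<tau>, \<sigma>) \<Rightarrow> f (t - \<tau>) * (g (\<tau> - \<sigma>) * \<phi> \<sigma>)) \<partial>lborel)"
    proof (rule Bochner_Integration.integrable_bound)
      show "integrable lborel (\<lambda>\<tau>. \<bar>f (t - \<tau>)\<bar> * ((\<integral>\<sigma>. \<bar>g \<sigma>\<bar> \<partial>lborel) * B))"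
        using integrable_reflect_shift[OF f, of t] by auto
      show "AE \<tau> in lborel. norm (\<integral>\<sigma>. norm (case (\<tau>, \<sigma>) of (\<tau>, \<sigma>) \<Rightarrow> f (t - \<tau>) * (g (\<tau> - \<sigma>) * \<phi> \<sigma>)) \<partial>lborel)
        \<le> norm (\<bar>f (t - \<tau>)\<bar> * ((\<integral>\<sigma>. \<bar>g \<sigma>\<bar> \<partial>lborel) * B))"
        using bd B0 by (intro AE_I2) (auto simp: abs_mult intro!: mult_left_mono)
    qed measurable
    show "AE \<tau> in lborel. integrable lborel (\<lambda>\<sigma>. case (\<tau>, \<sigma>) of (\<tau>, \<sigma>) \<Rightarrow> f (t - \<tau>) * (g (\<tau> - \<sigma>) * \<phi> \<sigma>))"
      using ig by simp
  qed
  have "convolution f (convolution g \<phi>) t = (\<integral>\<tau>. (\<integral>\<sigma>. f (t - \<tau>) * (g (\<tau> - \<sigma>) * \<phi> \<sigma>) \<partial>lborel) \<partial>lborel)"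
    by (simp add: convolution_def[abs_def])
  also have "\<dots> = (\<integral>\<sigma>. (\<integral>\<tau>. f (t - \<tau>) * (g (\<tau> - \<sigma>) * \<phi> \<sigma>) \<partial>lborel) \<partial>lborel)"
    using lborel_pair.Fubini_integral[OF int] by simp
  also have "\<dots> = (\<integral>\<sigma>. convolution f g (t - \<sigma>) * \<phi> \<sigma> \<partial>lborel)"
  proof (rule Bochner_Integration.integral_cong[OF refl])
    fix \<sigma>
    have "(\<integral>\<tau>. f (t - \<tau>) * (g (\<tau> - \<sigma>) * \<phi> \<sigma>) \<partial>lborel) = (\<integral>\<tau>. f (t - \<tau>) * g (\<tau> - \<sigma>) \<partial>lborel) * \<phi> \<sigma>"
      by (simp flip: mult.assoc)
    also have "(\<integral>\<tau>. f (t - \<tau>) * g (\<tau> - \<sigma>) \<partial>lborel) = convolution f g (t - \<sigma>)"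
      using integral_shift[of "\<lambda>\<tau>. f (t - \<sigma> - \<tau>) * g \<tau>" \<sigma>] by (simp add: convolution_def algebra_simps)
    finally show "(\<integral>\<tau>. f (t - \<tau>) * (g (\<tau> - \<sigma>) * \<phi> \<sigma>) \<partial>lborel) = convolution f g (t - \<sigma>) * \<phi> \<sigma>" .
  qed
  finally show ?thesis by (simp add: convolution_def)
qed

lemma convolution_commute: "convolution f g t = convolution g f t"
  using integral_reflect_shift[of "\<lambda>\<tau>. f (t - \<tau>) * g \<tau>" t] by (simp add: convolution_def mult.commute)

text \<open>Since exp(-s t) = exp(-s (t - \<tau>)) exp(-s \<tau>), exponential damping commutes with
  convolution. This reduces kernels that are integrable only after damping to the L1 theory.\<close>

lemma convolution_exp: "exp (- s * t) * convolution f g t = convolution (\<lambda>t. exp (- s * t) * f t) (\<lambda>t. exp (- s * t) * g t) t"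
proof -
  have "exp (- s * t) * (f (t - \<tau>) * g \<tau>) = (exp (- s * (t - \<tau>)) * f (t - \<tau>)) * (exp (- s * \<tau>) * g \<tau>)"
    for \<tau>
    by (simp add: algebra_simps flip: exp_add)
  then show ?thesis unfolding convolution_def by (simp only: flip: integral_mult_right_zero)
qed

text \<open>Sign and causality are demanded at every point, not just almost everywhere, so that they
  may be used pointwise; \<open>laplace_kernel_representative\<close> exchanges a given kernel for
  one of this kind.\<close>

definition laplace_kernel :: "(real \<Rightarrow> real) \<Rightarrow> bool" where
  "laplace_kernel k \<longleftrightarrow> k \<in> borel_measurable borel \<and> (\<forall>t. 0 \<le> k t) \<and> (\<forall>t<0. k t = 0) \<and>
     (\<forall>s>0. integrable lborel (\<lambda>t. exp (- s * t) * k t))"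

lemma laplace_kernelD:
  assumes "laplace_kernel k"
  shows "k \<in> borel_measurable borel" "0 \<le> k t" "t < 0 \<Longrightarrow> k t = 0"
    "0 < s \<Longrightarrow> integrable lborel (\<lambda>t. exp (- s * t) * k t)"
  using assms by (auto simp: laplace_kernel_def)

lemma laplace_kernel_convolution:
  assumes k: "laplace_kernel k" and r: "laplace_kernel r"
  shows "laplace_kernel (convolution k r)"
proof -
  note [measurable] = laplace_kernelD(1)[OF k] laplace_kernelD(1)[OF r]
  show ?thesis unfolding laplace_kernel_def
  proof (intro conjI allI impI)
    show "convolution k r \<in> borel_measurable borel" by measurable
    show "0 \<le> convolution k r t" for t unfolding convolution_def using laplace_kernelD(2) k r by (intro integral_nonneg_AE AE_I2) auto
    show "convolution k r t = 0" if "t < 0" for t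
    proof -
      have "k (t - \<tau>) * r \<tau> = 0" for \<tau> using laplace_kernelD(3)[OF k, of "t - \<tau>"] laplace_kernelD(3)[OF r, of \<tau>] that
        by (cases "\<tau> < 0") auto
      then show ?thesis unfolding convolution_def by (simp only: integral_zero)
    qed
    show "integrable lborel (\<lambda>t. exp (- s * t) * convolution k r t)" if "0 < s" for s
      unfolding convolution_exp by (intro convolution_L1 laplace_kernelD(4) k r that)
  qed
qed

lemma convolution_laplace:
  assumes k: "laplace_kernel k" and r: "laplace_kernel r" and s: "0 < s"
  shows "(\<integral>t. exp (- s * t) * convolution k r t \<partial>lborel) =
    (\<integral>t. exp (- s * t) * k t \<partial>lborel) * (\<integral>t. exp (- s * t) * r t \<partial>lborel)"
  unfolding convolution_exp by (intro convolution_L1 laplace_kernelD(4) k r s)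

text \<open>On \<open>{0..R}\<close> the factor exp(R - t) is at least 1, so the damped kernel at s
  = 1 is a majorant up to the constant exp R.\<close>

lemma laplace_kernel_set_integrable:
  assumes k: "laplace_kernel k" shows "set_integrable lborel {0..R} k"
  unfolding set_integrable_def
proof (rule Bochner_Integration.integrable_bound)
  note [measurable] = laplace_kernelD(1)[OF k]
  show "integrable lborel (\<lambda>t. exp R * (exp (- 1 * t) * k t))"
    using laplace_kernelD(4)[OF k, of 1] by simp
  show "(\<lambda>x. indicat_real {0..R} x *\<^sub>R k x) \<in> borel_measurable lborel" by measurable
  have "k t \<le> exp R * (exp (- t) * k t)" if "t \<le> R" for t
    using that mult_right_mono[of 1 "exp (R - t)" "k t"] laplace_kernelD(2)[OF k, of t]
    by (simp add: exp_diff exp_minus field_simps)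
  then show "AE x in lborel. norm (indicat_real {0..R} x *\<^sub>R k x) \<le> norm (exp R * (exp (- 1 * x) * k x))"
    using laplace_kernelD(2)[OF k] by (intro AE_I2) (auto simp: indicator_def)
qed

lemma laplace_kernel_reflect_set_integrable:
  assumes k: "laplace_kernel k" shows "set_integrable lborel {0..t} (\<lambda>\<tau>. k (t - \<tau>))"
  using integrable_reflect_shift[OF laplace_kernel_set_integrable[OF k, of t, unfolded set_integrable_def], of t]
  unfolding set_integrable_def by (rule back_subst[of "integrable lborel"]) (auto simp: indicator_def fun_eq_iff)

lemma laplace_kernel_bounded_set_integrable:
  assumes k: "laplace_kernel k" and [measurable]: "\<phi> \<in> borel_measurable borel"
    and B: "\<And>\<tau>. \<tau> \<in> {0..t} \<Longrightarrow> \<bar>\<phi> \<tau>\<bar> \<le> B"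
  shows "set_integrable lborel {0..t} (\<lambda>\<tau>. k (t - \<tau>) * \<phi> \<tau>)"
  unfolding set_integrable_def
proof (rule Bochner_Integration.integrable_bound)
  note [measurable] = laplace_kernelD(1)[OF k]
  show "integrable lborel (\<lambda>\<tau>. \<bar>B\<bar> * (indicat_real {0..t} \<tau> *\<^sub>R k (t - \<tau>)))"
    using laplace_kernel_reflect_set_integrable[OF k, of t] unfolding set_integrable_def by (intro integrable_mult_right)
  show "(\<lambda>\<tau>. indicat_real {0..t} \<tau> *\<^sub>R (k (t - \<tau>) * \<phi> \<tau>)) \<in> borel_measurable lborel" by measurable
  have "k (t - \<tau>) * \<bar>\<phi> \<tau>\<bar> \<le> k (t - \<tau>) * \<bar>B\<bar>" if "\<tau> \<in> {0..t}" for \<tau>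
    using B[OF that] laplace_kernelD(2)[OF k, of "t - \<tau>"] by (intro mult_left_mono) auto
  then show "AE \<tau> in lborel. norm (indicat_real {0..t} \<tau> *\<^sub>R (k (t - \<tau>) * \<phi> \<tau>)) \<le> norm (\<bar>B\<bar> * (indicat_real {0..t} \<tau> *\<^sub>R k (t - \<tau>)))"
    using laplace_kernelD(2)[OF k] by (intro AE_I2) (auto simp: indicator_def abs_mult mult.commute)
qed

text \<open>The same integral as in \<open>strong_solution\<close>, for values in any Banach space.
  For \<open>t < 0\<close> the interval is empty and the value is 0.\<close>

definition volterra_conv :: "(real \<Rightarrow> real) \<Rightarrow> (real \<Rightarrow> 'a::banach) \<Rightarrow> real \<Rightarrow> 'a" where
  "volterra_conv k f t = integral {0..t} (\<lambda>\<tau>. k (t - \<tau>) *\<^sub>R f \<tau>)"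

lemma volterra_conv_eq_convolution:
  assumes k: "laplace_kernel k" and [measurable]: "\<phi> \<in> borel_measurable borel"
    and B: "\<And>\<tau>. \<tau> \<in> {0..t} \<Longrightarrow> \<bar>\<phi> \<tau>\<bar> \<le> B"
  shows "volterra_conv k \<phi> t = convolution k (\<lambda>\<tau>. indicator {0..} \<tau> * \<phi> \<tau>) t"
proof -
  have "volterra_conv k \<phi> t = (\<integral>\<tau>. indicator {0..t} \<tau> *\<^sub>R (k (t - \<tau>) * \<phi> \<tau>) \<partial>lborel)"
    using set_borel_integral_eq_integral(2)[OF laplace_kernel_bounded_set_integrable[OF assms]]
    by (simp add: volterra_conv_def set_lebesgue_integral_def)
  also have "\<dots> = convolution k (\<lambda>\<tau>. indicator {0..} \<tau> * \<phi> \<tau>) t"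
    unfolding convolution_def using laplace_kernelD(3)[OF k]
    by (intro Bochner_Integration.integral_cong refl) (auto simp: indicator_def)
  finally show ?thesis .
qed

text \<open>After reflection the variable \<open>t\<close> sits in the bounded factor instead of the
  kernel, which may be singular; dominated convergence with majorant \<open>B * k\<close> then
  applies.\<close>

lemma volterra_conv_scalar_continuous:
  assumes k: "laplace_kernel k" and \<phi>: "continuous_on UNIV (\<phi>::real\<Rightarrow>real)" and B: "\<And>t. \<bar>\<phi> t\<bar> \<le> B"
  shows "continuous_on {0..R} (volterra_conv k \<phi>)"
proof -
  note [measurable] = laplace_kernelD(1)[OF k] borel_measurable_continuous_onI[OF \<phi>]
  have eq: "volterra_conv k \<phi> t = (\<integral>\<tau>. (indicator {0..R} \<tau> * k \<tau>) * (indicator {0..} (t - \<tau>) * \<phi> (t - \<tau>)) \<partial>lborel)"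
    if "t \<in> {0..R}" for t
  proof -
    have "volterra_conv k \<phi> t = convolution (\<lambda>\<tau>. indicator {0..} \<tau> * \<phi> \<tau>) k t"
      using volterra_conv_eq_convolution[OF k, of \<phi> t B] B by (simp add: convolution_commute)
    also have "\<dots> = (\<integral>\<tau>. (indicator {0..R} \<tau> * k \<tau>) * (indicator {0..} (t - \<tau>) * \<phi> (t - \<tau>)) \<partial>lborel)"
      unfolding convolution_def using laplace_kernelD(3)[OF k] that
      by (intro Bochner_Integration.integral_cong refl) (auto simp: indicator_def)
    finally show ?thesis .
  qed
  show ?thesis
  proof (rule continuous_on_eq)
    show "continuous_on {0..R} (\<lambda>t. \<integral>\<tau>. (indicator {0..R} \<tau> * k \<tau>) * (indicator {0..} (t - \<tau>) * \<phi> (t - \<tau>)) \<partial>lborel)"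
      unfolding continuous_on_sequentially comp_def
    proof (intro allI ballI impI, elim conjE)
      fix x t assume x: "\<forall>n::nat. x n \<in> {0..R}" "x \<longlonglongrightarrow> t"
      show "(\<lambda>n. \<integral>\<tau>. (indicator {0..R} \<tau> * k \<tau>) * (indicator {0..} (x n - \<tau>) * \<phi> (x n - \<tau>)) \<partial>lborel)
        \<longlonglongrightarrow> (\<integral>\<tau>. (indicator {0..R} \<tau> * k \<tau>) * (indicator {0..} (t - \<tau>) * \<phi> (t - \<tau>)) \<partial>lborel)"
      proof (rule integral_dominated_convergence)
        show "integrable lborel (\<lambda>\<tau>. B * (indicator {0..R} \<tau> * k \<tau>))"
          using laplace_kernel_set_integrable[OF k, of R] by (simp add: set_integrable_def)
        show "AE \<tau> in lborel. norm (indicator {0..R} \<tau> * k \<tau> * (indicator {0..} (x n - \<tau>) * \<phi> (x n - \<tau>))) \<le> B * (indicator {0..R} \<tau> * k \<tau>)" for n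
          using B laplace_kernelD(2)[OF k] order_trans[OF abs_ge_zero B]
          by (intro AE_I2) (auto simp: indicator_def abs_mult mult.commute[of B] intro!: mult_left_mono)
        show "AE \<tau> in lborel. (\<lambda>n. indicator {0..R} \<tau> * k \<tau> * (indicator {0..} (x n - \<tau>) * \<phi> (x n - \<tau>)))
             \<longlonglongrightarrow> indicator {0..R} \<tau> * k \<tau> * (indicator {0..} (t - \<tau>) * \<phi> (t - \<tau>))"
          using AE_lborel_singleton[of t]
        proof eventually_elim
          case (elim \<tau>)
          have lim: "(\<lambda>n. x n - \<tau>) \<longlonglongrightarrow> t - \<tau>" by (intro tendsto_intros x)
          have p: "(\<lambda>n. \<phi> (x n - \<tau>)) \<longlonglongrightarrow> \<phi> (t - \<tau>)"
            using continuous_on_tendsto_compose[OF \<phi> lim] by simp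
          \<comment> \<open>The cut-off jumps only where \<open>\<tau> = t\<close>, a null set
            already excluded.\<close>
          have i: "(\<lambda>n. indicator {0..} (x n - \<tau>) :: real) \<longlonglongrightarrow> indicator {0..} (t - \<tau>)"
          proof (rule tendsto_eventually)
            show "\<forall>\<^sub>F n in sequentially. indicator {0..} (x n - \<tau>) = (indicator {0..} (t - \<tau>) :: real)"
            proof (cases "t > \<tau>")
              case True
              then have "\<forall>\<^sub>F n in sequentially. 0 < x n - \<tau>" using order_tendstoD(1)[OF lim, of 0] by auto
              then show ?thesis by eventually_elim (use True in \<open>auto simp: indicator_def\<close>)
            next
              case False
              then have "\<forall>\<^sub>F n in sequentially. x n - \<tau> < 0" using elim order_tendstoD(2)[OF lim, of 0] by auto
              then show ?thesis by eventually_elim (use False elim in \<open>auto simp: indicator_def\<close>)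
            qed
          qed
          show ?case by (intro tendsto_intros p i)
        qed
      qed measurable
    qed
  qed (use eq in auto)
qed

lemma volterra_conv_scalar_assoc:
  assumes r: "laplace_kernel r" and k: "laplace_kernel k" and \<phi>: "continuous_on UNIV (\<phi>::real\<Rightarrow>real)" and B: "\<And>t. \<bar>\<phi> t\<bar> \<le> B"
    and t: "0 \<le> t"
  shows "volterra_conv r (volterra_conv k \<phi>) t = volterra_conv (convolution r k) \<phi> t"
proof -
  note [measurable] = laplace_kernelD(1)[OF k] laplace_kernelD(1)[OF r] borel_measurable_continuous_onI[OF \<phi>]
  define p where "p \<tau> = indicator {0..} \<tau> * \<phi> \<tau>" for \<tau>
  have [measurable]: "p \<in> borel_measurable borel" unfolding p_def by measurable
  have eq: "volterra_conv k \<phi> \<tau> = convolution k p \<tau>" for \<tau>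
    unfolding p_def using volterra_conv_eq_convolution[OF k, of \<phi> \<tau> B] B by simp
  have neg: "convolution k p \<tau> = 0" if "\<tau> < 0" for \<tau>
    by (simp add: that volterra_conv_def flip: eq)
  obtain C where C: "\<And>\<tau>. \<tau> \<in> {0..t} \<Longrightarrow> \<bar>convolution k p \<tau>\<bar> \<le> C"
  proof -
    have "compact (convolution k p ` {0..t})"
      using volterra_conv_scalar_continuous[OF k \<phi> B, of t] eq by (intro compact_continuous_image) (auto simp: fun_eq_iff)
    then show ?thesis using that unfolding bounded_iff compact_eq_bounded_closed by (auto simp: image_iff) force
  qed
  have "volterra_conv r (volterra_conv k \<phi>) t = volterra_conv r (convolution k p) t" by (simp add: volterra_conv_def[of r] eq)
  also have "\<dots> = convolution r (\<lambda>\<tau>. indicator {0..} \<tau> * convolution k p \<tau>) t"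
    using volterra_conv_eq_convolution[OF r, of "convolution k p" t C] C by simp
  also have "(\<lambda>\<tau>. indicator {0..} \<tau> * convolution k p \<tau>) = convolution k p" using neg by (auto simp: indicator_def fun_eq_iff)
  also have "convolution r (convolution k p) t = convolution (convolution r k) p t"
  proof -
    \<comment> \<open>The kernels become integrable only after damping; the damped \<open>p\<close>
      is still bounded by \<open>B\<close> because \<open>p\<close> vanishes at negative
      times.\<close>
    let ?e = "\<lambda>f t. exp (- 1 * t) * f t"
    have e: "?e (convolution f g) = convolution (?e f) (?e g)" for f g using convolution_exp[of 1 _ f g] by (simp add: fun_eq_iff)
    have "exp (- 1 * t) * convolution r (convolution k p) t = convolution (?e r) (?e (convolution k p)) t" by (rule convolution_exp)
    also have "?e (convolution k p) = convolution (?e k) (?e p)" by (rule e)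
    also have "convolution (?e r) (convolution (?e k) (?e p)) t = convolution (convolution (?e r) (?e k)) (?e p) t"
    proof (rule convolution_assoc[where B = B])
      show "\<bar>exp (- 1 * t) * p t\<bar> \<le> B" for t
      proof (cases "0 \<le> t")
        case True
        then have "exp (- t) * \<bar>\<phi> t\<bar> \<le> 1 * \<bar>\<phi> t\<bar>" by (intro mult_right_mono) auto
        then show ?thesis using True B[of t] by (simp add: p_def abs_mult)
      qed (use B[of 0] in \<open>auto simp: p_def\<close>)
    qed (use laplace_kernelD(4)[OF r, of 1] laplace_kernelD(4)[OF k, of 1] in auto)
    also have "convolution (?e r) (?e k) = ?e (convolution r k)" by (rule e[symmetric])
    also have "convolution (?e (convolution r k)) (?e p) t = exp (- 1 * t) * convolution (convolution r k) p t" by (rule convolution_exp[symmetric])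
    finally show ?thesis by simp
  qed
  also have "\<dots> = volterra_conv (convolution r k) \<phi> t"
    unfolding p_def using volterra_conv_eq_convolution[OF laplace_kernel_convolution[OF r k], of \<phi> t B] B by simp
  finally show ?thesis .
qed

section \<open>Convolution with functions valued in a Banach space\<close>

lemma continuous_on_Icc_bounded:
  fixes f :: "real \<Rightarrow> 'a::real_normed_vector"
  assumes "continuous_on {a..b} f"
  obtains C where "0 < C" "\<And>x. x \<in> {a..b} \<Longrightarrow> norm (f x) \<le> C"
proof -
  have "compact (f ` {a..b})" by (intro compact_continuous_image assms) auto
  then have "bounded (f ` {a..b})" by (rule compact_imp_bounded)
  then show ?thesis unfolding bounded_pos by (elim exE conjE) (rule that, auto)
qed

text \<open>Since the codomain need not be separable, Fubini's theorem is only available for scalar functions;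
  uniform approximation by functions of finite rank transfers its consequences.\<close>

definition finite_rank :: "(real \<Rightarrow> 'a::real_normed_vector) \<Rightarrow> bool" where
  "finite_rank F \<longleftrightarrow> (\<exists>P (\<phi> :: real \<Rightarrow> real \<Rightarrow> real) x. finite P \<and>
     (\<forall>p\<in>P. continuous_on UNIV (\<phi> p) \<and> (\<forall>t. \<bar>\<phi> p t\<bar> \<le> 1)) \<and> F = (\<lambda>t. \<Sum>p\<in>P. \<phi> p t *\<^sub>R x p))"

lemma finite_rank_approx:
  fixes f :: "real \<Rightarrow> 'a::real_normed_vector"
  assumes f: "continuous_on {0..R} f" and R: "0 \<le> R"
  obtains F where "\<And>n::nat. finite_rank (F n)" "uniform_limit {0..R} F f sequentially"
    "\<And>n t. t \<in> {0..R} \<Longrightarrow> norm (f t - F n t) \<le> inverse (real (Suc n))"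
proof -
  have "\<exists>F. finite_rank F \<and> (\<forall>t\<in>{0..R}. norm (f t - F t) \<le> inverse (real (Suc n)))" for n
  proof -
    show ?thesis
    proof (rule partition_approx[OF f R, of "inverse (real (Suc n))"])
      fix P and \<phi> :: "real \<Rightarrow> real \<Rightarrow> real"
      assume P: "finite P" "\<And>p. p \<in> P \<Longrightarrow> continuous_on UNIV (\<phi> p)"
        "\<And>p t. p \<in> P \<Longrightarrow> 0 \<le> \<phi> p t \<and> \<phi> p t \<le> 1"
        "\<And>t. t \<in> {0..R} \<Longrightarrow> norm (f t - (\<Sum>p\<in>P. \<phi> p t *\<^sub>R f p)) \<le> inverse (real (Suc n))"
      have "finite_rank (\<lambda>t. \<Sum>p\<in>P. \<phi> p t *\<^sub>R f p)"
        unfolding finite_rank_def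
        by (intro exI[of _ P] exI[of _ \<phi>] exI[of _ f] conjI ballI allI refl P(1) P(2)) (use P(3) in auto)
      then show "\<exists>F. finite_rank F \<and> (\<forall>t\<in>{0..R}. norm (f t - F t) \<le> inverse (real (Suc n)))"
        using P(4) by blast
    qed auto
  qed
  then obtain F where F: "\<And>n. finite_rank (F n)" "\<And>n t. t \<in> {0..R} \<Longrightarrow> norm (f t - F n t) \<le> inverse (real (Suc n))"
    by metis
  have "uniform_limit {0..R} F f sequentially"
  proof (rule uniform_limitI)
    fix e :: real assume "0 < e"
    then have "\<forall>\<^sub>F n in sequentially. inverse (real (Suc n)) < e"
      using LIMSEQ_inverse_real_of_nat order_tendstoD(2) by blast
    then show "\<forall>\<^sub>F n in sequentially. \<forall>x\<in>{0..R}. dist (F n x) (f x) < e"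
      proof eventually_elim
      case (elim n)
      show ?case
      proof
        fix x assume "x \<in> {0..R}"
        from F(2)[OF this, of n] elim show "dist (F n x) (f x) < e" by (simp add: dist_norm norm_minus_commute)
      qed
    qed
  qed
  then show ?thesis by (rule that[OF F(1) _ F(2)])
qed

lemma finite_rank_continuous: "finite_rank F \<Longrightarrow> continuous_on A F"
  unfolding finite_rank_def by (auto intro!: continuous_intros intro: continuous_on_subset)

lemma laplace_kernel_integrable_on:
  assumes "laplace_kernel k" shows "(\<lambda>\<tau>. k (t - \<tau>)) integrable_on {0..t}"
  using set_borel_integral_eq_integral(1)[OF laplace_kernel_reflect_set_integrable[OF assms]] .

text \<open>The fixed vectors \<open>x p\<close> come out of all integrals, so each claim reduces to
  the scalar coefficients \<open>\<phi> p\<close>.\<close>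

lemma finite_rank_volterra_conv:
  fixes F :: "real \<Rightarrow> 'a::banach"
  assumes k: "laplace_kernel k" and F: "finite_rank F"
  shows "(\<lambda>\<tau>. k (t - \<tau>) *\<^sub>R F \<tau>) integrable_on {0..t}"
    and "continuous_on {0..R} (volterra_conv k F)"
    and "laplace_kernel r \<Longrightarrow> 0 \<le> t \<Longrightarrow> volterra_conv r (volterra_conv k F) t = volterra_conv (convolution r k) F t"
proof -
  obtain P and \<phi> :: "real \<Rightarrow> real \<Rightarrow> real" and x where P: "finite P"
     "\<And>p. p\<in>P \<Longrightarrow> continuous_on UNIV (\<phi> p)" "\<And>p t. p \<in> P \<Longrightarrow> \<bar>\<phi> p t\<bar> \<le> 1"
     and Feq: "F = (\<lambda>t. \<Sum>p\<in>P. \<phi> p t *\<^sub>R x p)"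
    using F unfolding finite_rank_def by (elim exE conjE) (rule that, auto)
  have int: "(\<lambda>\<tau>. k (t - \<tau>) *\<^sub>R \<phi> p \<tau>) integrable_on {0..t}" if p: "p \<in> P" and k: "laplace_kernel k" for k t p
    using set_borel_integral_eq_integral(1)[OF laplace_kernel_bounded_set_integrable[OF k, of "\<phi> p" t 1]]
      borel_measurable_continuous_onI[OF P(2)[OF p]] P(3)[OF p] by simp
  have rep: "((\<lambda>\<tau>. k (t - \<tau>) *\<^sub>R F \<tau>) has_integral (\<Sum>p\<in>P. volterra_conv k (\<phi> p) t *\<^sub>R x p)) {0..t}"
    if k: "laplace_kernel k" for k t
  proof -
    have "((\<lambda>\<tau>. \<Sum>p\<in>P. (k (t - \<tau>) *\<^sub>R \<phi> p \<tau>) *\<^sub>R x p) has_integral (\<Sum>p\<in>P. volterra_conv k (\<phi> p) t *\<^sub>R x p)) {0..t}"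
      unfolding volterra_conv_def
      by (intro has_integral_sum P(1) has_integral_scaleR_left integrable_integral int k)
    then show ?thesis by (simp add: Feq scaleR_sum_right)
  qed
  show "(\<lambda>\<tau>. k (t - \<tau>) *\<^sub>R F \<tau>) integrable_on {0..t}" using rep[OF k] by (rule has_integral_integrable)
  have veq: "volterra_conv k F = (\<lambda>t. \<Sum>p\<in>P. volterra_conv k (\<phi> p) t *\<^sub>R x p)" if "laplace_kernel k" for k
    using integral_unique[OF rep[OF that]] by (simp add: volterra_conv_def fun_eq_iff)
  have cont: "continuous_on {0..R} (volterra_conv k (\<phi> p))" if "p \<in> P" for p R
    using volterra_conv_scalar_continuous[OF k P(2) P(3)] that by blast
  show "continuous_on {0..R} (volterra_conv k F)"
    unfolding veq[OF k] by (intro continuous_intros cont)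
  show "volterra_conv r (volterra_conv k F) t = volterra_conv (convolution r k) F t" if r: "laplace_kernel r" and t: "0 \<le> t"
  proof -
    have int2: "(\<lambda>\<tau>. r (t - \<tau>) *\<^sub>R volterra_conv k (\<phi> p) \<tau>) integrable_on {0..t}" if p: "p \<in> P" for p
    proof -
      note [measurable] = laplace_kernelD(1)[OF k] borel_measurable_continuous_onI[OF P(2)[OF p]]
      \<comment> \<open>The convolution is Borel measurable on the whole line, which continuity on
        each \<open>{0..R}\<close> does not directly express.\<close>
      have eq: "volterra_conv k (\<phi> p) = convolution k (\<lambda>\<tau>. indicator {0..} \<tau> * \<phi> p \<tau>)"
        using volterra_conv_eq_convolution[OF k, of "\<phi> p" _ 1] P(3)[OF p] by (simp add: fun_eq_iff)
      have "volterra_conv k (\<phi> p) \<in> borel_measurable borel" unfolding eq by measurable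
      moreover obtain C where "\<And>\<tau>. \<tau> \<in> {0..t} \<Longrightarrow> \<bar>volterra_conv k (\<phi> p) \<tau>\<bar> \<le> C"
        using continuous_on_Icc_bounded[OF cont[OF p, of t]] by (metis real_norm_def)
      ultimately show ?thesis
        using set_borel_integral_eq_integral(1)[OF laplace_kernel_bounded_set_integrable[OF r, of "volterra_conv k (\<phi> p)" t C]] by simp
    qed
    have "volterra_conv r (volterra_conv k F) t = (\<Sum>p\<in>P. volterra_conv r (volterra_conv k (\<phi> p)) t *\<^sub>R x p)"
    proof -
      have "((\<lambda>\<tau>. \<Sum>p\<in>P. (r (t - \<tau>) *\<^sub>R volterra_conv k (\<phi> p) \<tau>) *\<^sub>R x p) has_integral (\<Sum>p\<in>P. volterra_conv r (volterra_conv k (\<phi> p)) t *\<^sub>R x p)) {0..t}"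
        unfolding volterra_conv_def[of r]
        by (intro has_integral_sum P(1) has_integral_scaleR_left integrable_integral int2)
      then have "((\<lambda>\<tau>. r (t - \<tau>) *\<^sub>R volterra_conv k F \<tau>) has_integral (\<Sum>p\<in>P. volterra_conv r (volterra_conv k (\<phi> p)) t *\<^sub>R x p)) {0..t}"
        by (simp add: veq[OF k] scaleR_sum_right)
      then show ?thesis by (subst volterra_conv_def) (rule integral_unique)
    qed
    also have "\<dots> = volterra_conv (convolution r k) F t"
      unfolding veq[OF laplace_kernel_convolution[OF r k]]
      by (intro sum.cong refl arg_cong2[where f = scaleR] volterra_conv_scalar_assoc[OF r k P(2) P(3)] t)
    finally show ?thesis .
  qed
qed

text \<open>A uniform error e in the continuous factor is an error of at most e times
  \<open>k (t - x)\<close> in the integrand, which is the form that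
  \<open>integrable_on_dominated_approx\<close> accepts.\<close>

lemma volterra_conv_integrable:
  fixes f :: "real \<Rightarrow> 'a::banach"
  assumes k: "laplace_kernel k" and f: "continuous_on {0..t} f"
  shows "(\<lambda>\<tau>. k (t - \<tau>) *\<^sub>R f \<tau>) integrable_on {0..t}"
proof (cases "0 \<le> t")
  case True
  obtain F where F: "\<And>n::nat. finite_rank (F n)" 
    "\<And>n \<tau>. \<tau> \<in> {0..t} \<Longrightarrow> norm (f \<tau> - F n \<tau>) \<le> inverse (real (Suc n))"
    by (rule finite_rank_approx[OF f True]) blast
  show ?thesis
  proof (rule integrable_on_dominated_approx[OF laplace_kernel_integrable_on[OF k]])
    show "0 \<le> k (t - x)" for x by (rule laplace_kernelD(2)[OF k])
    fix e :: real assume "0 < e"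
    then obtain n where n: "inverse (real (Suc n)) < e" using reals_Archimedean by blast
    show "\<exists>g. g integrable_on {0..t} \<and> (\<forall>x\<in>{0..t}. norm (k (t - x) *\<^sub>R f x - g x) \<le> e * k (t - x))"
    proof (intro exI[of _ "\<lambda>\<tau>. k (t - \<tau>) *\<^sub>R F n \<tau>"] conjI ballI finite_rank_volterra_conv(1)[OF k F(1)])
      fix x assume x: "x \<in> {0..t}"
      have "norm (k (t - x) *\<^sub>R (f x - F n x)) \<le> k (t - x) * e"
        using laplace_kernelD(2)[OF k, of "t - x"] F(2)[OF x, of n] n by (simp add: mult_left_mono)
      then show "norm (k (t - x) *\<^sub>R f x - k (t - x) *\<^sub>R F n x) \<le> e * k (t - x)"
        by (simp add: scaleR_diff_right mult.commute)
    qed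
  qed
qed auto

lemma volterra_conv_has_integral:
  fixes f :: "real \<Rightarrow> 'a::banach"
  assumes "laplace_kernel k" "continuous_on {0..t} f"
  shows "((\<lambda>\<tau>. k (t - \<tau>) *\<^sub>R f \<tau>) has_integral volterra_conv k f t) {0..t}"
  unfolding volterra_conv_def by (intro integrable_integral volterra_conv_integrable assms)

lemma volterra_conv_norm:
  fixes f :: "real \<Rightarrow> 'a::banach"
  assumes k: "laplace_kernel k" and f: "continuous_on {0..t} f" and g: "continuous_on {0..t} g"
    and le: "\<And>\<tau>. \<tau> \<in> {0..t} \<Longrightarrow> norm (f \<tau>) \<le> g \<tau>"
  shows "norm (volterra_conv k f t) \<le> volterra_conv k g t"
  unfolding volterra_conv_def
  by (intro integral_norm_bound_integral volterra_conv_integrable assms)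
     (use laplace_kernelD(2)[OF k] le in \<open>auto intro!: mult_left_mono\<close>)

lemma volterra_conv_mono:
  fixes f g :: "real \<Rightarrow> real"
  assumes k: "laplace_kernel k" and f: "continuous_on {0..t} f" and g: "continuous_on {0..t} g"
    and le: "\<And>\<tau>. \<tau> \<in> {0..t} \<Longrightarrow> f \<tau> \<le> g \<tau>"
  shows "volterra_conv k f t \<le> volterra_conv k g t"
  unfolding volterra_conv_def
  by (intro integral_le volterra_conv_integrable assms)
     (use laplace_kernelD(2)[OF k] le in \<open>auto intro!: mult_left_mono\<close>)

lemma volterra_conv_cong:
  "(\<And>\<tau>. \<tau> \<in> {0..t} \<Longrightarrow> f \<tau> = g \<tau>) \<Longrightarrow> volterra_conv k f t = volterra_conv k g t"
  unfolding volterra_conv_def by (intro integral_cong) auto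

lemma volterra_conv_add:
  fixes f :: "real \<Rightarrow> 'a::banach"
  assumes k: "laplace_kernel k" and f: "continuous_on {0..t} f" and g: "continuous_on {0..t} g"
  shows "volterra_conv k (\<lambda>\<tau>. f \<tau> + g \<tau>) t = volterra_conv k f t + volterra_conv k g t"
  unfolding volterra_conv_def scaleR_add_right
  by (intro integral_add volterra_conv_integrable assms)

lemma volterra_conv_diff:
  fixes f :: "real \<Rightarrow> 'a::banach"
  assumes k: "laplace_kernel k" and f: "continuous_on {0..t} f" and g: "continuous_on {0..t} g"
  shows "volterra_conv k (\<lambda>\<tau>. f \<tau> - g \<tau>) t = volterra_conv k f t - volterra_conv k g t"
  unfolding volterra_conv_def scaleR_diff_right
  by (intro integral_diff volterra_conv_integrable assms)

lemma volterra_conv_bounded_linear: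
  fixes f :: "real \<Rightarrow> 'a::banach"
  assumes k: "laplace_kernel k" and f: "continuous_on {0..t} f" and B: "bounded_linear B"
  shows "volterra_conv k (\<lambda>\<tau>. B (f \<tau>)) t = B (volterra_conv k f t)"
  using integral_linear[OF volterra_conv_integrable[OF k f] B]
  by (simp add: volterra_conv_def comp_def linear_simps(5)[OF B])

lemma volterra_conv_scaleR:
  fixes f :: "real \<Rightarrow> 'a::banach"
  assumes "laplace_kernel k" "continuous_on {0..t} f"
  shows "volterra_conv k (\<lambda>\<tau>. c *\<^sub>R f \<tau>) t = c *\<^sub>R volterra_conv k f t"
  by (rule volterra_conv_bounded_linear[OF assms bounded_linear_scaleR_right])

lemma volterra_conv_scaleR_const:
  fixes x :: "'a::banach"
  assumes "laplace_kernel k" "continuous_on {0..t} f"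
  shows "volterra_conv k (\<lambda>\<tau>. f \<tau> *\<^sub>R x) t = volterra_conv k f t *\<^sub>R x"
  by (rule volterra_conv_bounded_linear[OF assms bounded_linear_scaleR_left])

lemma volterra_conv_norm_const:
  fixes f :: "real \<Rightarrow> 'a::banach"
  assumes k: "laplace_kernel k" and f: "continuous_on {0..t} f"
    and le: "\<And>\<tau>. \<tau> \<in> {0..t} \<Longrightarrow> norm (f \<tau>) \<le> C"
  shows "norm (volterra_conv k f t) \<le> C * volterra_conv k (\<lambda>_. 1) t"
  using volterra_conv_norm[OF k f, of "\<lambda>_. C *\<^sub>R 1"] le volterra_conv_scaleR[OF k, of t "\<lambda>_. 1::real" C] by simp

lemma volterra_conv_one_nonneg: "laplace_kernel k \<Longrightarrow> 0 \<le> volterra_conv k (\<lambda>_. 1::real) t"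
  unfolding volterra_conv_def using laplace_kernelD(2) by (intro integral_nonneg) (auto intro: laplace_kernel_integrable_on)

lemma volterra_conv_one_continuous: "laplace_kernel k \<Longrightarrow> continuous_on {0..R} (volterra_conv k (\<lambda>_. 1::real))"
  by (rule volterra_conv_scalar_continuous[where B = 1]) auto

lemma volterra_conv_uniform_limit:
  fixes f :: "real \<Rightarrow> 'a::banach"
  assumes k: "laplace_kernel k" and F: "\<And>n. continuous_on {0..R} (F n)" and f: "continuous_on {0..R} f"
    and lim: "uniform_limit {0..R} F f sequentially"
  shows "uniform_limit {0..R} (\<lambda>n. volterra_conv k (F n)) (volterra_conv k f) sequentially"
proof (rule uniform_limitI)
  fix e :: real assume e: "0 < e"
  obtain C where C: "0 < C" "\<And>t. t \<in> {0..R} \<Longrightarrow> norm (volterra_conv k (\<lambda>_. 1::real) t) \<le> C"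
    using continuous_on_Icc_bounded[OF volterra_conv_one_continuous[OF k]] by blast
  have "\<forall>\<^sub>F n in sequentially. \<forall>x\<in>{0..R}. dist (F n x) (f x) < e / (2 * C)"
    using lim e C(1) by (intro uniform_limitD) auto
  then show "\<forall>\<^sub>F n in sequentially. \<forall>x\<in>{0..R}. dist (volterra_conv k (F n) x) (volterra_conv k f x) < e"
  proof eventually_elim
    case (elim n)
    show ?case
    proof
      fix t assume t: "t \<in> {0..R}"
      have sub: "{0..t} \<subseteq> {0..R}" using t by auto
      note c = continuous_on_subset[OF F sub] continuous_on_subset[OF f sub]
      have "norm (volterra_conv k (F n) t - volterra_conv k f t) = norm (volterra_conv k (\<lambda>\<tau>. F n \<tau> - f \<tau>) t)"
        by (simp add: volterra_conv_diff[OF k c])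
      also have "\<dots> \<le> e / (2 * C) * volterra_conv k (\<lambda>_. 1) t"
        using elim sub by (intro volterra_conv_norm_const k continuous_intros c) (auto simp: dist_norm less_imp_le)
      also have "\<dots> \<le> e / (2 * C) * C" using C e t by (intro mult_left_mono) fastforce+
      also have "\<dots> < e" using C e by simp
      finally show "dist (volterra_conv k (F n) t) (volterra_conv k f t) < e" by (simp add: dist_norm)
    qed
  qed
qed

lemma volterra_conv_continuous:
  fixes f :: "real \<Rightarrow> 'a::banach"
  assumes k: "laplace_kernel k" and f: "continuous_on {0..R} f"
  shows "continuous_on {0..R} (volterra_conv k f)"
proof (cases "0 \<le> R")
  case True
  obtain F where F: "\<And>n::nat. finite_rank (F n)" "uniform_limit {0..R} F f sequentially"
    by (rule finite_rank_approx[OF f True]) blast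
  show ?thesis
    by (rule uniform_limit_theorem[OF _ volterra_conv_uniform_limit[OF k finite_rank_continuous[OF F(1)] f F(2)]])
       (use finite_rank_volterra_conv(2)[OF k F(1)] in auto)
qed auto

lemma volterra_conv_assoc:
  fixes f :: "real \<Rightarrow> 'a::banach"
  assumes r: "laplace_kernel r" and k: "laplace_kernel k" and f: "continuous_on {0..t} f" and t: "0 \<le> t"
  shows "volterra_conv r (volterra_conv k f) t = volterra_conv (convolution r k) f t"
proof -
  obtain F where F: "\<And>n::nat. finite_rank (F n)" "uniform_limit {0..t} F f sequentially"
    by (rule finite_rank_approx[OF f t]) blast
  note cF = finite_rank_continuous[OF F(1)]
  have t': "t \<in> {0..t}" using t by simp
  have "(\<lambda>n. volterra_conv r (volterra_conv k (F n)) t) \<longlonglongrightarrow> volterra_conv r (volterra_conv k f) t"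
    by (intro tendsto_uniform_limitI[OF _ t'] volterra_conv_uniform_limit r k volterra_conv_continuous cF f F(2))
  moreover have "(\<lambda>n. volterra_conv (convolution r k) (F n) t) \<longlonglongrightarrow> volterra_conv (convolution r k) f t"
    by (intro tendsto_uniform_limitI[OF _ t'] volterra_conv_uniform_limit laplace_kernel_convolution r k cF f F(2))
  ultimately show ?thesis
    using LIMSEQ_unique finite_rank_volterra_conv(3)[OF k F(1) r t] by simp
qed

text \<open>The exceptional set is reflected at \<open>t\<close>, and a differentiable map sends
  null sets to null sets. Hence the notion of strong solution depends on the kernel only up to null
  sets.\<close>

lemma has_integral_kernel_AE_cong:
  fixes f :: "real \<Rightarrow> 'a::real_normed_vector"
  assumes "AE \<tau> in lebesgue. 0 \<le> \<tau> \<longrightarrow> k \<tau> = k' \<tau>"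
  shows "((\<lambda>\<tau>. k (t - \<tau>) *\<^sub>R f \<tau>) has_integral y) {0..t} \<longleftrightarrow> ((\<lambda>\<tau>. k' (t - \<tau>) *\<^sub>R f \<tau>) has_integral y) {0..t}"
proof -
  obtain N where N: "\<And>\<tau>. \<tau> \<in> space lebesgue - N \<Longrightarrow> 0 \<le> \<tau> \<longrightarrow> k \<tau> = k' \<tau>" "N \<in> null_sets lebesgue"
    by (rule AE_E3[OF assms], rule that)
  define N' where "N' = (\<lambda>x. t - x) ` N"
  have "negligible N" using N(2) by (simp add: negligible_iff_null_sets)
  then have "negligible N'"
    unfolding N'_def by (intro negligible_differentiable_image_negligible derivative_intros) auto
  then show ?thesis
  proof (rule has_integral_spike_eq)
    fix \<tau> assume \<tau>: "\<tau> \<in> {0..t} - N'"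
    then have "t - \<tau> \<notin> N" unfolding N'_def by (auto simp: image_iff)
    then show "k' (t - \<tau>) *\<^sub>R f \<tau> = k (t - \<tau>) *\<^sub>R f \<tau>" using N(1)[of "t - \<tau>"] \<tau> by simp
  qed
qed

lemma volterra_conv_AE_cong:
  assumes "AE \<tau> in lebesgue. 0 \<le> \<tau> \<longrightarrow> k \<tau> = k' \<tau>"
  shows "volterra_conv k f t = volterra_conv k' f t"
  unfolding volterra_conv_def integral_def integrable_on_def has_integral_kernel_AE_cong[OF assms] ..

section \<open>Resolvent kernels\<close>

text \<open>The last two clauses are quantitative: mass at most 1 for \<open>\<mu> * r\<close> on
  every \<open>{0..t}\<close> makes the iterates \<open>e\<close> decrease, and a Laplace transform
  below 1 at s = 1 makes them decay geometrically.\<close>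

definition resolvent_kernel :: "real \<Rightarrow> (real \<Rightarrow> real) \<Rightarrow> (real \<Rightarrow> real) \<Rightarrow> bool" where
  "resolvent_kernel \<mu> k r \<longleftrightarrow> laplace_kernel r \<and> (AE t in lborel. k t = r t + \<mu> * convolution r k t) \<and>
     (\<forall>t. \<mu> * volterra_conv r (\<lambda>_. 1) t \<le> 1) \<and> \<mu> * (\<integral>t. exp (- t) * r t \<partial>lborel) < 1"

locale resolvent_pair =
  fixes \<mu> :: real and k r :: "real \<Rightarrow> real"
  assumes \<mu>: "0 < \<mu>" and k: "laplace_kernel k" and res: "resolvent_kernel \<mu> k r"
begin

lemma r: "laplace_kernel r"
  and r_AE: "AE t in lborel. k t = r t + \<mu> * convolution r k t"
  and r_le: "\<mu> * volterra_conv r (\<lambda>_. 1) t \<le> 1"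
  and r_lap: "\<mu> * (\<integral>t. exp (- t) * r t \<partial>lborel) < 1"
  using res by (auto simp: resolvent_kernel_def)

lemma volterra_conv_convolution_eq:
  fixes f :: "real \<Rightarrow> 'a::banach"
  assumes f: "continuous_on {0..t} f"
  shows "volterra_conv k f t = volterra_conv r f t + \<mu> *\<^sub>R volterra_conv (convolution r k) f t"
proof -
  have "volterra_conv k f t = volterra_conv (\<lambda>t. r t + \<mu> * convolution r k t) f t"
    by (rule volterra_conv_AE_cong) (use AE_completion[OF r_AE] in auto)
  also have "\<dots> = volterra_conv r f t + \<mu> *\<^sub>R volterra_conv (convolution r k) f t"
    unfolding volterra_conv_def[of "\<lambda>t. r t + \<mu> * convolution r k t"]
  proof (rule integral_unique)
    have "((\<lambda>\<tau>. r (t - \<tau>) *\<^sub>R f \<tau> + \<mu> *\<^sub>R (convolution r k (t - \<tau>) *\<^sub>R f \<tau>)) has_integral volterra_conv r f t + \<mu> *\<^sub>R volterra_conv (convolution r k) f t) {0..t}"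
      by (intro has_integral_add has_integral_cmul volterra_conv_has_integral r laplace_kernel_convolution k f)
    then show "((\<lambda>\<tau>. (r (t - \<tau>) + \<mu> * convolution r k (t - \<tau>)) *\<^sub>R f \<tau>) has_integral volterra_conv r f t + \<mu> *\<^sub>R volterra_conv (convolution r k) f t) {0..t}"
      by (simp add: scaleR_add_left)
  qed
  finally show ?thesis .
qed

lemma volterra_conv_resolvent1:
  fixes f :: "real \<Rightarrow> 'a::banach"
  assumes f: "continuous_on {0..t} f" and t: "0 \<le> t"
  shows "volterra_conv k f t = volterra_conv r f t + \<mu> *\<^sub>R volterra_conv r (volterra_conv k f) t"
  using volterra_conv_convolution_eq[OF f] volterra_conv_assoc[OF r k f t] by simp

lemma volterra_conv_resolvent2:
  fixes f :: "real \<Rightarrow> 'a::banach"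
  assumes f: "continuous_on {0..t} f" and t: "0 \<le> t"
  shows "volterra_conv k f t = volterra_conv r f t + \<mu> *\<^sub>R volterra_conv k (volterra_conv r f) t"
  using volterra_conv_convolution_eq[OF f] volterra_conv_assoc[OF k r f t] by (simp add: convolution_commute[of k r, abs_def])

text \<open>The term \<open>- \<mu> *\<^sub>R w\<close> is absorbed into the kernel. With f = \<mu>
  J w + g the equation is w + \<mu> k*w = k*f, and convolving it with \<open>r\<close> gives w =
  r*f. No term with a minus sign is left, so norms can be taken under the integral without
  loss.\<close>

lemma volterra_resolvent_form:
  fixes w g :: "real \<Rightarrow> 'a::banach"
  assumes w: "continuous_on {0..R} w" and g: "continuous_on {0..R} g" and J: "bounded_linear J"
    and eq: "\<And>t. t \<in> {0..R} \<Longrightarrow> w t = volterra_conv k (\<lambda>\<tau>. \<mu> *\<^sub>R (J (w \<tau>) - w \<tau>) + g \<tau>) t"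
    and t: "t \<in> {0..R}"
  shows "w t = volterra_conv r (\<lambda>\<tau>. \<mu> *\<^sub>R J (w \<tau>) + g \<tau>) t"
proof -
  define f where "f \<tau> = \<mu> *\<^sub>R J (w \<tau>) + g \<tau>" for \<tau>
  have Jw: "continuous_on {0..R} (\<lambda>\<tau>. J (w \<tau>))" by (rule bounded_linear.continuous_on[OF J w])
  have fc: "continuous_on {0..R} f" unfolding f_def by (intro continuous_intros Jw g)
  have sub: "continuous_on {0..s} h" if "s \<in> {0..R}" "continuous_on {0..R} h" for s and h :: "real \<Rightarrow> 'a"
    by (rule continuous_on_subset[OF that(2)]) (use that in auto)
  have A: "w s + \<mu> *\<^sub>R volterra_conv k w s = volterra_conv k f s" if s: "s \<in> {0..R}" for s
  proof -
    have "w s = volterra_conv k (\<lambda>\<tau>. f \<tau> - \<mu> *\<^sub>R w \<tau>) s"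
      using eq[OF s] by (simp add: f_def algebra_simps)
    also have "\<dots> = volterra_conv k f s - \<mu> *\<^sub>R volterra_conv k w s"
      using s fc w by (simp add: volterra_conv_diff[OF k] volterra_conv_scaleR[OF k] sub continuous_intros)
    finally show ?thesis by simp
  qed
  have t0: "0 \<le> t" using t by simp
  \<comment> \<open>Both sides are convolved with \<open>r\<close>. By k = r + \<mu> r*k, the right
    side collapses to k*w, while \<mu> times the left side is k*f - r*f.\<close>
  have "volterra_conv r (volterra_conv k f) t = volterra_conv r (\<lambda>s. w s + \<mu> *\<^sub>R volterra_conv k w s) t"
    by (rule volterra_conv_cong) (use A t in auto)
  also have "\<dots> = volterra_conv r w t + \<mu> *\<^sub>R volterra_conv r (volterra_conv k w) t"
    using sub[OF t w] volterra_conv_continuous[OF k sub[OF t w]]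
    by (simp add: volterra_conv_add[OF r] volterra_conv_scaleR[OF r] continuous_intros)
  also have "\<dots> = volterra_conv k w t" using volterra_conv_resolvent1[OF sub[OF t w] t0] by simp
  finally have "volterra_conv k f t = volterra_conv r f t + \<mu> *\<^sub>R volterra_conv k w t"
    using volterra_conv_resolvent1[OF sub[OF t fc] t0] by simp
  with A[OF t] have "w t = volterra_conv r f t" by simp
  then show ?thesis unfolding f_def .
qed

text \<open>A Gronwall inequality whose bound is free of \<mu>. Adding \<mu> times its own
  convolution with \<open>k\<close> to the hypothesis turns the right side into k*(\<mu> \<phi> +
  \<gamma>), and the term \<mu> k*\<phi> cancels; the step is monotone because k \<ge> 0.\<close>

lemma comparison:
  fixes \<phi> \<gamma> :: "real \<Rightarrow> real"
  assumes \<phi>: "continuous_on {0..R} \<phi>" and \<gamma>: "continuous_on {0..R} \<gamma>"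
    and le: "\<And>t. t \<in> {0..R} \<Longrightarrow> \<phi> t \<le> volterra_conv r (\<lambda>\<tau>. \<mu> * \<phi> \<tau> + \<gamma> \<tau>) t"
    and t: "t \<in> {0..R}"
  shows "\<phi> t \<le> volterra_conv k \<gamma> t"
proof -
  define f where "f \<tau> = \<mu> * \<phi> \<tau> + \<gamma> \<tau>" for \<tau>
  have sub: "continuous_on {0..t} h" if "continuous_on {0..R} h" for h :: "real \<Rightarrow> real"
    by (rule continuous_on_subset[OF that]) (use t in auto)
  have fc: "continuous_on {0..t} f" unfolding f_def by (intro continuous_intros sub \<phi> \<gamma>)
  have "\<phi> t + \<mu> * volterra_conv k \<phi> t \<le> volterra_conv r f t + \<mu> * volterra_conv k (volterra_conv r f) t"
    using le t \<mu> unfolding f_def[symmetric, abs_def]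
    by (intro add_mono mult_left_mono volterra_conv_mono k sub[OF \<phi>] volterra_conv_continuous r fc) auto
  also have "\<dots> = volterra_conv k f t" using volterra_conv_resolvent2[OF fc] t by simp
  also have "\<dots> = \<mu> * volterra_conv k \<phi> t + volterra_conv k \<gamma> t"
    unfolding f_def using volterra_conv_scaleR[OF k sub[OF \<phi>], of \<mu>] sub[OF \<phi>] sub[OF \<gamma>]
    by (simp add: volterra_conv_add[OF k] continuous_intros)
  finally show ?thesis by simp
qed

text \<open>Iterated convolution of 1 with \<mu> r. In the renewal process with waiting time density
  \<mu> r, \<open>e n t\<close> is the probability of at least n renewals up to time t \<ge> 0, and
  the difference \<open>c n t\<close> below that of exactly n. The \<open>c n t\<close> therefore
  sum to 1 as soon as \<open>e n t\<close> tends to 0.\<close>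

fun e :: "nat \<Rightarrow> real \<Rightarrow> real" where
  "e 0 = (\<lambda>t. 1)"
| "e (Suc n) = (\<lambda>t. \<mu> * volterra_conv r (e n) t)"

lemma e_continuous: "continuous_on {0..R} (e n)"
  by (induction n arbitrary: R) (auto intro!: continuous_intros volterra_conv_continuous r)

lemma e_antimono: "e (Suc n) t \<le> e n t"
proof (induction n arbitrary: t)
  case 0 then show ?case using r_le by simp
next
  case (Suc n)
  have "volterra_conv r (e (Suc n)) t \<le> volterra_conv r (e n) t"
    by (intro volterra_conv_mono r e_continuous Suc)
  then show ?case using \<mu> by simp
qed

lemma e_nonneg: "0 \<le> e n t"
proof (induction n arbitrary: t)
  case (Suc n)
  have "volterra_conv r (\<lambda>_. 0) t \<le> volterra_conv r (e n) t"
    by (intro volterra_conv_mono r e_continuous Suc) auto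
  then show ?case using \<mu> by (simp add: volterra_conv_def)
qed auto

text \<open>The contraction factor of convolution with \<mu> r when functions are measured against
  the weight exp t.\<close>

definition q where "q = \<mu> * (\<integral>t. exp (- t) * r t \<partial>lborel)"

lemma q: "0 \<le> q" "q < 1"
  using r_lap \<mu> laplace_kernelD(2)[OF r] unfolding q_def by (auto intro!: mult_nonneg_nonneg Bochner_Integration.integral_nonneg)

lemma volterra_conv_exp_le:
  "volterra_conv r exp t \<le> exp t * (\<integral>t. exp (- t) * r t \<partial>lborel)"
proof -
  note [measurable] = laplace_kernelD(1)[OF r]
  have int: "integrable lborel (\<lambda>\<tau>. exp (- (t - \<tau>)) * r (t - \<tau>))"
    using integrable_reflect_shift[OF laplace_kernelD(4)[OF r, of 1], of t] by simp
  have "volterra_conv r exp t = convolution r (\<lambda>\<tau>. indicator {0..} \<tau> * exp \<tau>) t"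
    by (rule volterra_conv_eq_convolution[OF r, of exp t "exp t"]) auto
  also have "\<dots> \<le> (\<integral>\<tau>. exp t * (exp (- (t - \<tau>)) * r (t - \<tau>)) \<partial>lborel)"
    unfolding convolution_def
  proof (rule integral_mono_AE')
    show "integrable lborel (\<lambda>\<tau>. exp t * (exp (- (t - \<tau>)) * r (t - \<tau>)))" using int by simp
    show "AE \<tau> in lborel. r (t - \<tau>) * (indicator {0..} \<tau> * exp \<tau>) \<le> exp t * (exp (- (t - \<tau>)) * r (t - \<tau>))"
      using laplace_kernelD(2)[OF r] by (intro AE_I2) (auto simp: indicator_def exp_diff exp_minus field_simps)
    show "AE \<tau> in lborel. 0 \<le> exp t * (exp (- (t - \<tau>)) * r (t - \<tau>))"
      using laplace_kernelD(2)[OF r] by (intro AE_I2) auto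
  qed
  also have "\<dots> = exp t * (\<integral>t. exp (- t) * r t \<partial>lborel)"
    using integral_reflect_shift[of "\<lambda>t. exp (- t) * r t" t] by simp
  finally show ?thesis .
qed

lemma e_geometric: "0 \<le> t \<Longrightarrow> e n t \<le> q ^ n * exp t"
proof (induction n arbitrary: t)
  case (Suc n)
  have "e (Suc n) t = \<mu> * volterra_conv r (e n) t" by simp
  also have "\<dots> \<le> \<mu> * volterra_conv r (\<lambda>\<tau>. q ^ n *\<^sub>R exp \<tau>) t"
    using \<mu> Suc.IH by (intro mult_left_mono volterra_conv_mono r e_continuous continuous_intros) auto
  also have "\<dots> = q ^ n * (\<mu> * volterra_conv r exp t)" by (subst volterra_conv_scaleR[OF r]) (auto intro!: continuous_intros)
  also have "\<dots> \<le> q ^ n * (\<mu> * (exp t * (\<integral>t. exp (- t) * r t \<partial>lborel)))"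
    using volterra_conv_exp_le \<mu> q by (intro mult_left_mono) auto
  finally show ?case by (simp add: q_def mult_ac)
qed auto

text \<open>The resolvent identity applied to \<open>e n\<close>. It returns from \<open>r\<close>
  to the original kernel \<open>k\<close>, and is the scalar form of the Volterra equation for the
  series \<open>S\<^sub>h\<close>.\<close>

lemma e_volterra_conv:
  assumes "0 \<le> t"
  shows "e (Suc n) t = \<mu> * volterra_conv k (\<lambda>\<tau>. e n \<tau> - e (Suc n) \<tau>) t"
proof -
  have "\<mu> * volterra_conv k (e (Suc n)) t = \<mu> * (\<mu> * volterra_conv k (volterra_conv r (e n)) t)"
    using volterra_conv_scaleR[OF k volterra_conv_continuous[OF r e_continuous[of t n]], of \<mu>] by simp
  moreover have "volterra_conv k (e n) t = volterra_conv r (e n) t + \<mu> * volterra_conv k (volterra_conv r (e n)) t"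
    using volterra_conv_resolvent2[OF e_continuous assms] by simp
  moreover have "volterra_conv k (\<lambda>\<tau>. e n \<tau> - e (Suc n) \<tau>) t = volterra_conv k (e n) t - volterra_conv k (e (Suc n)) t"
    by (rule volterra_conv_diff[OF k e_continuous e_continuous])
  moreover have "e (Suc n) t = \<mu> * volterra_conv r (e n) t" by simp
  ultimately show ?thesis
    by (auto simp: algebra_simps simp del: e.simps)
qed

definition c where "c n t = e n t - e (Suc n) t"

lemma c_nonneg: "0 \<le> c n t" and c_continuous: "continuous_on {0..R} (c n)"
  using e_antimono by (auto simp: c_def[abs_def] simp del: e.simps intro!: continuous_intros e_continuous)

lemma c_le: "0 \<le> t \<Longrightarrow> c n t \<le> q ^ n * exp t"
  using e_geometric[of t n] e_nonneg[of "Suc n" t] by (simp add: c_def del: e.simps)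

lemma e_tendsto: assumes "0 \<le> t" shows "(\<lambda>n. e n t) \<longlonglongrightarrow> 0"
proof (rule tendsto_sandwich[OF _ _ tendsto_const])
  show "(\<lambda>n. q ^ n * exp t) \<longlonglongrightarrow> 0" using LIMSEQ_power_zero[of q] q by (intro tendsto_mult_left_zero) auto
qed (use e_nonneg e_geometric[OF assms] in auto)

lemma c_sums: assumes "0 \<le> t" shows "(\<lambda>n. c n t) sums 1"
  using telescope_sums'[OF e_tendsto[OF assms]] by (simp add: c_def)

end

section \<open>Volterra equations for bounded semigroups\<close>

locale bounded_semigroup =
  fixes T :: "real \<Rightarrow> 'a::banach \<Rightarrow>\<^sub>L 'a" and M :: real
  assumes C0: "C0_semigroup T" and bound: "\<And>t. 0 \<le> t \<Longrightarrow> norm (T t) \<le> M"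
begin

lemma M_nonneg: "0 \<le> M"
  using bound[of 0] norm_ge_zero[of "T 0"] by linarith

lemma norm_T: "0 \<le> t \<Longrightarrow> norm (T t x) \<le> M * norm x"
  using norm_blinfun[of "T t" x] bound[of t] mult_right_mono[of "norm (T t)" M "norm x"] by simp

lemma T_0: "T 0 x = x"
  using C0 by (simp add: C0_semigroup_def)

lemma T_add: "0 \<le> s \<Longrightarrow> 0 \<le> t \<Longrightarrow> T (s + t) x = T s (T t x)"
  using C0 by (simp add: C0_semigroup_def)

lemma T_commute: "0 \<le> s \<Longrightarrow> 0 \<le> t \<Longrightarrow> T s (T t x) = T t (T s x)"
  using T_add[of s t] T_add[of t s] by (simp add: add.commute)

lemma T_right_limit: "((\<lambda>t. T t x) \<longlongrightarrow> x) (at_right 0)"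
  using C0 by (simp add: C0_semigroup_def)

lemma norm_T_diff:
  assumes "0 \<le> s" "0 \<le> t"
  shows "norm (T t x - T s x) \<le> M * norm (T \<bar>t - s\<bar> x - x)"
proof -
  have *: "norm (T t x - T s x) \<le> M * norm (T (t - s) x - x)" if "0 \<le> s" "s \<le> t" for s t
  proof -
    have "T t x - T s x = T s (T (t - s) x - x)"
      using T_add[of s "t - s" x] that by (simp add: blinfun.diff_right)
    then show ?thesis using norm_T[of s] that by simp
  qed
  show ?thesis using *[of s t] *[of t s] assms by (cases "s \<le> t") (auto simp: norm_minus_commute)
qed

lemma T_continuous: "continuous_on {0..} (\<lambda>t. T t x)"
  unfolding continuous_on_iff
proof (intro ballI allI impI)
  fix s \<epsilon> :: real assume s: "s \<in> {0..}" and \<epsilon>: "0 < \<epsilon>"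
  \<comment> \<open>\<open>M\<close> may be 0, hence the denominator \<open>M + 1\<close>.\<close>
  have "\<forall>\<^sub>F t in at_right 0. dist (T t x) x < \<epsilon> / (M + 1)"
    using T_right_limit[of x] \<epsilon> M_nonneg by (intro tendstoD) auto
  then obtain d where d: "0 < d" "\<And>t. 0 < t \<Longrightarrow> t < d \<Longrightarrow> norm (T t x - x) < \<epsilon> / (M + 1)"
    unfolding eventually_at_right_field by (auto simp: dist_norm)
  show "\<exists>d>0. \<forall>t\<in>{0..}. dist t s < d \<longrightarrow> dist (T t x) (T s x) < \<epsilon>"
  proof (intro exI[of _ d] conjI ballI impI d(1))
    fix t assume t: "t \<in> {0..}" "dist t s < d"
    have "norm (T \<bar>t - s\<bar> x - x) < \<epsilon> / (M + 1)"
      using d(2)[of "\<bar>t - s\<bar>"] t \<epsilon> M_nonneg by (cases "t = s") (auto simp: dist_real_def T_0)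
    then have "M * norm (T \<bar>t - s\<bar> x - x) \<le> M * (\<epsilon> / (M + 1))"
      using M_nonneg by (intro mult_left_mono) auto
    also have "\<dots> < \<epsilon>" using M_nonneg \<epsilon> by (simp add: field_simps)
    finally show "dist (T t x) (T s x) < \<epsilon>"
      using norm_T_diff[of s t x] s t by (simp add: dist_norm)
  qed
qed

text \<open>An equivalent norm for which the semigroup is contractive.\<close>

definition N :: "'a \<Rightarrow> real" where "N x = (SUP s\<in>{0..}. norm (T s x))"

lemma N_bdd: "bdd_above ((\<lambda>s. norm (T s x)) ` {0..})"
  using norm_T by (intro bdd_aboveI2[where M = "M * norm x"]) auto

lemma N_ge: "0 \<le> s \<Longrightarrow> norm (T s x) \<le> N x"
  unfolding N_def by (intro cSUP_upper N_bdd) auto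

lemma N_leI: "(\<And>s. 0 \<le> s \<Longrightarrow> norm (T s x) \<le> b) \<Longrightarrow> N x \<le> b"
  unfolding N_def by (intro cSUP_least) auto

lemma norm_le_N: "norm x \<le> N x" using N_ge[of 0 x] by (simp add: T_0)

lemma N_le: "N x \<le> M * norm x" by (intro N_leI norm_T)

lemma N_add: "N (x + y) \<le> N x + N y"
proof (rule N_leI)
  fix s :: real assume "0 \<le> s"
  then show "norm (T s (x + y)) \<le> N x + N y"
    using norm_triangle_ineq[of "T s x" "T s y"] N_ge[of s x] N_ge[of s y] by (simp add: blinfun.add_right)
qed

lemma N_T: "0 \<le> h \<Longrightarrow> N (T h x) \<le> N x"
  by (intro N_leI) (metis N_ge T_add add_nonneg_nonneg)

lemma N_scaleR: "0 \<le> c \<Longrightarrow> N (c *\<^sub>R x) \<le> c * N x"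
  by (intro N_leI) (simp add: blinfun.scaleR_right mult_left_mono N_ge)

lemma N_continuous: "continuous_on A N"
proof -
  have "N x - N y \<le> M * norm (x - y)" for x y
    using N_add[of "x - y" y] N_le[of "x - y"] by simp
  then have "\<bar>N x - N y\<bar> \<le> M * norm (x - y)" for x y
    using norm_minus_commute[of x y] by (smt (verit))
  then have "M-lipschitz_on A N"
    by (intro lipschitz_onI M_nonneg) (simp add: dist_norm)
  then show ?thesis by (rule lipschitz_on_continuous_on)
qed

lemma N_continuous_comp: "continuous_on A f \<Longrightarrow> continuous_on A (\<lambda>t. N (f t))"
  by (rule continuous_on_compose2[OF N_continuous]) auto

lemma N_volterra_conv:
  assumes r: "laplace_kernel r" and f: "continuous_on {0..t} f"
  shows "N (volterra_conv r f t) \<le> volterra_conv r (\<lambda>\<tau>. N (f \<tau>)) t"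
proof (rule N_leI)
  fix s :: real assume s: "0 \<le> s"
  have "T s (volterra_conv r f t) = volterra_conv r (\<lambda>\<tau>. T s (f \<tau>)) t"
    by (rule volterra_conv_bounded_linear[OF r f blinfun.bounded_linear_right, symmetric])
  then show "norm (T s (volterra_conv r f t)) \<le> volterra_conv r (\<lambda>\<tau>. N (f \<tau>)) t"
    using N_ge[OF s] by (simp add: volterra_conv_norm[OF r] continuous_intros N_continuous_comp f)
qed

end

section \<open>The Volterra equation with a bounded operator\<close>

locale resolvent_semigroup = resolvent_pair \<mu> k r + bounded_semigroup T M
  for \<mu> :: real and k r :: "real \<Rightarrow> real" and T :: "real \<Rightarrow> 'a::banach \<Rightarrow>\<^sub>L 'a" and M :: real +
  fixes h :: real
  assumes h: "0 \<le> h"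
begin

text \<open>Rate \<mu> and step \<open>h\<close> are independent in this locale; only the coupling
  \<mu> = 1/h, made later in \<open>A\<^sub>n\<close>, turns this operator into a difference
  quotient.\<close>

definition A\<^sub>h :: "'a \<Rightarrow> 'a" where "A\<^sub>h x = \<mu> *\<^sub>R (T h x - x)"

lemma A\<^sub>h_bounded_linear: "bounded_linear A\<^sub>h"
  unfolding A\<^sub>h_def[abs_def]
  by (intro bounded_linear_scaleR_right[THEN bounded_linear_compose] bounded_linear_sub blinfun.bounded_linear_right bounded_linear_ident)

text \<open>In the norm \<open>N\<close> the operator \<open>T h\<close> is a contraction, so the
  resolvent form gives N(w) \<le> r*(\<mu> N(w) + N(g)), the hypothesis of
  \<open>comparison\<close>. A factor M in front of \<mu> N(w) would destroy the cancellation
  there.\<close>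

lemma estimate:
  assumes w: "continuous_on {0..R} w" and g: "continuous_on {0..R} g"
    and eq: "\<And>t. t \<in> {0..R} \<Longrightarrow> w t = volterra_conv k (\<lambda>\<tau>. A\<^sub>h (w \<tau>) + g \<tau>) t"
    and t: "t \<in> {0..R}"
  shows "norm (w t) \<le> volterra_conv k (\<lambda>\<tau>. N (g \<tau>)) t"
proof -
  have "N (w t) \<le> volterra_conv k (\<lambda>\<tau>. N (g \<tau>)) t"
  proof (rule comparison[where R = R])
    fix t assume t: "t \<in> {0..R}"
    have sub: "continuous_on {0..t} f" if "continuous_on {0..R} f" for f :: "real \<Rightarrow> 'b::topological_space"
      by (rule continuous_on_subset[OF that]) (use t in auto)
    have c: "continuous_on {0..t} (\<lambda>\<tau>. \<mu> *\<^sub>R T h (w \<tau>) + g \<tau>)"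
      by (intro continuous_intros sub w g)
    have "w t = volterra_conv r (\<lambda>\<tau>. \<mu> *\<^sub>R T h (w \<tau>) + g \<tau>) t"
      using eq t by (intro volterra_resolvent_form[where R = R] w g blinfun.bounded_linear_right) (auto simp: A\<^sub>h_def)
    then have "N (w t) \<le> volterra_conv r (\<lambda>\<tau>. N (\<mu> *\<^sub>R T h (w \<tau>) + g \<tau>)) t"
      using N_volterra_conv[OF r c] by simp
    also have "\<dots> \<le> volterra_conv r (\<lambda>\<tau>. \<mu> * N (w \<tau>) + N (g \<tau>)) t"
    proof (rule volterra_conv_mono[OF r])
      show "continuous_on {0..t} (\<lambda>\<tau>. N (\<mu> *\<^sub>R T h (w \<tau>) + g \<tau>))" by (intro N_continuous_comp c)
      show "continuous_on {0..t} (\<lambda>\<tau>. \<mu> * N (w \<tau>) + N (g \<tau>))"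
        by (intro continuous_intros N_continuous_comp sub w g)
      fix \<tau>
      have "N (\<mu> *\<^sub>R T h (w \<tau>)) \<le> \<mu> * N (w \<tau>)"
        using N_scaleR[of \<mu> "T h (w \<tau>)"] mult_left_mono[OF N_T[OF h, of "w \<tau>"], of \<mu>] \<mu> by linarith
      then show "N (\<mu> *\<^sub>R T h (w \<tau>) + g \<tau>) \<le> \<mu> * N (w \<tau>) + N (g \<tau>)"
        using N_add[of "\<mu> *\<^sub>R T h (w \<tau>)" "g \<tau>"] by linarith
    qed
    finally show "N (w t) \<le> volterra_conv r (\<lambda>\<tau>. \<mu> * N (w \<tau>) + N (g \<tau>)) t" .
  qed (intro N_continuous_comp w g t)+
  then show ?thesis using norm_le_N[of "w t"] by linarith
qed

text \<open>The Neumann series of the renewal equation u = c 0 a + \<mu> r * T(h) u: the expectation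
  of T(n h) a over the number n of renewals up to time t.\<close>

definition S\<^sub>h :: "real \<Rightarrow> 'a \<Rightarrow> 'a" where
  "S\<^sub>h t a = (\<Sum>n. c n t *\<^sub>R T (real n * h) a)"

lemma S\<^sub>h_summable_norm:
  assumes "0 \<le> t" shows "summable (\<lambda>n. norm (c n t *\<^sub>R T (real n * h) a))"
proof (rule summable_comparison_test'[where N = 0])
  show "summable (\<lambda>n. c n t * (M * norm a))"
    by (intro summable_mult2 sums_summable[OF c_sums] assms)
  show "norm (norm (c n t *\<^sub>R T (real n * h) a)) \<le> c n t * (M * norm a)" for n
    using norm_T[of "real n * h" a] c_nonneg[of n t] h by (simp add: mult_left_mono)
qed

lemma S\<^sub>h_sums: "0 \<le> t \<Longrightarrow> (\<lambda>n. c n t *\<^sub>R T (real n * h) a) sums S\<^sub>h t a"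
  unfolding S\<^sub>h_def by (rule summable_sums[OF summable_norm_cancel[OF S\<^sub>h_summable_norm]])

lemma S\<^sub>h_norm: assumes "0 \<le> t" shows "norm (S\<^sub>h t a) \<le> M * norm a"
proof -
  have "norm (S\<^sub>h t a) \<le> (\<Sum>n. norm (c n t *\<^sub>R T (real n * h) a))"
    unfolding S\<^sub>h_def by (rule summable_norm[OF S\<^sub>h_summable_norm[OF assms]])
  also have "\<dots> \<le> (\<Sum>n. c n t * (M * norm a))"
    using norm_T[of "real _ * h" a] c_nonneg[of _ t] h
    by (intro suminf_le S\<^sub>h_summable_norm assms summable_mult2 sums_summable[OF c_sums]) (auto simp: mult_left_mono)
  also have "\<dots> = M * norm a"
    using sums_mult2[OF c_sums[OF assms], of "M * norm a"] by (simp add: sums_iff)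
  finally show ?thesis .
qed

text \<open>One statement for every bounded operator commuting with the semigroup: scalar multiples
  right below, the operators \<open>A\<^sub>n m\<close> and the semigroup itself later.\<close>

lemma S\<^sub>h_commute:
  assumes B: "bounded_linear B" and comm: "\<And>s x. 0 \<le> s \<Longrightarrow> B (T s x) = T s (B x)" and t: "0 \<le> t"
  shows "S\<^sub>h t (B a) = B (S\<^sub>h t a)"
proof -
  have "(\<lambda>n. B (c n t *\<^sub>R T (real n * h) a)) sums B (S\<^sub>h t a)"
    by (rule bounded_linear.sums[OF B S\<^sub>h_sums[OF t]])
  then have "(\<lambda>n. c n t *\<^sub>R T (real n * h) (B a)) sums B (S\<^sub>h t a)"
    using comm h by (simp add: linear_simps(5)[OF B])
  then show ?thesis using S\<^sub>h_sums[OF t, of "B a"] sums_unique2 by blast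
qed

lemma S\<^sub>h_bounded_linear:
  assumes t: "0 \<le> t" shows "bounded_linear (S\<^sub>h t)"
proof (rule bounded_linear_intro[where K = M])
  show "S\<^sub>h t (x + y) = S\<^sub>h t x + S\<^sub>h t y" for x y
    using sums_add[OF S\<^sub>h_sums[OF t, of x] S\<^sub>h_sums[OF t, of y]] S\<^sub>h_sums[OF t, of "x + y"] sums_unique2
    by (simp add: blinfun.add_right scaleR_add_right) blast
  show "S\<^sub>h t (b *\<^sub>R x) = b *\<^sub>R S\<^sub>h t x" for b x
    by (rule S\<^sub>h_commute[OF bounded_linear_scaleR_right _ t]) (simp add: blinfun.scaleR_right)
  show "norm (S\<^sub>h t x) \<le> norm x * M" for x using S\<^sub>h_norm[OF t, of x] by (simp add: mult.commute)
qed

text \<open>The space carries no order in this locale, so positivity is phrased for an arbitrary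
  invariant closed convex cone. The partial sums are combinations with nonnegative coefficients
  \<open>c i t\<close>.\<close>

lemma S\<^sub>h_cone:
  assumes C: "convex_cone C" "closed C" "\<And>s x. 0 \<le> s \<Longrightarrow> x \<in> C \<Longrightarrow> T s x \<in> C" and a: "a \<in> C" and t: "0 \<le> t"
  shows "S\<^sub>h t a \<in> C"
proof (rule closed_sequentially[OF C(2)])
  show "(\<lambda>n. \<Sum>i<n. c i t *\<^sub>R T (real i * h) a) \<longlonglongrightarrow> S\<^sub>h t a"
    using S\<^sub>h_sums[OF t] unfolding sums_def .
  show "(\<Sum>i<n. c i t *\<^sub>R T (real i * h) a) \<in> C" for n
    using h by (induction n)
      (auto intro!: convex_cone_add convex_cone_scaleR convex_cone_contains_0 C a c_nonneg)
qed

lemma S\<^sub>h_uniform_limit: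
  "uniform_limit {0..R} (\<lambda>n t. \<Sum>i<n. c i t *\<^sub>R T (real i * h) a) (\<lambda>t. S\<^sub>h t a) sequentially"
  unfolding S\<^sub>h_def
proof (rule Weierstrass_m_test)
  show "summable (\<lambda>n. q ^ n * (exp R * (M * norm a)))"
    using q by (intro summable_mult2 summable_geometric) auto
  fix n t assume t: "t \<in> {0..R}"
  have "norm (c n t *\<^sub>R T (real n * h) a) \<le> (q ^ n * exp t) * (M * norm a)"
    using norm_T[of "real n * h" a] c_nonneg[of n t] h c_le[of t n] t q
    by (auto intro!: mult_mono)
  also have "\<dots> \<le> (q ^ n * exp R) * (M * norm a)"
    using t q M_nonneg by (intro mult_right_mono mult_left_mono) auto
  finally show "norm (c n t *\<^sub>R T (real n * h) a) \<le> q ^ n * (exp R * (M * norm a))" by (simp add: mult.assoc)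
qed

lemma S\<^sub>h_continuous: "continuous_on {0..R} (\<lambda>t. S\<^sub>h t a)"
  by (rule uniform_limit_theorem[OF _ S\<^sub>h_uniform_limit])
     (auto intro!: always_eventually continuous_intros c_continuous)

text \<open>Abel summation: the difference moves from \<open>y\<close> onto \<open>e\<close>, where
  it becomes \<open>c\<close>, at the price of a boundary term that vanishes in the limit.\<close>

lemma summation_by_parts:
  fixes y :: "nat \<Rightarrow> 'b::real_vector"
  shows "(\<Sum>n<m. e (Suc n) t *\<^sub>R (y (Suc n) - y n)) = (\<Sum>n<m. c n t *\<^sub>R y n) - y 0 + e m t *\<^sub>R y m"
  by (induction m) (auto simp: c_def algebra_simps simp del: e.simps(2))

text \<open>On the orbit y n = T(n h) a the operator \<open>A\<^sub>h\<close> acts as \<mu> times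
  the forward difference, and \<mu> k * c n = e (n+1). Summation by parts then shows that each
  partial sum solves the equation up to the term \<open>e m t *\<^sub>R y m\<close>, which tends to
  0.\<close>

lemma S\<^sub>h_equation:
  assumes t: "0 \<le> t"
  shows "S\<^sub>h t a = a + volterra_conv k (\<lambda>\<tau>. A\<^sub>h (S\<^sub>h \<tau> a)) t"
proof -
  define y where "y n = T (real n * h) a" for n
  define P where "P m \<tau> = (\<Sum>n<m. c n \<tau> *\<^sub>R y n)" for m \<tau>
  have Pc: "continuous_on {0..t} (P m)" for m
    unfolding P_def by (intro continuous_intros c_continuous)
  have ule: "uniform_limit {0..t} P (\<lambda>\<tau>. S\<^sub>h \<tau> a) sequentially"
    using S\<^sub>h_uniform_limit[where R = t and a = a] by (simp add: P_def[abs_def] y_def)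
  have tt: "t \<in> {0..t}" using t by simp
  have "(\<lambda>m. volterra_conv k (\<lambda>\<tau>. A\<^sub>h (P m \<tau>)) t) \<longlonglongrightarrow> volterra_conv k (\<lambda>\<tau>. A\<^sub>h (S\<^sub>h \<tau> a)) t"
    by (intro tendsto_uniform_limitI[OF _ tt] volterra_conv_uniform_limit k bounded_linear.uniform_limit[OF A\<^sub>h_bounded_linear ule]
        bounded_linear.continuous_on[OF A\<^sub>h_bounded_linear] Pc S\<^sub>h_continuous)
  moreover have "volterra_conv k (\<lambda>\<tau>. A\<^sub>h (P m \<tau>)) t = P m t - a + e m t *\<^sub>R y m" for m
  proof -
    have Ay: "A\<^sub>h (y n) = \<mu> *\<^sub>R (y (Suc n) - y n)" for n
      using T_add[of h "real n * h" a] h by (simp add: A\<^sub>h_def y_def algebra_simps)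
    have "volterra_conv k (\<lambda>\<tau>. A\<^sub>h (P m \<tau>)) t = A\<^sub>h (volterra_conv k (P m) t)"
      by (rule volterra_conv_bounded_linear[OF k Pc A\<^sub>h_bounded_linear])
    also have "volterra_conv k (P m) t = (\<Sum>n<m. volterra_conv k (c n) t *\<^sub>R y n)"
    proof (induction m)
      case 0
      show ?case by (simp add: P_def volterra_conv_def)
    next
      case (Suc m)
      have "volterra_conv k (P (Suc m)) t = volterra_conv k (\<lambda>\<tau>. P m \<tau> + c m \<tau> *\<^sub>R y m) t" by (simp add: P_def[abs_def])
      also have "\<dots> = volterra_conv k (P m) t + volterra_conv k (c m) t *\<^sub>R y m"
        by (subst volterra_conv_add[OF k Pc]) (auto intro!: continuous_intros c_continuous simp: volterra_conv_scaleR_const[OF k c_continuous])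
      finally show ?case using Suc by simp
    qed
    also have "A\<^sub>h (\<Sum>n<m. volterra_conv k (c n) t *\<^sub>R y n) = (\<Sum>n<m. (\<mu> * volterra_conv k (c n) t) *\<^sub>R (y (Suc n) - y n))"
      using bounded_linear.linear[OF A\<^sub>h_bounded_linear]
      by (simp add: linear_sum linear_cmul Ay mult.commute)
    also have "\<dots> = (\<Sum>n<m. e (Suc n) t *\<^sub>R (y (Suc n) - y n))"
      using e_volterra_conv[OF t] by (simp add: c_def[abs_def] del: e.simps)
    also have "\<dots> = P m t - a + e m t *\<^sub>R y m"
      unfolding summation_by_parts by (simp add: P_def y_def T_0)
    finally show ?thesis .
  qed
  moreover have "(\<lambda>m. P m t - a + e m t *\<^sub>R y m) \<longlonglongrightarrow> S\<^sub>h t a - a + 0"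
  proof (intro tendsto_intros)
    show "(\<lambda>m. P m t) \<longlonglongrightarrow> S\<^sub>h t a" by (rule tendsto_uniform_limitI[OF ule tt])
    show "(\<lambda>m. e m t *\<^sub>R y m) \<longlonglongrightarrow> 0"
    proof (rule Lim_null_comparison)
      show "\<forall>\<^sub>F m in sequentially. norm (e m t *\<^sub>R y m) \<le> e m t * (M * norm a)"
        using e_nonneg norm_T h by (intro always_eventually) (auto simp: y_def mult_left_mono)
      show "(\<lambda>m. e m t * (M * norm a)) \<longlonglongrightarrow> 0"
        using e_tendsto[OF t] by (rule tendsto_mult_left_zero)
    qed
  qed
  ultimately have "volterra_conv k (\<lambda>\<tau>. A\<^sub>h (S\<^sub>h \<tau> a)) t = S\<^sub>h t a - a + 0"
    using LIMSEQ_unique by simp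
  then show ?thesis by simp
qed

end

section \<open>Passage to the generator and the solution operator\<close>

lemma continuous_on_atLeastI:
  fixes f :: "real \<Rightarrow> 'a::topological_space"
  assumes "\<And>R. continuous_on {a..R} f" shows "continuous_on {a..} f"
  unfolding continuous_on_eq_continuous_within
proof
  fix t assume t: "t \<in> {a..}"
  have "continuous (at t within {a..t+1}) f"
    using assms[of "t + 1"] t by (auto simp: continuous_on_eq_continuous_within)
  moreover have "at t within {a..} = at t within {a..t+1}"
    by (rule at_within_nhd[of _ "{..<t+1}"]) auto
  ultimately show "continuous (at t within {a..}) f" by simp
qed

locale volterra_semigroup = bounded_semigroup T M
  for T :: "real \<Rightarrow> 'a::banach \<Rightarrow>\<^sub>L 'a" and M :: real +
  fixes D :: "'a set" and A :: "'a \<Rightarrow> 'a" and k :: "real \<Rightarrow> real"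
  assumes gen: "is_generator T D A" and k: "laplace_kernel k"
    and resolvents: "\<And>\<mu>. 0 < \<mu> \<Longrightarrow> \<exists>r. resolvent_kernel \<mu> k r"
begin

lemma D_tendsto: "x \<in> D \<Longrightarrow> ((\<lambda>t. (T t x - x) /\<^sub>R t) \<longlongrightarrow> A x) (at_right 0)"
  using gen by (simp add: is_generator_def)

lemma DI:
  assumes "((\<lambda>t. (T t x - x) /\<^sub>R t) \<longlongrightarrow> y) (at_right 0)"
  shows "x \<in> D" "A x = y"
proof -
  show "x \<in> D" using gen assms unfolding is_generator_def by blast
  from tendsto_unique[OF _ D_tendsto[OF this] assms] show "A x = y" by simp
qed

lemma D_diff:
  assumes "x \<in> D" "y \<in> D" shows "x - y \<in> D" "A (x - y) = A x - A y"
proof -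
  have "((\<lambda>t. (T t x - x) /\<^sub>R t - (T t y - y) /\<^sub>R t) \<longlongrightarrow> A x - A y) (at_right 0)"
    by (intro tendsto_diff D_tendsto assms)
  also have "(\<lambda>t. (T t x - x) /\<^sub>R t - (T t y - y) /\<^sub>R t) = (\<lambda>t. (T t (x - y) - (x - y)) /\<^sub>R t)"
    by (simp add: fun_eq_iff blinfun.diff_right algebra_simps)
  finally show "x - y \<in> D" "A (x - y) = A x - A y" by (rule DI)+
qed

lemma D_commuting:
  assumes B: "bounded_linear B" and comm: "\<And>s x. 0 \<le> s \<Longrightarrow> B (T s x) = T s (B x)" and x: "x \<in> D"
  shows "B x \<in> D" "A (B x) = B (A x)"
proof -
  have "((\<lambda>t. B ((T t x - x) /\<^sub>R t)) \<longlongrightarrow> B (A x)) (at_right 0)"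
    by (intro bounded_linear.tendsto[OF B] D_tendsto x)
  moreover have "\<forall>\<^sub>F t in at_right 0. B ((T t x - x) /\<^sub>R t) = (T t (B x) - B x) /\<^sub>R t"
    using eventually_at_right_less[of "0::real"]
    by eventually_elim (use comm in \<open>simp add: linear_simps[OF B]\<close>)
  ultimately have "((\<lambda>t. (T t (B x) - B x) /\<^sub>R t) \<longlongrightarrow> B (A x)) (at_right 0)"
    using tendsto_cong by fast
  then show "B x \<in> D" "A (B x) = B (A x)" by (rule DI)+
qed

text \<open>The interval is cut into m + 1 steps of length \<delta>. The difference telescopes into
  terms T(i \<delta>) (T(\<delta>) x - x), each of norm at most M times that of one increment, and m
  \<rightarrow> \<infinity> turns the difference quotients into A x.\<close>

lemma norm_T_diff_generator:
  assumes x: "x \<in> D" and h: "0 < h"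
  shows "norm (T h x - x) \<le> h * (M * norm (A x))"
proof (rule tendsto_lowerbound)
  have "filterlim (\<lambda>m. h / real (Suc m)) (at_right 0) sequentially"
    unfolding filterlim_at
    using h by (auto intro!: always_eventually real_tendsto_divide_at_top[OF tendsto_const]
        filterlim_compose[OF filterlim_real_sequentially filterlim_Suc] simp del: of_nat_Suc)
  from filterlim_compose[OF D_tendsto[OF x] this]
  show "(\<lambda>m. h * (M * norm ((T (h / real (Suc m)) x - x) /\<^sub>R (h / real (Suc m))))) \<longlonglongrightarrow> h * (M * norm (A x))"
    by (intro tendsto_intros)
  have "norm (T h x - x) \<le> h * (M * norm ((T (h / real (Suc m)) x - x) /\<^sub>R (h / real (Suc m))))" for m
  proof -
    define \<delta> where "\<delta> = h / real (Suc m)"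
    have \<delta>: "0 < \<delta>" "real (Suc m) * \<delta> = h" using h by (auto simp: \<delta>_def)
    have "T (real j * \<delta>) x - x = (\<Sum>i<j. T (real i * \<delta>) (T \<delta> x - x))" for j
    proof (induction j)
      case (Suc j)
      have "T (real (Suc j) * \<delta>) x = T (real j * \<delta>) (T \<delta> x)"
        using T_add[of "real j * \<delta>" \<delta> x] \<delta>(1) by (simp add: algebra_simps)
      then show ?case using Suc by (simp add: blinfun.diff_right algebra_simps)
    qed (simp add: T_0)
    from this[of "Suc m"] have "norm (T h x - x) = norm (\<Sum>i<Suc m. T (real i * \<delta>) (T \<delta> x - x))"
      by (simp only: \<delta>(2))
    also have "\<dots> \<le> (\<Sum>i<Suc m. M * norm (T \<delta> x - x))"
      using \<delta>(1) by (intro sum_norm_le norm_T) auto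
    also have "\<dots> = h * (M * norm ((T \<delta> x - x) /\<^sub>R \<delta>))"
    proof -
      have "\<delta> * norm ((T \<delta> x - x) /\<^sub>R \<delta>) = norm (T \<delta> x - x)" using \<delta>(1) by simp
      then have "real (Suc m) * (M * norm (T \<delta> x - x)) = (real (Suc m) * \<delta>) * (M * norm ((T \<delta> x - x) /\<^sub>R \<delta>))"
        by (metis mult.assoc mult.left_commute)
      then show ?thesis unfolding \<delta>(2) by simp
    qed
    finally show ?thesis unfolding \<delta>_def .
  qed
  then show "\<forall>\<^sub>F m in sequentially. norm (T h x - x) \<le> h * (M * norm ((T (h / real (Suc m)) x - x) /\<^sub>R (h / real (Suc m))))"
    by (intro always_eventually) auto
qed simp

text \<open>The averages of T(s) a over 0 \<le> s \<le> h converge to a. They lie in the domain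
  because applying T(\<tau>) shifts the interval of integration, so only its two ends contribute to
  the difference quotient, with limit T(h) a - a.\<close>

lemma D_dense: "closure D = UNIV"
proof -
  define I where "I a t = integral {0..t} (\<lambda>s. T s a)" for a t
  have cont: "continuous_on {x..y} (\<lambda>s. T s a)" if "0 \<le> x" for a x y
    by (rule continuous_on_subset[OF T_continuous]) (use that in auto)
  have der: "((\<lambda>\<tau>. (I a (h + \<tau>) - I a h) /\<^sub>R \<tau>) \<longlongrightarrow> T h a) (at_right 0)" if h: "0 \<le> h" for a h
  proof -
    have "((\<lambda>u. I a u) has_vector_derivative T h a) (at h within {0..h+1})"
      unfolding I_def by (rule integral_has_vector_derivative) (use h cont in auto)
    then have "((\<lambda>u. I a u) has_vector_derivative T h a) (at h within {h<..<h+1})"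
      by (rule has_vector_derivative_within_subset) (use h in auto)
    moreover have "at h within {h<..<h+1} = at_right h"
      by (rule at_within_nhd[of _ "{..<h+1}"]) auto
    ultimately have "((\<lambda>u. (1 / norm (u - h)) *\<^sub>R (I a u - (I a h + (u - h) *\<^sub>R T h a))) \<longlongrightarrow> 0) (at_right h)"
      unfolding has_vector_derivative_def has_derivative_within by simp
    then have "((\<lambda>u. (1 / norm (u - h)) *\<^sub>R (I a u - (I a h + (u - h) *\<^sub>R T h a)) + T h a) \<longlongrightarrow> 0 + T h a) (at_right h)"
      by (intro tendsto_intros)
    moreover have "\<forall>\<^sub>F u in at_right h. (1 / norm (u - h)) *\<^sub>R (I a u - (I a h + (u - h) *\<^sub>R T h a)) + T h a = (I a u - I a h) /\<^sub>R (u - h)"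
      using eventually_at_right_less[of h]
      by eventually_elim (simp add: scaleR_diff_right scaleR_add_right divide_inverse)
    ultimately have "((\<lambda>u. (I a u - I a h) /\<^sub>R (u - h)) \<longlongrightarrow> T h a) (at_right h)"
      using tendsto_cong by force
    then show ?thesis by (subst (asm) at_right_to_0) (simp add: filterlim_filtermap add.commute)
  qed
  have I0: "I a 0 = 0" for a by (simp add: I_def)
  have shift: "T \<tau> (I a h) - I a h = (I a (h + \<tau>) - I a h) - I a \<tau>" if "0 \<le> h" "0 \<le> \<tau>" for a h \<tau>
  proof -
    have "T \<tau> (I a h) = integral {0..h} (\<lambda>s. T \<tau> (T s a))"
      unfolding I_def using integral_linear[OF integrable_continuous_real[OF cont[of 0 h a]] blinfun.bounded_linear_right, of "T \<tau>"]
      by (simp add: comp_def)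
    also have "\<dots> = integral {0..h} ((\<lambda>s. T s a) \<circ> (+) \<tau>)"
      using that by (intro integral_cong) (auto simp: T_add)
    also have "\<dots> = integral {\<tau>..h+\<tau>} (\<lambda>s. T s a)" by (subst integral_shift_Icc_real) simp
    also have "\<dots> = I a (h + \<tau>) - I a \<tau>"
    proof -
      have "integral {0..\<tau>} (\<lambda>s. T s a) + integral {\<tau>..h+\<tau>} (\<lambda>s. T s a) = integral {0..h+\<tau>} (\<lambda>s. T s a)"
        using that by (intro Henstock_Kurzweil_Integration.integral_combine integrable_continuous_real cont) auto
      then show ?thesis unfolding I_def by (metis add_diff_cancel_left')
    qed
    finally show ?thesis by simp
  qed
  have ID: "I a h /\<^sub>R h \<in> D" if h: "0 < h" for a h
  proof -
    have "((\<lambda>\<tau>. (I a (h + \<tau>) - I a h) /\<^sub>R \<tau> - (I a (0 + \<tau>) - I a 0) /\<^sub>R \<tau>) \<longlongrightarrow> T h a - T 0 a) (at_right 0)"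
      using h by (intro tendsto_diff der) auto
    moreover have "\<forall>\<^sub>F \<tau> in at_right 0. (I a (h + \<tau>) - I a h) /\<^sub>R \<tau> - (I a (0 + \<tau>) - I a 0) /\<^sub>R \<tau> = (T \<tau> (I a h) - I a h) /\<^sub>R \<tau>"
      using eventually_at_right_less[of "0::real"]
      by eventually_elim (use h in \<open>simp add: shift I0 scaleR_diff_right\<close>)
    ultimately have "((\<lambda>\<tau>. (T \<tau> (I a h) - I a h) /\<^sub>R \<tau>) \<longlongrightarrow> T h a - T 0 a) (at_right 0)"
      using tendsto_cong by fast
    then have "I a h \<in> D" by (rule DI)
    then show ?thesis
      by (rule D_commuting(1)[OF bounded_linear_scaleR_right, rotated]) (simp add: blinfun.scaleR_right)
  qed
  have "a \<in> closure D" for a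
  proof (rule Lim_in_closed_set[where F = "at_right (0::real)" and f = "\<lambda>h. I a h /\<^sub>R h"])
    show "((\<lambda>h. I a h /\<^sub>R h) \<longlongrightarrow> a) (at_right 0)" using der[of 0 a] by (simp add: I0 T_0)
    show "\<forall>\<^sub>F h in at_right 0. I a h /\<^sub>R h \<in> closure D"
      using eventually_at_right_less[of "0::real"]
      by eventually_elim (use ID closure_subset in blast)
  qed auto
  then show ?thesis by auto
qed

text \<open>The difference quotient with step 1/(n+1); the shift keeps step and rate positive for
  \<open>n = 0\<close>.\<close>

definition A\<^sub>n :: "nat \<Rightarrow> 'a \<Rightarrow> 'a" where
  "A\<^sub>n n x = real (Suc n) *\<^sub>R (T (1 / real (Suc n)) x - x)"

definition r\<^sub>n :: "nat \<Rightarrow> real \<Rightarrow> real" where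
  "r\<^sub>n n = (SOME r. resolvent_kernel (real (Suc n)) k r)"

text \<open>The operator \<open>S\<^sub>h\<close> with rate n+1 and step 1/(n+1) written out;
  \<open>approx_def\<close> identifies the two, so that the results of the previous locale
  transfer.\<close>

definition S\<^sub>n :: "nat \<Rightarrow> real \<Rightarrow> 'a \<Rightarrow> 'a" where
  "S\<^sub>n n t a = (\<Sum>j. resolvent_pair.c (real (Suc n)) (r\<^sub>n n) j t *\<^sub>R T (real j * (1 / real (Suc n))) a)"

lemma approx_semigroup: "resolvent_semigroup (real (Suc n)) k (r\<^sub>n n) T M (1 / real (Suc n))"
proof unfold_locales
  show "resolvent_kernel (real (Suc n)) k (r\<^sub>n n)"
    unfolding r\<^sub>n_def by (rule someI_ex[OF resolvents]) simp
qed (use k in auto)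

lemma approx_def: "resolvent_semigroup.S\<^sub>h (real (Suc n)) (r\<^sub>n n) T (1 / real (Suc n)) = S\<^sub>n n"
  "resolvent_semigroup.A\<^sub>h (real (Suc n)) T (1 / real (Suc n)) = A\<^sub>n n"
  by (simp_all add: fun_eq_iff S\<^sub>n_def A\<^sub>n_def resolvent_semigroup.S\<^sub>h_def[OF approx_semigroup]
      resolvent_semigroup.A\<^sub>h_def[OF approx_semigroup] del: of_nat_Suc)

lemmas S\<^sub>n_norm = resolvent_semigroup.S\<^sub>h_norm[OF approx_semigroup, unfolded approx_def]
  and S\<^sub>n_commute = resolvent_semigroup.S\<^sub>h_commute[OF approx_semigroup, unfolded approx_def]
  and S\<^sub>n_bounded_linear = resolvent_semigroup.S\<^sub>h_bounded_linear[OF approx_semigroup, unfolded approx_def]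
  and S\<^sub>n_cone = resolvent_semigroup.S\<^sub>h_cone[OF approx_semigroup, unfolded approx_def]
  and S\<^sub>n_continuous = resolvent_semigroup.S\<^sub>h_continuous[OF approx_semigroup, unfolded approx_def]
  and S\<^sub>n_equation = resolvent_semigroup.S\<^sub>h_equation[OF approx_semigroup, unfolded approx_def]
  and A\<^sub>n_bounded_linear = resolvent_semigroup.A\<^sub>h_bounded_linear[OF approx_semigroup, unfolded approx_def]
  and A\<^sub>n_estimate = resolvent_semigroup.estimate[OF approx_semigroup, unfolded approx_def]

lemma A\<^sub>n_commute: "0 \<le> s \<Longrightarrow> A\<^sub>n n (T s x) = T s (A\<^sub>n n x)"
  by (simp add: A\<^sub>n_def blinfun.scaleR_right blinfun.diff_right T_commute[of s "1 / (1 + real n)"])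

lemma A\<^sub>n_S\<^sub>n: "0 \<le> t \<Longrightarrow> A\<^sub>n m (S\<^sub>n n t a) = S\<^sub>n n t (A\<^sub>n m a)"
  by (rule S\<^sub>n_commute[OF A\<^sub>n_bounded_linear A\<^sub>n_commute, symmetric])

lemma A\<^sub>n_tendsto:
  assumes "x \<in> D" shows "(\<lambda>n. A\<^sub>n n x) \<longlonglongrightarrow> A x"
proof -
  have "filterlim (\<lambda>m. 1 / real (Suc m)) (at_right 0) sequentially"
    unfolding filterlim_at
    by (auto intro!: always_eventually real_tendsto_divide_at_top[OF tendsto_const]
        filterlim_compose[OF filterlim_real_sequentially filterlim_Suc] simp del: of_nat_Suc)
  from filterlim_compose[OF D_tendsto[OF assms] this] show ?thesis by (simp add: A\<^sub>n_def)
qed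

lemma A\<^sub>n_norm:
  assumes "x \<in> D" shows "norm (A\<^sub>n n x) \<le> M * norm (A x)"
  using mult_left_mono[OF norm_T_diff_generator[OF assms, of "1 / real (Suc n)"], of "real (Suc n)"]
  by (simp add: A\<^sub>n_def del: of_nat_Suc)

text \<open>The difference w of the two approximations solves the m-th equation with source (A_m -
  A_n) S_n a = S_n b, where b = (A_m - A_n) a, because all operators commute. One factor M comes
  from \<open>N_le\<close>, the other from \<open>S\<^sub>n_norm\<close>.\<close>

lemma S\<^sub>n_diff:
  assumes t: "0 \<le> t"
  shows "norm (S\<^sub>n m t a - S\<^sub>n n t a) \<le> M * (M * norm (A\<^sub>n m a - A\<^sub>n n a)) * volterra_conv k (\<lambda>_. 1) t"
proof -
  define b where "b = A\<^sub>n m a - A\<^sub>n n a"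
  define w where "w \<tau> = S\<^sub>n m \<tau> a - S\<^sub>n n \<tau> a" for \<tau>
  note Ac = bounded_linear.continuous_on[OF A\<^sub>n_bounded_linear]
  have "norm (w t) \<le> volterra_conv k (\<lambda>\<tau>. N (S\<^sub>n n \<tau> b)) t"
  proof (rule A\<^sub>n_estimate[where R = t and n = m])
    show "continuous_on {0..t} w" unfolding w_def by (intro continuous_intros S\<^sub>n_continuous)
    show "continuous_on {0..t} (\<lambda>\<tau>. S\<^sub>n n \<tau> b)" by (rule S\<^sub>n_continuous)
    fix s assume s: "s \<in> {0..t}"
    have "w s = volterra_conv k (\<lambda>\<tau>. A\<^sub>n m (S\<^sub>n m \<tau> a)) s - volterra_conv k (\<lambda>\<tau>. A\<^sub>n n (S\<^sub>n n \<tau> a)) s"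
      using S\<^sub>n_equation[of s m a] S\<^sub>n_equation[of s n a] s by (simp add: w_def)
    also have "\<dots> = volterra_conv k (\<lambda>\<tau>. A\<^sub>n m (S\<^sub>n m \<tau> a) - A\<^sub>n n (S\<^sub>n n \<tau> a)) s"
      by (rule volterra_conv_diff[OF k, symmetric]) (intro Ac S\<^sub>n_continuous)+
    also have "\<dots> = volterra_conv k (\<lambda>\<tau>. A\<^sub>n m (w \<tau>) + S\<^sub>n n \<tau> b) s"
    proof (rule volterra_conv_cong)
      fix \<tau> assume \<tau>: "\<tau> \<in> {0..s}"
      then show "A\<^sub>n m (S\<^sub>n m \<tau> a) - A\<^sub>n n (S\<^sub>n n \<tau> a) = A\<^sub>n m (w \<tau>) + S\<^sub>n n \<tau> b"
        unfolding w_def b_def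
        by (simp add: linear_diff[OF bounded_linear.linear[OF A\<^sub>n_bounded_linear]]
            linear_diff[OF bounded_linear.linear[OF S\<^sub>n_bounded_linear]] A\<^sub>n_S\<^sub>n)
    qed
    finally show "w s = volterra_conv k (\<lambda>\<tau>. A\<^sub>n m (w \<tau>) + S\<^sub>n n \<tau> b) s" .
  qed (use t in auto)
  also have "\<dots> \<le> norm (volterra_conv k (\<lambda>\<tau>. N (S\<^sub>n n \<tau> b)) t)" by simp
  also have "\<dots> \<le> M * (M * norm b) * volterra_conv k (\<lambda>_. 1) t"
  proof (rule volterra_conv_norm_const[OF k])
    show "continuous_on {0..t} (\<lambda>\<tau>. N (S\<^sub>n n \<tau> b))" by (intro N_continuous_comp S\<^sub>n_continuous)
    fix \<tau> assume "\<tau> \<in> {0..t}"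
    then have "N (S\<^sub>n n \<tau> b) \<le> M * (M * norm b)"
      using N_le[of "S\<^sub>n n \<tau> b"] mult_left_mono[OF S\<^sub>n_norm[of \<tau> n b] M_nonneg] by simp
    moreover have "0 \<le> N (S\<^sub>n n \<tau> b)" using norm_le_N[of "S\<^sub>n n \<tau> b"] norm_ge_zero order_trans by blast
    ultimately show "norm (N (S\<^sub>n n \<tau> b)) \<le> M * (M * norm b)" by simp
  qed
  finally show ?thesis by (simp add: w_def b_def)
qed

text \<open>For d in the domain \<open>A\<^sub>n n d\<close> converges, so
  \<open>S\<^sub>n_diff\<close> gives the claim. Density of the domain and the bound M, common to
  all n, extend it to every a.\<close>

lemma S\<^sub>n_uniformly_Cauchy: "uniformly_Cauchy_on {0..R} (\<lambda>n t. S\<^sub>n n t a)"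
proof (rule uniformly_Cauchy_onI)
  fix \<epsilon> :: real assume \<epsilon>: "0 < \<epsilon>"
  obtain C where C: "0 < C" "\<And>t. t \<in> {0..R} \<Longrightarrow> norm (volterra_conv k (\<lambda>_. 1::real) t) \<le> C"
    using continuous_on_Icc_bounded[OF volterra_conv_one_continuous[OF k]] by blast
  \<comment> \<open>Passing from a to d costs M \<eta> for each of the two approximations, together
    less than \<epsilon>/2; \<open>\<rho>\<close> below reserves the other half for the comparison
    at d.\<close>
  define \<eta> where "\<eta> = \<epsilon> / (4 * (M + 1))"
  have \<eta>: "0 < \<eta>" using \<epsilon> M_nonneg by (simp add: \<eta>_def)
  obtain d where d: "d \<in> D" "norm (a - d) < \<eta>"
    using D_dense \<eta> closure_approachable[of a D] by (auto simp: dist_norm norm_minus_commute)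
  \<comment> \<open>\<open>C\<close> bounds the integral of the kernel over \<open>{0..t}\<close>;
    the added 1 keeps the denominator positive when \<open>M = 0\<close>.\<close>
  define \<rho> where "\<rho> = \<epsilon> / (2 * ((M * M + 1) * C))"
  have MM: "0 < M * M + 1" by (simp add: add_nonneg_pos)
  have \<rho>: "0 < \<rho>" unfolding \<rho>_def using \<epsilon> C(1) MM by (intro divide_pos_pos mult_pos_pos) auto
  have "Cauchy (\<lambda>n. A\<^sub>n n d)" using A\<^sub>n_tendsto[OF d(1)] by (rule LIMSEQ_imp_Cauchy)
  then obtain n0 where n0: "\<And>m n. n0 \<le> m \<Longrightarrow> n0 \<le> n \<Longrightarrow> norm (A\<^sub>n m d - A\<^sub>n n d) < \<rho>"
    using \<rho> unfolding Cauchy_def dist_norm by meson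
  show "\<exists>n0. \<forall>t\<in>{0..R}. \<forall>m\<ge>n0. \<forall>n\<ge>n0. dist (S\<^sub>n m t a) (S\<^sub>n n t a) < \<epsilon>"
  proof (intro exI[of _ n0] ballI allI impI)
    fix t m n assume t: "t \<in> {0..R}" and mn: "n0 \<le> m" "n0 \<le> n"
    then have t0: "0 \<le> t" by simp
    have close: "norm (S\<^sub>n j t a - S\<^sub>n j t d) \<le> M * \<eta>" for j
    proof -
      have "norm (S\<^sub>n j t (a - d)) \<le> M * norm (a - d)" by (rule S\<^sub>n_norm[OF t0])
      also have "\<dots> \<le> M * \<eta>" using d(2) M_nonneg by (intro mult_left_mono) auto
      finally show ?thesis by (simp add: linear_diff[OF bounded_linear.linear[OF S\<^sub>n_bounded_linear[OF t0]]])
    qed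
    have "norm (S\<^sub>n m t d - S\<^sub>n n t d) \<le> M * (M * norm (A\<^sub>n m d - A\<^sub>n n d)) * volterra_conv k (\<lambda>_. 1) t"
      by (rule S\<^sub>n_diff[OF t0])
    also have "\<dots> \<le> M * (M * \<rho>) * C"
      using n0[OF mn] C t M_nonneg \<rho> volterra_conv_one_nonneg[OF k, of t] by (intro mult_mono mult_left_mono) fastforce+
    also have "\<dots> \<le> (M * M + 1) * C * \<rho>" using C(1) \<rho> by (simp add: algebra_simps)
    also have "\<dots> = \<epsilon> / 2" using C(1) MM by (simp add: \<rho>_def)
    finally have "norm (S\<^sub>n m t d - S\<^sub>n n t d) \<le> \<epsilon> / 2" .
    moreover have "2 * (M * \<eta>) < \<epsilon> / 2" using \<epsilon> M_nonneg by (simp add: \<eta>_def field_simps)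
    moreover have "S\<^sub>n m t a - S\<^sub>n n t a = (S\<^sub>n m t a - S\<^sub>n m t d) + (S\<^sub>n m t d - S\<^sub>n n t d) - (S\<^sub>n n t a - S\<^sub>n n t d)"
      by simp
    ultimately show "dist (S\<^sub>n m t a) (S\<^sub>n n t a) < \<epsilon>"
      unfolding dist_norm using close[of m] close[of n]
        norm_triangle_ineq[of "S\<^sub>n m t a - S\<^sub>n m t d" "S\<^sub>n m t d - S\<^sub>n n t d"]
        norm_triangle_ineq4[of "(S\<^sub>n m t a - S\<^sub>n m t d) + (S\<^sub>n m t d - S\<^sub>n n t d)" "S\<^sub>n n t a - S\<^sub>n n t d"]
      by simp
  qed
qed

definition S :: "real \<Rightarrow> 'a \<Rightarrow> 'a" where "S t a = lim (\<lambda>n. S\<^sub>n n t a)"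

lemma S_uniform_limit: "uniform_limit {0..R} (\<lambda>n t. S\<^sub>n n t a) (\<lambda>t. S t a) sequentially"
  using Cauchy_uniformly_convergent[OF S\<^sub>n_uniformly_Cauchy]
  unfolding uniformly_convergent_uniform_limit_iff S_def .

lemma S_tendsto: "0 \<le> t \<Longrightarrow> (\<lambda>n. S\<^sub>n n t a) \<longlonglongrightarrow> S t a"
  by (rule tendsto_uniform_limitI[OF S_uniform_limit[where R = t]]) auto

lemma S_continuous: "continuous_on {0..} (\<lambda>t. S t a)"
proof -
  have "continuous_on {0..R} (\<lambda>t. S t a)" for R
    by (rule uniform_limit_theorem[OF _ S_uniform_limit]) (auto intro!: always_eventually S\<^sub>n_continuous)
  then show ?thesis
    by (rule continuous_on_atLeastI)
qed

lemma S_norm: "0 \<le> t \<Longrightarrow> norm (S t a) \<le> M * norm a"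
  by (rule tendsto_upperbound[OF tendsto_norm[OF S_tendsto]]) (auto intro!: always_eventually S\<^sub>n_norm)

lemma S_commute:
  assumes B: "bounded_linear B" and comm: "\<And>s x. 0 \<le> s \<Longrightarrow> B (T s x) = T s (B x)" and t: "0 \<le> t"
  shows "S t (B a) = B (S t a)"
proof (rule LIMSEQ_unique)
  show "(\<lambda>n. S\<^sub>n n t (B a)) \<longlonglongrightarrow> S t (B a)" by (rule S_tendsto[OF t])
  have "S\<^sub>n n t (B a) = B (S\<^sub>n n t a)" for n by (rule S\<^sub>n_commute[OF B _ t]) (rule comm)
  then show "(\<lambda>n. S\<^sub>n n t (B a)) \<longlonglongrightarrow> B (S t a)"
    by (simp add: bounded_linear.tendsto[OF B] S_tendsto t)
qed

lemma S_bounded_linear: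
  assumes t: "0 \<le> t" shows "bounded_linear (S t)"
proof (rule bounded_linear_intro[where K = M])
  show "S t (x + y) = S t x + S t y" for x y
  proof (rule LIMSEQ_unique[OF S_tendsto[OF t]])
    show "(\<lambda>n. S\<^sub>n n t (x + y)) \<longlonglongrightarrow> S t x + S t y"
      unfolding linear_add[OF bounded_linear.linear[OF S\<^sub>n_bounded_linear[OF t]]]
      by (intro tendsto_intros S_tendsto t)
  qed
  show "S t (b *\<^sub>R x) = b *\<^sub>R S t x" for b x
    by (rule S_commute[OF bounded_linear_scaleR_right _ t]) (simp add: blinfun.scaleR_right)
  show "norm (S t x) \<le> norm x * M" for x using S_norm[OF t, of x] by (simp add: mult.commute)
qed

lemma S_cone:
  assumes "convex_cone C" "closed C" "\<And>s x. 0 \<le> s \<Longrightarrow> x \<in> C \<Longrightarrow> T s x \<in> C" "a \<in> C" "0 \<le> t"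
  shows "S t a \<in> C"
  by (rule closed_sequentially[OF assms(2) _ S_tendsto[OF assms(5)]]) (rule S\<^sub>n_cone[OF assms])

lemma S_T: "0 \<le> t \<Longrightarrow> 0 \<le> s \<Longrightarrow> S t (T s a) = T s (S t a)"
  by (rule S_commute[OF blinfun.bounded_linear_right]) (auto simp: T_commute)

lemma S_D:
  assumes a: "a \<in> D" and t: "0 \<le> t" shows "S t a \<in> D" "A (S t a) = S t (A a)"
  by (rule D_commuting[OF S_bounded_linear[OF t] _ a], rule S_T[OF t], assumption)+

text \<open>Since \<open>A\<^sub>n n\<close> commutes with \<open>S\<^sub>n n\<close>, the
  approximate integrand equals \<open>S\<^sub>n n \<tau> (A\<^sub>n n a)\<close> and converges
  uniformly to \<open>S \<tau> (A a)\<close>. In this way \<open>A\<close> is applied only to the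
  initial value, never to a limit.\<close>

lemma S_equation:
  assumes a: "a \<in> D" and t: "0 \<le> t"
  shows "S t a = a + volterra_conv k (\<lambda>\<tau>. S \<tau> (A a)) t"
proof -
  have tt: "t \<in> {0..t}" using t by simp
  have "uniform_limit {0..t} (\<lambda>n \<tau>. A\<^sub>n n (S\<^sub>n n \<tau> a)) (\<lambda>\<tau>. S \<tau> (A a)) sequentially"
  proof (rule uniform_limitI)
    fix \<epsilon> :: real assume \<epsilon>: "0 < \<epsilon>"
    have "\<forall>\<^sub>F n in sequentially. dist (A\<^sub>n n a) (A a) < \<epsilon> / (2 * (M + 1))"
      using A\<^sub>n_tendsto[OF a] \<epsilon> M_nonneg by (intro tendstoD) auto
    moreover have "\<forall>\<^sub>F n in sequentially. \<forall>\<tau>\<in>{0..t}. dist (S\<^sub>n n \<tau> (A a)) (S \<tau> (A a)) < \<epsilon> / 2"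
      using S_uniform_limit \<epsilon> by (intro uniform_limitD) auto
    ultimately show "\<forall>\<^sub>F n in sequentially. \<forall>\<tau>\<in>{0..t}. dist (A\<^sub>n n (S\<^sub>n n \<tau> a)) (S \<tau> (A a)) < \<epsilon>"
    proof eventually_elim
      case (elim n)
      show ?case
      proof
        fix \<tau> assume \<tau>: "\<tau> \<in> {0..t}"
        then have \<tau>0: "0 \<le> \<tau>" by simp
        have "dist (A\<^sub>n n (S\<^sub>n n \<tau> a)) (S\<^sub>n n \<tau> (A a)) = norm (S\<^sub>n n \<tau> (A\<^sub>n n a - A a))"
          by (simp add: A\<^sub>n_S\<^sub>n[OF \<tau>0] dist_norm linear_diff[OF bounded_linear.linear[OF S\<^sub>n_bounded_linear[OF \<tau>0]]])
        also have "\<dots> \<le> M * norm (A\<^sub>n n a - A a)" by (rule S\<^sub>n_norm[OF \<tau>0])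
        also have "\<dots> \<le> M * (\<epsilon> / (2 * (M + 1)))"
          using elim(1) M_nonneg by (intro mult_left_mono) (auto simp: dist_norm)
        also have "\<dots> \<le> \<epsilon> / 2" using M_nonneg \<epsilon> by (simp add: field_simps)
        finally show "dist (A\<^sub>n n (S\<^sub>n n \<tau> a)) (S \<tau> (A a)) < \<epsilon>"
          using elim(2) \<tau> dist_triangle[of "A\<^sub>n n (S\<^sub>n n \<tau> a)" "S \<tau> (A a)" "S\<^sub>n n \<tau> (A a)"] by fastforce
      qed
    qed
  qed
  then have "(\<lambda>n. a + volterra_conv k (\<lambda>\<tau>. A\<^sub>n n (S\<^sub>n n \<tau> a)) t) \<longlonglongrightarrow> a + volterra_conv k (\<lambda>\<tau>. S \<tau> (A a)) t"
    by (intro tendsto_intros tendsto_uniform_limitI[OF _ tt] volterra_conv_uniform_limit k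
        bounded_linear.continuous_on[OF A\<^sub>n_bounded_linear] S\<^sub>n_continuous continuous_on_subset[OF S_continuous]) auto
  then have "(\<lambda>n. S\<^sub>n n t a) \<longlonglongrightarrow> a + volterra_conv k (\<lambda>\<tau>. S \<tau> (A a)) t"
    by (simp flip: S\<^sub>n_equation[OF t])
  then show ?thesis using S_tendsto[OF t] LIMSEQ_unique by blast
qed

lemma S_strong_solution:
  assumes a: "a \<in> D" shows "strong_solution D A k a (\<lambda>t. S t a)"
  unfolding strong_solution_def
proof (intro conjI allI impI)
  have eq: "A (S t a) = S t (A a)" if "t \<in> {0..}" for t using S_D[OF a] that by simp
  show "S t a \<in> D" if "0 \<le> t" for t by (rule S_D[OF a that])
  show "continuous_on {0..} (\<lambda>t. S t a)" by (rule S_continuous)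
  show "continuous_on {0..} (\<lambda>t. A (S t a))"
    using S_continuous[of "A a"] by (rule continuous_on_eq) (simp add: eq)
  show "((\<lambda>\<tau>. k (t - \<tau>) *\<^sub>R A (S \<tau> a)) has_integral S t a - a) {0..t}" if t: "0 \<le> t" for t
  proof -
    have "((\<lambda>\<tau>. k (t - \<tau>) *\<^sub>R S \<tau> (A a)) has_integral volterra_conv k (\<lambda>\<tau>. S \<tau> (A a)) t) {0..t}"
      by (rule volterra_conv_has_integral[OF k continuous_on_subset[OF S_continuous]]) auto
    then have "((\<lambda>\<tau>. k (t - \<tau>) *\<^sub>R S \<tau> (A a)) has_integral S t a - a) {0..t}"
      using S_equation[OF a t] by simp
    then show ?thesis
      by (rule has_integral_eq[rotated]) (simp add: eq)
  qed
qed

text \<open>The difference w of two solutions solves the n-th approximate equation with source g_n =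
  A w - A_n w, hence the norm of w is at most k*N(g_n). The sources tend to 0 at every time, and
  dominated convergence gives w = 0.\<close>

lemma strong_solution_unique:
  assumes u: "strong_solution D A k a u" and v: "strong_solution D A k a v" and t: "0 \<le> t"
  shows "u t = v t"
proof -
  define w where "w \<tau> = u \<tau> - v \<tau>" for \<tau>
  have wD: "w \<tau> \<in> D" "A (w \<tau>) = A (u \<tau>) - A (v \<tau>)" if "0 \<le> \<tau>" for \<tau>
    using u v that D_diff unfolding strong_solution_def w_def by auto
  have wc: "continuous_on {0..t} w"
    using u v unfolding strong_solution_def w_def by (intro continuous_intros) (auto intro: continuous_on_subset)
  have "continuous_on {0..t} (\<lambda>\<tau>. A (u \<tau>) - A (v \<tau>))"
    using u v unfolding strong_solution_def by (intro continuous_intros) (auto intro: continuous_on_subset)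
  then have Awc: "continuous_on {0..t} (\<lambda>\<tau>. A (w \<tau>))"
    by (rule continuous_on_eq) (simp add: wD(2))
  have weq: "w s = volterra_conv k (\<lambda>\<tau>. A (w \<tau>)) s" if s: "s \<in> {0..t}" for s
  proof -
    have "((\<lambda>\<tau>. k (s - \<tau>) *\<^sub>R A (u \<tau>) - k (s - \<tau>) *\<^sub>R A (v \<tau>)) has_integral (u s - a) - (v s - a)) {0..s}"
      using u v s unfolding strong_solution_def by (intro has_integral_diff) auto
    then have "((\<lambda>\<tau>. k (s - \<tau>) *\<^sub>R A (u \<tau>) - k (s - \<tau>) *\<^sub>R A (v \<tau>)) has_integral w s) {0..s}"
      by (simp add: w_def)
    then have "((\<lambda>\<tau>. k (s - \<tau>) *\<^sub>R A (w \<tau>)) has_integral w s) {0..s}"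
      by (rule has_integral_eq[rotated]) (simp add: wD scaleR_diff_right)
    then show ?thesis unfolding volterra_conv_def by (rule integral_unique[symmetric])
  qed
  define g where "g n \<tau> = A (w \<tau>) - A\<^sub>n n (w \<tau>)" for n \<tau>
  have gc: "continuous_on {0..t} (g n)" for n
    unfolding g_def by (intro continuous_intros Awc bounded_linear.continuous_on[OF A\<^sub>n_bounded_linear] wc)
  have bd: "norm (w t) \<le> volterra_conv k (\<lambda>\<tau>. N (g n \<tau>)) t" for n
  proof (rule A\<^sub>n_estimate[where n = n, OF wc gc])
    fix s assume "s \<in> {0..t}"
    then have "w s = volterra_conv k (\<lambda>\<tau>. A (w \<tau>)) s" by (rule weq)
    also have "(\<lambda>\<tau>. A (w \<tau>)) = (\<lambda>\<tau>. A\<^sub>n n (w \<tau>) + g n \<tau>)" by (simp add: g_def)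
    finally show "w s = volterra_conv k (\<lambda>\<tau>. A\<^sub>n n (w \<tau>) + g n \<tau>) s" .
  qed (use t in auto)
  obtain C where C: "0 < C" "\<And>\<tau>. \<tau> \<in> {0..t} \<Longrightarrow> norm (A (w \<tau>)) \<le> C"
    using continuous_on_Icc_bounded[OF Awc] by blast
  \<comment> \<open>A bound uniform in n: difference quotients at a point x of the domain are
    bounded by M times the norm of A x, and \<open>A (w \<tau>)\<close> is continuous on the compact
    interval.\<close>
  have gle: "N (g n \<tau>) \<le> M * (C + M * C)" if \<tau>: "\<tau> \<in> {0..t}" for n \<tau>
  proof -
    have "norm (g n \<tau>) \<le> norm (A (w \<tau>)) + norm (A\<^sub>n n (w \<tau>))" unfolding g_def by (rule norm_triangle_ineq4)
    also have "\<dots> \<le> norm (A (w \<tau>)) + M * norm (A (w \<tau>))" using A\<^sub>n_norm[OF wD(1)] \<tau> by simp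
    also have "\<dots> \<le> C + M * C" using C(2)[OF \<tau>] M_nonneg by (intro add_mono mult_left_mono) auto
    finally show ?thesis using N_le[of "g n \<tau>"] mult_left_mono[OF _ M_nonneg] order_trans by blast
  qed
  have N0: "0 \<le> N x" for x using norm_le_N[of x] norm_ge_zero[of x] by linarith
  have "(\<lambda>n. integral {0..t} (\<lambda>\<tau>. k (t - \<tau>) *\<^sub>R N (g n \<tau>))) \<longlonglongrightarrow> integral {0..t} (\<lambda>\<tau>. 0)"
  proof (rule dominated_convergence(2))
    show "(\<lambda>\<tau>. k (t - \<tau>) *\<^sub>R N (g n \<tau>)) integrable_on {0..t}" for n
      by (intro volterra_conv_integrable k N_continuous_comp gc)
    show "(\<lambda>\<tau>. k (t - \<tau>) *\<^sub>R (M * (C + M * C))) integrable_on {0..t}"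
      by (intro volterra_conv_integrable k continuous_intros)
    show "norm (k (t - \<tau>) *\<^sub>R N (g n \<tau>)) \<le> k (t - \<tau>) *\<^sub>R (M * (C + M * C))" if "\<tau> \<in> {0..t}" for n \<tau>
      using gle[OF that] N0 laplace_kernelD(2)[OF k, of "t - \<tau>"] by (simp add: abs_mult mult_left_mono)
    show "(\<lambda>n. k (t - \<tau>) *\<^sub>R N (g n \<tau>)) \<longlonglongrightarrow> 0" if \<tau>: "\<tau> \<in> {0..t}" for \<tau>
    proof -
      have "(\<lambda>n. M * norm (g n \<tau>)) \<longlonglongrightarrow> M * norm (A (w \<tau>) - A (w \<tau>))"
        unfolding g_def using \<tau> by (intro tendsto_intros A\<^sub>n_tendsto wD) auto
      then have "(\<lambda>n. N (g n \<tau>)) \<longlonglongrightarrow> 0"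
        using tendsto_sandwich[of "\<lambda>_. 0" "\<lambda>n. N (g n \<tau>)" sequentially "\<lambda>n. M * norm (g n \<tau>)" 0]
        by (simp add: N0 N_le)
      from tendsto_scaleR[OF tendsto_const this] show ?thesis by simp
    qed
  qed
  then have "(\<lambda>n. volterra_conv k (\<lambda>\<tau>. N (g n \<tau>)) t) \<longlonglongrightarrow> 0" by (simp add: volterra_conv_def)
  then have "norm (w t) \<le> 0" using bd by (intro LIMSEQ_le_const) auto
  then show ?thesis by (simp add: w_def)
qed

lemma the_strong_solution_eq:
  assumes a: "a \<in> D" and t: "0 \<le> t" shows "the_strong_solution D A k a t = S t a"
  unfolding the_strong_solution_def
  by (rule the_equality) (use S_strong_solution[OF a] strong_solution_unique t in blast)+

text \<open>Required before \<open>solution_operator\<close> can be evaluated, since its value is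
  \<open>undefined\<close> for an ill-posed equation. Continuous dependence is the bound
  \<open>S_norm\<close>.\<close>

lemma well_posed: "well_posed D A k"
  unfolding well_posed_def
proof (intro conjI ballI allI impI)
  show "\<exists>u. strong_solution D A k a u" if "a \<in> D" for a using S_strong_solution[OF that] by blast
  show "u t = v t" if "strong_solution D A k a u" "strong_solution D A k a v" "0 \<le> t" for a u v t
    using that by (rule strong_solution_unique)
  fix a :: "nat \<Rightarrow> 'a" and R :: real
  assume a: "\<forall>n. a n \<in> D" "a \<longlonglongrightarrow> 0"
  show "uniform_limit {0..R} (\<lambda>n t. the_strong_solution D A k (a n) t) (\<lambda>_. 0) sequentially"
  proof (rule uniform_limitI)
    fix \<epsilon> :: real assume \<epsilon>: "0 < \<epsilon>"
    have "(\<lambda>n. M * norm (a n)) \<longlonglongrightarrow> 0" using tendsto_mult_right_zero[OF tendsto_norm_zero[OF a(2)]] .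
    then have "\<forall>\<^sub>F n in sequentially. M * norm (a n) < \<epsilon>" using \<epsilon> by (rule order_tendstoD)
    then show "\<forall>\<^sub>F n in sequentially. \<forall>t\<in>{0..R}. dist (the_strong_solution D A k (a n) t) 0 < \<epsilon>"
    proof eventually_elim
      case (elim n)
      show ?case
      proof
        fix t assume "t \<in> {0..R}"
        then show "dist (the_strong_solution D A k (a n) t) 0 < \<epsilon>"
          using S_norm[of t "a n"] a(1) elim by (simp add: the_strong_solution_eq)
      qed
    qed
  qed
qed

lemma solution_operator_eq:
  assumes t: "0 \<le> t" shows "solution_operator D A k t a = S t a"
proof (cases "a \<in> D")
  case False
  have "((\<lambda>x. the_strong_solution D A k x t) \<longlongrightarrow> S t a) (at a within D)"
  proof (rule Lim_transform_eventually)
    show "(S t \<longlongrightarrow> S t a) (at a within D)"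
      by (rule bounded_linear.tendsto[OF S_bounded_linear[OF t] tendsto_ident_at])
    show "\<forall>\<^sub>F x in at a within D. S t x = the_strong_solution D A k x t"
      using the_strong_solution_eq t by (simp add: eventually_at_filter)
  qed
  \<comment> \<open>A point of the closure that is not in \<open>D\<close> is a limit point of
    \<open>D\<close>, so the \<open>Lim\<close> in the definition is a genuine limit.\<close>
  moreover have "at a within D \<noteq> bot"
    using False D_dense islimpt_iff_eventually[of a D] closure_def[of D] trivial_limit_within[of a D] by auto
  ultimately show ?thesis
    using False well_posed by (simp add: solution_operator_def tendsto_Lim)
qed (use well_posed t in \<open>simp add: solution_operator_def the_strong_solution_eq\<close>)

end

section \<open>Positivity from the moments of the Laplace transform\<close>

lemma poisson_sums:
  fixes x :: real
  shows "(\<lambda>n. x ^ n / fact n) sums exp x"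
    and "(\<lambda>n. real n * (x ^ n / fact n)) sums (x * exp x)"
    and "(\<lambda>n. (real n)\<^sup>2 * (x ^ n / fact n)) sums ((x\<^sup>2 + x) * exp x)"
proof -
  show 0: "(\<lambda>n. x ^ n / fact n) sums exp x"
    using exp_converges[of x] by (simp add: divide_inverse mult.commute)
  have s: "real (Suc n) * (x ^ Suc n / fact (Suc n)) = x * (x ^ n / fact n)" for n
    by (simp del: of_nat_Suc)
  have "(\<lambda>n. real (Suc n) * (x ^ Suc n / fact (Suc n))) sums (x * exp x)"
    unfolding s by (intro sums_mult 0)
  then show 1: "(\<lambda>n. real n * (x ^ n / fact n)) sums (x * exp x)"
    by (subst (asm) sums_Suc_iff) simp
  have "(real (Suc n))\<^sup>2 * (x ^ Suc n / fact (Suc n)) = x * (real n * (x ^ n / fact n) + x ^ n / fact n)" for n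
  proof -
    have "(real (Suc n))\<^sup>2 * (x ^ Suc n / fact (Suc n)) = real (Suc n) * (x * (x ^ n / fact n))"
      by (simp only: power2_eq_square mult.assoc s)
    also have "\<dots> = x * (real n * (x ^ n / fact n) + x ^ n / fact n)" by (simp add: algebra_simps add_divide_distrib)
    finally show ?thesis .
  qed
  then have "(\<lambda>n. (real (Suc n))\<^sup>2 * (x ^ Suc n / fact (Suc n))) sums (x * (x * exp x + exp x))"
    by (simp only:) (intro sums_mult sums_add 0 1)
  then show "(\<lambda>n. (real n)\<^sup>2 * (x ^ n / fact n)) sums ((x\<^sup>2 + x) * exp x)"
    by (subst (asm) sums_Suc_iff) (simp add: power2_eq_square algebra_simps)
qed

definition poisson :: "real \<Rightarrow> nat \<Rightarrow> real" where
  "poisson x n = exp (- x) * (x ^ n / fact n)"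

lemma poisson_nonneg: "0 \<le> x \<Longrightarrow> 0 \<le> poisson x n"
  by (simp add: poisson_def)

lemma poisson_moments:
  shows "poisson x sums 1"
    and "(\<lambda>n. real n * poisson x n) sums x"
    and "(\<lambda>n. (real n)\<^sup>2 * poisson x n) sums (x\<^sup>2 + x)"
proof -
  have e: "exp (- x) * (c * exp x) = c" for c by (simp add: mult.left_commute flip: exp_add)
  have p: "exp (- x) * (c * (x ^ n / fact n)) = c * poisson x n" for c n by (simp add: poisson_def)
  show "poisson x sums 1"
    using sums_mult[OF poisson_sums(1), of "exp (- x)" x] by (simp add: poisson_def[abs_def] flip: exp_add)
  show "(\<lambda>n. real n * poisson x n) sums x"
    using sums_mult[OF poisson_sums(2), of "exp (- x)" x] unfolding p e .
  show "(\<lambda>n. (real n)\<^sup>2 * poisson x n) sums (x\<^sup>2 + x)"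
    using sums_mult[OF poisson_sums(3), of "exp (- x)" x] unfolding p e .
qed

lemma poisson_le_1: "0 \<le> x \<Longrightarrow> poisson x n \<le> 1"
  using sum_le_suminf[OF sums_summable[OF poisson_moments(1)], of "{n}" x] poisson_nonneg[of x]
    sums_unique[OF poisson_moments(1), of x] by simp

text \<open>The Szasz-Mirakyan operator: the expectation of \<phi>(Z/m) for a Poisson variable Z of
  mean m t. At \<open>m = 0\<close> division by zero makes it the constant
  \<open>\<phi> 0\<close>.\<close>

definition szasz :: "(real \<Rightarrow> real) \<Rightarrow> nat \<Rightarrow> real \<Rightarrow> real" where
  "szasz \<phi> m t = (\<Sum>n. \<phi> (real n / real m) * poisson (real m * t) n)"

lemma szasz_summable:
  assumes "\<And>x. \<bar>\<phi> x\<bar> \<le> (1::real)" "0 \<le> x"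
  shows "summable (\<lambda>n. \<bar>\<phi> (real n / real m) * poisson x n\<bar>)"
proof (rule summable_comparison_test'[OF sums_summable[OF poisson_moments(1)], where N = 0])
  show "norm \<bar>\<phi> (real n / real m) * poisson x n\<bar> \<le> poisson x n" for n
    using mult_right_mono[OF assms(1)[of "real n / real m"] poisson_nonneg[OF assms(2)], of n] poisson_nonneg[OF assms(2), of n]
    by (simp add: abs_mult)
qed

text \<open>Z/m has mean t and variance t/m. For a Lipschitz function the error is at most L times
  the mean absolute deviation, which is controlled by the variance and hence is of order 1/sqrt
  m.\<close>

lemma szasz_tendsto:
  assumes b: "\<And>x. \<bar>\<phi> x\<bar> \<le> (1::real)" and L: "\<And>x y. \<bar>\<phi> x - \<phi> y\<bar> \<le> L * \<bar>x - y\<bar>" and t: "0 \<le> t"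
  shows "(\<lambda>m. szasz \<phi> m t) \<longlonglongrightarrow> \<phi> t"
proof -
  have L0: "0 \<le> L" using L[of 1 0] by (simp add: order_trans[OF abs_ge_zero])
  have est: "\<bar>szasz \<phi> m t - \<phi> t\<bar> \<le> L * (1 + t) / (2 * sqrt (real m))" if m: "0 < m" for m
  proof -
    define M where "M = real m"
    have M: "0 < M" using m by (simp add: M_def)
    \<comment> \<open>The deviation d is estimated by 2 d \<le> \<eta> + d^2/\<eta>, which is linear
      in d^2 and so can be averaged; this \<eta> gives both terms the order 1/sqrt M.\<close>
    define \<eta> where "\<eta> = 1 / sqrt M"
    have \<eta>: "0 < \<eta>" using M by (simp add: \<eta>_def)
    define p where "p = poisson (M * t)"
    have p0: "0 \<le> p n" for n unfolding p_def using M t by (intro poisson_nonneg) auto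
    note pm = poisson_moments[of "M * t", folded p_def]
    have "(\<lambda>n. 1 / M\<^sup>2 * ((real n)\<^sup>2 * p n) - 2 * t / M * (real n * p n) + t\<^sup>2 * p n) sums
       (1 / M\<^sup>2 * ((M * t)\<^sup>2 + M * t) - 2 * t / M * (M * t) + t\<^sup>2 * 1)"
      by (intro sums_add sums_diff sums_mult pm)
    also have "(\<lambda>n. 1 / M\<^sup>2 * ((real n)\<^sup>2 * p n) - 2 * t / M * (real n * p n) + t\<^sup>2 * p n) = (\<lambda>n. (real n / M - t)\<^sup>2 * p n)"
      using M by (auto simp: fun_eq_iff power2_eq_square field_simps)
    also have "1 / M\<^sup>2 * ((M * t)\<^sup>2 + M * t) - 2 * t / M * (M * t) + t\<^sup>2 * 1 = t / M"
      using M by (simp add: power2_eq_square field_simps)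
    finally have var: "(\<lambda>n. (real n / M - t)\<^sup>2 * p n) sums (t / M)" .
    have ub: "(\<lambda>n. L / 2 * (\<eta> * p n + 1 / \<eta> * ((real n / M - t)\<^sup>2 * p n))) sums (L / 2 * (\<eta> * 1 + 1 / \<eta> * (t / M)))"
      by (intro sums_mult sums_add var pm(1))
    have le: "\<bar>(\<phi> (real n / M) - \<phi> t) * p n\<bar> \<le> L / 2 * (\<eta> * p n + 1 / \<eta> * ((real n / M - t)\<^sup>2 * p n))" for n
    proof -
      define d where "d = \<bar>real n / M - t\<bar>"
      have "0 \<le> (d - \<eta>)\<^sup>2" by simp
      then have "2 * d * \<eta> \<le> \<eta>\<^sup>2 + d\<^sup>2" by (simp add: power2_diff algebra_simps)
      then have "d \<le> (\<eta> + d\<^sup>2 / \<eta>) / 2" using \<eta> by (simp add: field_simps power2_eq_square)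
      then have "L * d \<le> L * ((\<eta> + d\<^sup>2 / \<eta>) / 2)" using L0 by (rule mult_left_mono)
      then have "\<bar>\<phi> (real n / M) - \<phi> t\<bar> \<le> L * ((\<eta> + d\<^sup>2 / \<eta>) / 2)"
        using L[of "real n / M" t] unfolding d_def by linarith
      then have "\<bar>\<phi> (real n / M) - \<phi> t\<bar> * p n \<le> L * ((\<eta> + d\<^sup>2 / \<eta>) / 2) * p n"
        by (rule mult_right_mono[OF _ p0])
      also have "\<dots> = L / 2 * (\<eta> * p n + 1 / \<eta> * ((real n / M - t)\<^sup>2 * p n))"
        by (simp add: d_def field_simps)
      finally show ?thesis using p0[of n] by (simp add: abs_mult)
    qed
    have "(\<lambda>n. \<phi> (real n / M) * p n) sums szasz \<phi> m t"
      unfolding szasz_def p_def M_def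
      by (rule summable_sums[OF summable_rabs_cancel[OF szasz_summable[of \<phi>, OF b]]]) (use t in simp)
    then have "(\<lambda>n. \<phi> (real n / M) * p n - \<phi> t * p n) sums (szasz \<phi> m t - \<phi> t * 1)"
      by (intro sums_diff sums_mult pm(1))
    then have s: "(\<lambda>n. (\<phi> (real n / M) - \<phi> t) * p n) sums (szasz \<phi> m t - \<phi> t)"
      by (simp add: left_diff_distrib)
    have sa: "summable (\<lambda>n. \<bar>(\<phi> (real n / M) - \<phi> t) * p n\<bar>)"
      by (rule summable_comparison_test'[OF sums_summable[OF ub], where N = 0]) (use le in simp)
    have "\<bar>szasz \<phi> m t - \<phi> t\<bar> \<le> (\<Sum>n. \<bar>(\<phi> (real n / M) - \<phi> t) * p n\<bar>)"
      using summable_rabs[OF sa] sums_unique[OF s] by simp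
    also have "\<dots> \<le> L / 2 * (\<eta> * 1 + 1 / \<eta> * (t / M))"
      using suminf_le[OF le sa sums_summable[OF ub]] sums_unique[OF ub] by simp
    also have "\<dots> = L * (1 + t) / (2 * sqrt M)"
      using M real_sqrt_mult_self[of M] by (simp add: \<eta>_def field_simps)
    finally show ?thesis by (simp add: M_def)
  qed
  have "(\<lambda>m. szasz \<phi> m t - \<phi> t) \<longlonglongrightarrow> 0"
  proof (rule Lim_null_comparison)
    show "\<forall>\<^sub>F m in sequentially. norm (szasz \<phi> m t - \<phi> t) \<le> L * (1 + t) / (2 * sqrt (real m))"
      using eventually_gt_at_top[of 0] by eventually_elim (use est in simp)
    show "(\<lambda>m. L * (1 + t) / (2 * sqrt (real m))) \<longlonglongrightarrow> 0"
      by (intro real_tendsto_divide_at_top[OF tendsto_const] filterlim_tendsto_pos_mult_at_top[OF tendsto_const]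
          filterlim_compose[OF sqrt_at_top filterlim_real_sequentially]) simp
  qed
  then show ?thesis by (simp add: LIM_zero_iff)
qed

lemma szasz_bound:
  assumes b: "\<And>x. \<bar>\<phi> x\<bar> \<le> (1::real)" and t: "0 \<le> t"
  shows "(\<Sum>n<j. \<bar>\<phi> (real n / real m) * poisson (real m * t) n\<bar>) \<le> 1" and "\<bar>szasz \<phi> m t\<bar> \<le> 1"
proof -
  have x: "0 \<le> real m * t" using t by simp
  have le: "\<bar>\<phi> (real n / real m) * poisson (real m * t) n\<bar> \<le> poisson (real m * t) n" for n
    using mult_right_mono[OF b[of "real n / real m"] poisson_nonneg[OF x], of n] poisson_nonneg[OF x, of n]
    by (simp add: abs_mult)
  note s = szasz_summable[of \<phi>, OF b x, where m = m]
  have *: "(\<Sum>n. \<bar>\<phi> (real n / real m) * poisson (real m * t) n\<bar>) \<le> 1"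
    using suminf_le[OF le s sums_summable[OF poisson_moments(1)]] sums_unique[OF poisson_moments(1), of "real m * t"] by simp
  show "\<bar>szasz \<phi> m t\<bar> \<le> 1" unfolding szasz_def using summable_rabs[OF s] * by linarith
  show "(\<Sum>n<j. \<bar>\<phi> (real n / real m) * poisson (real m * t) n\<bar>) \<le> 1"
    using sum_le_suminf[OF s, of "{..<j}"] * by simp
qed

text \<open>With d = l - s, the quantity exp(-d t) (d t)^n / n! is a Poisson probability and so at
  most 1. This bounds the power of t by a constant once part of the damping is spent on it.\<close>

lemma integrable_power_exp:
  fixes f :: "real \<Rightarrow> real"
  assumes [measurable]: "f \<in> borel_measurable borel" and f0: "\<And>t. t < 0 \<Longrightarrow> f t = 0"
    and int: "integrable lborel (\<lambda>t. exp (- s * t) * f t)" and s: "s < l"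
  shows "integrable lborel (\<lambda>t. exp (- l * t) * t ^ n * f t)"
proof (rule Bochner_Integration.integrable_bound)
  show "integrable lborel (\<lambda>t. fact n / (l - s) ^ n * (exp (- s * t) * f t))" using int by simp
  show "AE t in lborel. norm (exp (- l * t) * t ^ n * f t) \<le> norm (fact n / (l - s) ^ n * (exp (- s * t) * f t))"
  proof (rule AE_I2)
    fix t :: real
    show "norm (exp (- l * t) * t ^ n * f t) \<le> norm (fact n / (l - s) ^ n * (exp (- s * t) * f t))"
    proof (cases "t < 0")
      case False
      define d where "d = l - s"
      have d: "0 < d" using s by (simp add: d_def)
      have "poisson (d * t) n \<le> 1" using False d by (intro poisson_le_1) auto
      then have "exp (- d * t) * t ^ n \<le> fact n / d ^ n"
        using d by (simp add: poisson_def field_simps power_mult_distrib)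
      then have "exp (- (l - s) * t) * t ^ n \<le> fact n / (l - s) ^ n" unfolding d_def .
      then have "exp (- (l - s) * t) * t ^ n * (exp (- s * t) * \<bar>f t\<bar>) \<le> fact n / (l - s) ^ n * (exp (- s * t) * \<bar>f t\<bar>)"
        by (rule mult_right_mono) simp
      moreover have id: "exp (- l * t) = exp (- (l - s) * t) * exp (- s * t)"
        by (simp add: algebra_simps flip: exp_add)
      moreover have "norm (exp (- l * t) * t ^ n * f t) = exp (- (l - s) * t) * t ^ n * (exp (- s * t) * \<bar>f t\<bar>)"
        unfolding id using False by (simp add: abs_mult mult_ac)
      moreover have "norm (fact n / (l - s) ^ n * (exp (- s * t) * f t)) = fact n / (l - s) ^ n * (exp (- s * t) * \<bar>f t\<bar>)"
        using s by (simp add: abs_mult)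
      ultimately show ?thesis by simp
    qed (use f0 in simp)
  qed
qed measurable

text \<open>The Szasz operators approximate a nonnegative test function by nonnegative combinations of the
  functions \<open>t\<^sup>n exp (- m t)\<close>; inner regularity then reduces the claim to test functions decreasing to the
  indicator of a compact set.\<close>

lemma AE_nonneg_if_moments_nonneg:
  fixes f :: "real \<Rightarrow> real"
  assumes [measurable]: "f \<in> borel_measurable borel" and f0: "\<And>t. t < 0 \<Longrightarrow> f t = 0"
    and int: "\<And>s. s0 < s \<Longrightarrow> integrable lborel (\<lambda>t. exp (- s * t) * f t)"
    and mom: "\<And>l n. s0 < l \<Longrightarrow> 0 \<le> (\<integral>t. exp (- l * t) * t ^ n * f t \<partial>lborel)"
  shows "AE t in lborel. 0 \<le> f t"
proof -
  \<comment> \<open>Some fixed damping beyond \<open>s0\<close> makes \<open>F\<close> integrable,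
    so that bounded test functions may be integrated against it.\<close>
  define l where "l = s0 + 1"
  define F where "F t = exp (- l * t) * f t" for t
  have l: "s0 < l" by (simp add: l_def)
  have F: "integrable lborel F" using int[OF l] by (simp add: F_def[abs_def])
  then have [measurable]: "F \<in> borel_measurable borel" by auto
  have F0: "F t = 0" if "t < 0" for t using f0[OF that] by (simp add: F_def)
  have step: "0 \<le> (\<integral>t. F t * \<phi> t \<partial>lborel)"
    if \<phi>0: "\<And>x. 0 \<le> \<phi> x" and \<phi>1: "\<And>x. \<phi> x \<le> (1::real)" and L: "\<And>x y. \<bar>\<phi> x - \<phi> y\<bar> \<le> L * \<bar>x - y\<bar>" for \<phi> L
  proof -
    have b: "\<bar>\<phi> x\<bar> \<le> 1" for x using \<phi>0 \<phi>1 by simp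
    have "L-lipschitz_on UNIV \<phi>"
      using L[of 1 0] by (intro lipschitz_onI) (auto simp: dist_real_def L order_trans[OF abs_ge_zero])
    then have [measurable]: "\<phi> \<in> borel_measurable borel"
      by (intro borel_measurable_continuous_onI lipschitz_on_continuous_on)
    have [measurable]: "(\<lambda>t. poisson (real m * t) n) \<in> borel_measurable borel" for m n
      unfolding poisson_def by measurable
    have [measurable]: "szasz \<phi> m \<in> borel_measurable borel" for m
      unfolding szasz_def by measurable
    have sz: "0 \<le> (\<integral>t. F t * szasz \<phi> m t \<partial>lborel)" for m
    proof -
      have tm: "0 \<le> (\<integral>t. F t * (\<phi> (real n / real m) * poisson (real m * t) n) \<partial>lborel)" 
        and tm_int: "integrable lborel (\<lambda>t. F t * (\<phi> (real n / real m) * poisson (real m * t) n))" for n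
      proof -
        \<comment> \<open>The Poisson weight and the damping in \<open>F\<close> merge into exp(-(l
          + m) t) t^n. As l + m > s0, the integral is one of the given moments times a nonnegative
          constant.\<close>
        have eq: "F t * (\<phi> (real n / real m) * poisson (real m * t) n) = (\<phi> (real n / real m) * real m ^ n / fact n) * (exp (- (l + real m) * t) * t ^ n * f t)" for t
          by (simp add: F_def poisson_def power_mult_distrib exp_add exp_diff exp_minus field_simps distrib_right)
        show "0 \<le> (\<integral>t. F t * (\<phi> (real n / real m) * poisson (real m * t) n) \<partial>lborel)"
          unfolding eq using mom[of "l + real m" n] l \<phi>0 by simp
        obtain s where s: "s0 < s" "s < l + real m" using dense[of s0 "l + real m"] l by auto
        show "integrable lborel (\<lambda>t. F t * (\<phi> (real n / real m) * poisson (real m * t) n))"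
          unfolding eq by (intro integrable_mult_right integrable_power_exp[OF _ f0 int[OF s(1)] s(2)]) auto
      qed
      have "(\<lambda>j. \<integral>t. F t * (\<Sum>n<j. \<phi> (real n / real m) * poisson (real m * t) n) \<partial>lborel) \<longlonglongrightarrow> (\<integral>t. F t * szasz \<phi> m t \<partial>lborel)"
      proof (rule integral_dominated_convergence)
        show "integrable lborel (\<lambda>t. \<bar>F t\<bar>)" using F by simp
        show "AE t in lborel. (\<lambda>j. F t * (\<Sum>n<j. \<phi> (real n / real m) * poisson (real m * t) n)) \<longlonglongrightarrow> F t * szasz \<phi> m t"
        proof (rule AE_I2)
          fix t :: real
          show "(\<lambda>j. F t * (\<Sum>n<j. \<phi> (real n / real m) * poisson (real m * t) n)) \<longlonglongrightarrow> F t * szasz \<phi> m t"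
          proof (cases "t < 0")
            case False
            have "(\<lambda>n. \<phi> (real n / real m) * poisson (real m * t) n) sums szasz \<phi> m t"
              unfolding szasz_def
              by (rule summable_sums[OF summable_rabs_cancel[OF szasz_summable[of \<phi>, OF b]]]) (use False in simp)
            then show ?thesis unfolding sums_def by (intro tendsto_intros)
          qed (simp add: F0)
        qed
        show "AE t in lborel. norm (F t * (\<Sum>n<j. \<phi> (real n / real m) * poisson (real m * t) n)) \<le> \<bar>F t\<bar>" for j
        proof (rule AE_I2)
          fix t :: real
          show "norm (F t * (\<Sum>n<j. \<phi> (real n / real m) * poisson (real m * t) n)) \<le> \<bar>F t\<bar>"
          proof (cases "t < 0")
            case False
            then have "\<bar>\<Sum>n<j. \<phi> (real n / real m) * poisson (real m * t) n\<bar> \<le> 1"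
              using order_trans[OF sum_abs szasz_bound(1)[of \<phi>, OF b]] by simp
            then show ?thesis using mult_left_mono[of _ 1 "\<bar>F t\<bar>"] by (simp add: abs_mult)
          qed (simp add: F0)
        qed
      qed measurable
      moreover have "0 \<le> (\<integral>t. F t * (\<Sum>n<j. \<phi> (real n / real m) * poisson (real m * t) n) \<partial>lborel)" for j
      proof -
        have "(\<integral>t. F t * (\<Sum>n<j. \<phi> (real n / real m) * poisson (real m * t) n) \<partial>lborel) =
          (\<Sum>n<j. \<integral>t. F t * (\<phi> (real n / real m) * poisson (real m * t) n) \<partial>lborel)"
          unfolding sum_distrib_left by (intro Bochner_Integration.integral_sum tm_int)
        then show ?thesis using tm by (simp add: sum_nonneg)
      qed
      ultimately show ?thesis by (intro LIMSEQ_le_const) auto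
    qed
    have "(\<lambda>m. \<integral>t. F t * szasz \<phi> m t \<partial>lborel) \<longlonglongrightarrow> (\<integral>t. F t * \<phi> t \<partial>lborel)"
    proof (rule integral_dominated_convergence)
      show "integrable lborel (\<lambda>t. \<bar>F t\<bar>)" using F by simp
      show "AE t in lborel. (\<lambda>m. F t * szasz \<phi> m t) \<longlonglongrightarrow> F t * \<phi> t"
      proof (rule AE_I2)
        fix t :: real
        show "(\<lambda>m. F t * szasz \<phi> m t) \<longlonglongrightarrow> F t * \<phi> t"
          by (cases "t < 0") (auto simp: F0 intro!: tendsto_intros szasz_tendsto[of \<phi>, OF b L])
      qed
      show "AE t in lborel. norm (F t * szasz \<phi> m t) \<le> \<bar>F t\<bar>" for m
      proof (rule AE_I2)
        fix t :: real
        show "norm (F t * szasz \<phi> m t) \<le> \<bar>F t\<bar>"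
        proof (cases "t < 0")
          case False
          then have "\<bar>szasz \<phi> m t\<bar> \<le> 1" by (intro szasz_bound(2)[of \<phi>, OF b]) simp
          then show ?thesis using mult_left_mono[of _ 1 "\<bar>F t\<bar>"] by (simp add: abs_mult)
        qed (simp add: F0)
      qed
    qed measurable
    then show ?thesis using sz by (intro LIMSEQ_le_const) auto
  qed
  define B where "B = {t. F t < 0}"
  have [measurable]: "B \<in> sets borel" unfolding B_def by measurable
  \<comment> \<open>A finite measure on the line, hence inner regular: it suffices that it vanishes
    on every compact set where \<open>F\<close> is negative.\<close>
  define M where "M = density lborel (\<lambda>t. ennreal \<bar>F t\<bar>)"
  have K: "emeasure M K = 0" if K: "compact K" "K \<subseteq> B" for K
  \<comment> \<open>The distance to the empty set is 0 by convention, so the tents below would not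
    approach its indicator.\<close>
  proof (cases "K = {}")
    case False
    have [measurable]: "K \<in> sets borel" using K(1) by (simp add: compact_imp_closed)
    \<comment> \<open>Tents of slope j: values between 0 and 1, Lipschitz as \<open>step\<close>
      requires, equal to 1 on \<open>K\<close>, and 0 at a point off \<open>K\<close> once j times
      its distance exceeds 1.\<close>
    define \<phi> where "\<phi> j t = max 0 (1 - real j * infdist t K)" for j t
    have pos: "0 \<le> (\<integral>t. F t * \<phi> j t \<partial>lborel)" for j
    proof (rule step[where L = "real j"])
      fix x y
      have "\<bar>real j * infdist x K - real j * infdist y K\<bar> = real j * \<bar>infdist x K - infdist y K\<bar>"
        by (simp add: abs_mult flip: right_diff_distrib)
      also have "\<dots> \<le> real j * \<bar>x - y\<bar>"
        using infdist_triangle_abs[of x K y] by (intro mult_left_mono) (auto simp: dist_real_def)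
      finally show "\<bar>\<phi> j x - \<phi> j y\<bar> \<le> real j * \<bar>x - y\<bar>" unfolding \<phi>_def max_def by auto
    qed (auto simp: \<phi>_def infdist_nonneg)
    have [measurable]: "\<phi> j \<in> borel_measurable borel" for j
      unfolding \<phi>_def by (intro borel_measurable_continuous_onI continuous_intros)
    have "(\<lambda>j. \<integral>t. F t * \<phi> j t \<partial>lborel) \<longlonglongrightarrow> (\<integral>t. F t * indicator K t \<partial>lborel)"
    proof (rule integral_dominated_convergence)
      show "integrable lborel (\<lambda>t. \<bar>F t\<bar>)" using F by simp
      show "AE t in lborel. norm (F t * \<phi> j t) \<le> \<bar>F t\<bar>" for j
        using mult_left_mono[of _ 1] by (intro AE_I2) (auto simp: abs_mult \<phi>_def infdist_nonneg intro!: mult_left_le)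
      show "AE t in lborel. (\<lambda>j. F t * \<phi> j t) \<longlonglongrightarrow> F t * indicator K t"
      proof (intro AE_I2 tendsto_intros)
        fix t
        show "(\<lambda>j. \<phi> j t) \<longlonglongrightarrow> indicator K t"
        proof (cases "t \<in> K")
          case False
          then have "0 < infdist t K"
            using K(1) \<open>K \<noteq> {}\<close> infdist_pos_not_in_closed compact_imp_closed by blast
          then obtain j0 where j0: "1 < real j0 * infdist t K" using ex_less_of_nat_mult by blast
          have "\<phi> j t = 0" if "j0 \<le> j" for j
          proof -
            have "real j0 * infdist t K \<le> real j * infdist t K" using that infdist_nonneg by (intro mult_right_mono) auto
            then show ?thesis using j0 by (simp add: \<phi>_def)
          qed
          then have "\<forall>\<^sub>F j in sequentially. \<phi> j t = indicator K t"
            using False by (auto simp: eventually_sequentially)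
          then show ?thesis by (rule tendsto_eventually)
        qed (simp add: \<phi>_def)
      qed
    qed measurable
    \<comment> \<open>As \<open>F\<close> is negative on \<open>K\<close>, this integral is minus
      the \<open>M\<close>-measure of \<open>K\<close>, which must therefore be 0.\<close>
    then have "0 \<le> (\<integral>t. F t * indicator K t \<partial>lborel)" using pos by (intro LIMSEQ_le_const) auto
    moreover have "integrable lborel (\<lambda>t. indicator K t * \<bar>F t\<bar>)"
      using integrable_mult_indicator[of K lborel "\<lambda>t. \<bar>F t\<bar>"] F by simp
    moreover have "(\<lambda>t. F t * indicator K t) = (\<lambda>t. - (indicator K t * \<bar>F t\<bar>))"
      using K(2) by (auto simp: fun_eq_iff indicator_def B_def)
    ultimately have "(\<integral>t. indicator K t * \<bar>F t\<bar> \<partial>lborel) \<le> 0" by simp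
    moreover have "emeasure M K = ennreal (\<integral>t. indicator K t * \<bar>F t\<bar> \<partial>lborel)"
    proof -
      have "emeasure M K = (\<integral>\<^sup>+t. ennreal \<bar>F t\<bar> * indicator K t \<partial>lborel)"
        unfolding M_def by (rule emeasure_density) auto
      also have "\<dots> = (\<integral>\<^sup>+t. ennreal (indicator K t * \<bar>F t\<bar>) \<partial>lborel)"
        by (intro nn_integral_cong) (auto simp: indicator_def)
      also have "\<dots> = ennreal (\<integral>t. indicator K t * \<bar>F t\<bar> \<partial>lborel)"
        using integrable_mult_indicator[of K lborel "\<lambda>t. \<bar>F t\<bar>"] F by (intro nn_integral_eq_integral) auto
      finally show ?thesis .
    qed
    ultimately show ?thesis by (simp add: ennreal_neg)
  qed simp
  have "emeasure M B = (SUP K\<in>{K. K \<subseteq> B \<and> compact K}. emeasure M K)"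
  proof (rule inner_regular)
    show "sets M = sets borel" by (simp add: M_def)
    have "emeasure M (space M) = (\<integral>\<^sup>+t. ennreal (norm (F t)) \<partial>lborel)"
      unfolding M_def by (subst emeasure_density) auto
    then show "emeasure M (space M) \<noteq> \<infinity>"
      using F unfolding integrable_iff_bounded by (auto simp: top.not_eq_extremum)
  qed measurable
  also have "\<dots> = 0" using K by (auto intro!: SUP_eqI)
  finally have "(\<integral>\<^sup>+t. ennreal \<bar>F t\<bar> * indicator B t \<partial>lborel) = 0"
    unfolding M_def by (subst (asm) emeasure_density) auto
  then have "AE t in lborel. ennreal \<bar>F t\<bar> * indicator B t = 0"
    by (subst (asm) nn_integral_0_iff_AE) auto
  then show ?thesis
  proof eventually_elim
    case (elim t)
    have "\<not> F t < 0"
    proof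
      assume "F t < 0"
      then have "ennreal \<bar>F t\<bar> = 0" using elim by (simp add: B_def)
      then show False using \<open>F t < 0\<close> by (simp add: ennreal_eq_0_iff)
    qed
    then show ?case by (simp add: F_def not_less zero_le_mult_iff)
  qed
qed

section \<open>Bernstein functions\<close>

lemma power_series_unique:
  fixes a b :: "nat \<Rightarrow> real"
  assumes \<epsilon>: "0 < \<epsilon>" and a: "\<And>z. \<bar>z\<bar> < \<epsilon> \<Longrightarrow> (\<lambda>n. a n * z ^ n) sums f z"
    and b: "\<And>z. \<bar>z\<bar> < \<epsilon> \<Longrightarrow> (\<lambda>n. b n * z ^ n) sums f z"
  shows "a = b"
proof
  fix m
  have s: "(\<lambda>n. (a n - b n) * z ^ n) sums 0" if "\<bar>z\<bar> < \<epsilon>" for z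
    using sums_diff[OF a[OF that] b[OF that]] by (simp add: left_diff_distrib)
  show "a m = b m"
  proof (induction m rule: less_induct)
    case (less m)
    have "((\<lambda>_. 0) \<longlongrightarrow> a (0 + m) - b (0 + m)) (at (0::real))"
    proof (rule powser_limit_0_strong[OF \<epsilon>])
      fix z :: real assume z: "z \<noteq> 0" "norm z < \<epsilon>"
      have "(\<lambda>n. (a (n + m) - b (n + m)) * z ^ (n + m)) sums 0"
        using sums_iff_shift[of "\<lambda>n. (a n - b n) * z ^ n" m 0] s[of z] z less by simp
      from sums_divide[OF this, of "z ^ m"] z(1)
      show "(\<lambda>n. (a (n + m) - b (n + m)) * z ^ n) sums 0" by (simp add: power_add)
    qed
    from tendsto_unique[OF _ this tendsto_const] show ?case by simp
  qed
qed

text \<open>An exact identity between truncations. It serves to bound the partial sums of a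
  reciprocal series whose convergence is not yet known.\<close>

lemma convolution_partial_sum:
  fixes a b :: "nat \<Rightarrow> 'a::comm_semiring_1"
  shows "(\<Sum>n\<le>N. (\<Sum>i\<le>n. a i * b (n - i)) * z ^ n) = (\<Sum>j\<le>N. b j * z ^ j * (\<Sum>i\<le>N - j. a i * z ^ i))"
proof -
  have "(\<Sum>n\<le>N. (\<Sum>i\<le>n. a i * b (n - i)) * z ^ n) = (\<Sum>(n, i)\<in>(SIGMA n:{..N}. {..n}). a i * b (n - i) * z ^ n)"
    by (simp add: sum.Sigma sum_distrib_right)
  also have "\<dots> = (\<Sum>(j, i)\<in>(SIGMA j:{..N}. {..N - j}). b j * z ^ j * (a i * z ^ i))"
    by (rule sum.reindex_bij_witness[where i = "\<lambda>(j, i). (i + j, i)" and j = "\<lambda>(n, i). (n - i, i)"])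
       (auto simp: mult_ac simp flip: power_add)
  also have "\<dots> = (\<Sum>j\<le>N. b j * z ^ j * (\<Sum>i\<le>N - j. a i * z ^ i))"
    by (simp add: sum.Sigma sum_distrib_left)
  finally show ?thesis .
qed

lemma fps_inverse_convolution:
  fixes a :: "nat \<Rightarrow> real"
  assumes "a 0 \<noteq> 0"
  shows "(\<Sum>i\<le>n. a i * fps_nth (inverse (Abs_fps a)) (n - i)) = (if n = 0 then 1 else 0)"
proof -
  have "fps_nth (Abs_fps a * inverse (Abs_fps a)) n = fps_nth 1 n"
    using inverse_mult_eq_1[of "Abs_fps a"] assms by (simp add: mult.commute)
  then show ?thesis by (simp add: fps_mult_nth atLeast0AtMost)
qed

lemma summable_powser_if_bounded:
  fixes \<rho> :: "nat \<Rightarrow> real"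
  assumes \<rho>: "\<And>n. 0 \<le> \<rho> n" and bd: "\<And>z. 0 \<le> z \<Longrightarrow> z < 1 \<Longrightarrow> \<exists>B. \<forall>N. (\<Sum>n\<le>N. \<rho> n * z ^ n) \<le> B"
    and z: "\<bar>z\<bar> < 1"
  shows "summable (\<lambda>n. norm (\<rho> n * z ^ n))"
proof -
  obtain B where B: "\<And>N. (\<Sum>n\<le>N. \<rho> n * \<bar>z\<bar> ^ n) \<le> B" using bd[of "\<bar>z\<bar>"] z by auto
  have "summable (\<lambda>n. \<rho> n * \<bar>z\<bar> ^ n)"
    by (rule bounded_imp_summable[OF _ B]) (simp add: \<rho>)
  then show ?thesis by (simp add: abs_mult power_abs \<rho>)
qed

text \<open>The formal inverse is the analytic one as soon as both series converge absolutely at z;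
  the callers get this for the reciprocal from bounded partial sums.\<close>

lemma reciprocal_powser:
  fixes a \<rho> :: "nat \<Rightarrow> real"
  assumes conv: "\<And>n. (\<Sum>i\<le>n. a i * \<rho> (n - i)) = (if n = 0 then 1 else 0)"
    and a: "(\<lambda>n. a n * z ^ n) sums f" and sa: "summable (\<lambda>n. norm (a n * z ^ n))"
    and s\<rho>: "summable (\<lambda>n. norm (\<rho> n * z ^ n))"
  shows "(\<lambda>n. \<rho> n * z ^ n) sums (1 / f)"
proof -
  have "(\<lambda>k. \<Sum>i\<le>k. (a i * z ^ i) * (\<rho> (k - i) * z ^ (k - i))) sums ((\<Sum>k. a k * z ^ k) * (\<Sum>k. \<rho> k * z ^ k))"
    by (rule Cauchy_product_sums[OF sa s\<rho>])
  moreover have "(\<Sum>i\<le>k. (a i * z ^ i) * (\<rho> (k - i) * z ^ (k - i))) = (if k = 0 then 1 else 0)" for k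
  proof -
    have "(\<Sum>i\<le>k. (a i * z ^ i) * (\<rho> (k - i) * z ^ (k - i))) = (\<Sum>i\<le>k. a i * \<rho> (k - i)) * z ^ k"
      unfolding sum_distrib_right by (intro sum.cong refl) (simp add: mult_ac flip: power_add)
    then show ?thesis by (simp add: conv)
  qed
  moreover have "(\<lambda>k. if k = 0 then 1 else 0 :: real) sums 1" using sums_single[of 0 "\<lambda>_. 1::real"] by (simp add: eq_commute)
  ultimately have "(\<Sum>k. a k * z ^ k) * (\<Sum>k. \<rho> k * z ^ k) = 1"
    by (simp only:) (rule sums_unique2)
  then have "f * (\<Sum>k. \<rho> k * z ^ k) = 1"
    unfolding sums_unique[OF a, symmetric] .
  then have "(\<Sum>k. \<rho> k * z ^ k) = 1 / f"
    by (metis mult_zero_left nonzero_mult_div_cancel_left zero_neq_one)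
  then show ?thesis using summable_sums[OF summable_norm_cancel[OF s\<rho>]] by simp
qed

text \<open>For f(z) = g(l (1 - z)) the coefficient b n is (-l)^n g^(n)(l) / n!. The sign condition
  thus says that the derivatives of g at l alternate in sign from g' \<ge> 0 on, as for a Bernstein
  function.\<close>

definition bernstein_series :: "(nat \<Rightarrow> real) \<Rightarrow> (real \<Rightarrow> real) \<Rightarrow> bool" where
  "bernstein_series b f \<longleftrightarrow> (\<forall>n. b (Suc n) \<le> 0) \<and> (\<forall>z. \<bar>z\<bar> < 1 \<longrightarrow> (\<lambda>n. b n * z ^ n) sums f z \<and> 0 < f z)"

text \<open>In the recursion for the coefficients of the reciprocal, b 0 \<rho> n is the sum of the
  terms - b i \<rho> (n - i) for n > 0, all nonnegative by induction. For 0 \<le> z < 1 the partial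
  sums are bounded by 1/f(z), which yields convergence.\<close>

lemma bernstein_series_reciprocal:
  assumes f: "bernstein_series b f"
  obtains \<rho> where "\<And>n. 0 \<le> \<rho> n" "\<And>z. \<bar>z\<bar> < 1 \<Longrightarrow> (\<lambda>n. \<rho> n * z ^ n) sums (1 / f z)"
proof -
  have b: "b (Suc n) \<le> 0" and s: "\<bar>z\<bar> < 1 \<Longrightarrow> (\<lambda>n. b n * z ^ n) sums f z" and pos: "\<bar>z\<bar> < 1 \<Longrightarrow> 0 < f z" for n z
    using f by (auto simp: bernstein_series_def)
  have b': "b n \<le> 0" if "n \<noteq> 0" for n using b[of "n - 1"] that by simp
  have b0: "0 < b 0" using sums_unique2[OF s[of 0] powser_sums_zero] pos[of 0] by simp
  define \<rho> where "\<rho> = fps_nth (inverse (Abs_fps b))"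
  have conv: "(\<Sum>i\<le>n. b i * \<rho> (n - i)) = (if n = 0 then 1 else 0)" for n
    unfolding \<rho>_def using b0 by (intro fps_inverse_convolution) simp
  have \<rho>: "0 \<le> \<rho> n" for n
  proof (induction n rule: less_induct)
    case (less n)
    have "b 0 * \<rho> n + (\<Sum>i\<in>{..n} - {0}. b i * \<rho> (n - i)) = (if n = 0 then 1 else 0)"
      using conv[of n] by (subst (asm) sum.remove[of _ 0]) auto
    moreover have "(\<Sum>i\<in>{..n} - {0}. b i * \<rho> (n - i)) \<le> 0"
      using less b' by (intro sum_nonpos mult_nonpos_nonneg) auto
    ultimately have "0 \<le> b 0 * \<rho> n" by (auto split: if_splits)
    then show ?case using b0 by (simp add: zero_le_mult_iff)
  qed
  have sa: "summable (\<lambda>n. norm (b n * z ^ n))" if z: "\<bar>z\<bar> < 1" for z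
  proof -
    obtain x where x: "\<bar>z\<bar> < x" "x < 1" using dense[OF z] by auto
    then have "\<bar>x\<bar> < 1" by simp
    from powser_insidea[OF sums_summable[OF s[OF this]], of z] x show ?thesis by simp
  qed
  have "\<exists>B. \<forall>N. (\<Sum>n\<le>N. \<rho> n * z ^ n) \<le> B" if z: "0 \<le> z" "z < 1" for z
  proof (intro exI allI)
    fix N
    have z': "\<bar>z\<bar> < 1" using z by simp
    \<comment> \<open>Every term beyond index 0 is nonpositive, so the partial sums decrease to f
      z.\<close>
    have low: "f z \<le> (\<Sum>i\<le>m. b i * z ^ i)" for m
    proof -
      have "(\<lambda>M. \<Sum>i\<le>M. b i * z ^ i) \<longlonglongrightarrow> f z" using s[OF z'] unfolding sums_def_le .
      moreover have "(\<Sum>i\<le>M. b i * z ^ i) \<le> (\<Sum>i\<le>m. b i * z ^ i)" if "m \<le> M" for M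
      proof -
        have "(\<Sum>i\<le>M. b i * z ^ i) = (\<Sum>i\<le>m. b i * z ^ i) + (\<Sum>i\<in>{..M} - {..m}. b i * z ^ i)"
          using that by (subst sum.subset_diff[of "{..m}"]) auto
        moreover have "(\<Sum>i\<in>{..M} - {..m}. b i * z ^ i) \<le> 0"
          using z b' by (intro sum_nonpos mult_nonpos_nonneg) auto
        ultimately show ?thesis by simp
      qed
      ultimately show ?thesis by (intro LIMSEQ_le_const2) auto
    qed
    have "(\<Sum>n\<le>N. \<rho> n * z ^ n) * f z = (\<Sum>j\<le>N. \<rho> j * z ^ j * f z)" by (simp add: sum_distrib_right)
    also have "\<dots> \<le> (\<Sum>j\<le>N. \<rho> j * z ^ j * (\<Sum>i\<le>N - j. b i * z ^ i))"
      using \<rho> z low by (intro sum_mono mult_left_mono) auto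
    also have "\<dots> = (\<Sum>n\<le>N. (if n = 0 then 1 else 0) * z ^ n)"
      by (simp only: convolution_partial_sum[symmetric] conv)
    also have "\<dots> = 1" by (simp add: if_distrib[of "\<lambda>x. x * _"] cong: if_cong)
    finally show "(\<Sum>n\<le>N. \<rho> n * z ^ n) \<le> 1 / f z" using pos[OF z'] by (simp add: field_simps)
  qed
  then have s\<rho>: "summable (\<lambda>n. norm (\<rho> n * z ^ n))" if "\<bar>z\<bar> < 1" for z
    by (rule summable_powser_if_bounded[of \<rho>, OF \<rho> _ that])
  show thesis
    by (rule that[of \<rho>, OF \<rho>]) (intro reciprocal_powser[where a = b and \<rho> = \<rho>, OF conv s] sa s\<rho>)
qed

text \<open>Log-convexity means that the quotients \<open>R\<close> of consecutive terms increase.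
  This is played off against the recursion for the reciprocal: at index n+1 the n-th identity is
  subtracted with factor R n, which leaves only terms of known sign.\<close>

lemma kaluza:
  assumes a0: "0 < a 0" and a1: "0 < a 1" and lc: "\<And>n. (a (Suc n))\<^sup>2 \<le> a n * a (Suc (Suc n))"
    and s: "\<And>z. \<bar>z\<bar> < 1 \<Longrightarrow> (\<lambda>n. a n * z ^ n) sums q z" and qpos: "\<And>z. \<bar>z\<bar> < 1 \<Longrightarrow> (0::real) < q z"
  obtains b where "bernstein_series b (\<lambda>z. 1 / q z)"
proof -
  have ap: "0 < a n \<and> 0 < a (Suc n)" for n
  proof (induction n)
    case (Suc n)
    have "0 < (a (Suc n))\<^sup>2" using Suc by simp
    then have "0 < a n * a (Suc (Suc n))" using lc[of n] by linarith
    then show ?case using Suc by (simp add: zero_less_mult_iff)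
  qed (use a0 a1 in simp)
  then have apos: "0 < a n" for n by blast
  define R where "R n = a (Suc n) / a n" for n
  have Rmono: "R m \<le> R n" if "m \<le> n" for m n
  proof (rule lift_Suc_mono_le[OF _ that])
    fix n show "R n \<le> R (Suc n)"
      using lc[of n] apos[of n] apos[of "Suc n"] by (simp add: R_def field_simps power2_eq_square)
  qed
  define b where "b = fps_nth (inverse (Abs_fps a))"
  have conv: "(\<Sum>i\<le>n. a i * b (n - i)) = (if n = 0 then 1 else 0)" for n
    unfolding b_def using a0 by (intro fps_inverse_convolution) simp
  have conv': "(\<Sum>j\<le>n. a (n - j) * b j) = (if n = 0 then 1 else 0)" for n
    unfolding conv[of n, symmetric]
    by (rule sum.reindex_bij_witness[where i = "\<lambda>j. n - j" and j = "\<lambda>i. n - i"]) auto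
  have b0: "a 0 * b 0 = 1" using conv[of 0] by simp
  have b0p: "0 < b 0" using b0 a0 by (metis zero_less_mult_pos zero_less_one)
  have bneg: "b (Suc n) \<le> 0" for n
  proof (induction n rule: less_induct)
    case (less n)
    show ?case
    proof (cases n)
      case 0
      have "a 1 * b 0 + a 0 * b 1 = 0" using conv'[of 1] by simp
      moreover have "0 < b 0" by (rule b0p)
      ultimately have "a 0 * b 1 < 0" using mult_pos_pos[OF a1, of "b 0"] by linarith
      then show ?thesis using a0 0 by (simp add: mult_less_0_iff)
    next
      case (Suc m)
      have e1: "(\<Sum>j\<le>n. a (n - j) * b j) = 0" using conv'[of n] Suc by simp
      have e2: "(\<Sum>j\<le>n. a (Suc n - j) * b j) + a 0 * b (Suc n) = 0" using conv'[of "Suc n"] by simp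
      \<comment> \<open>The factor R n cancels the term j = 0, the only one with \<open>b j\<close>
        positive. For j \<ge> 1 the bracket is (R (n - j) - R n) a (n - j) \<le> 0, and b j \<le> 0
        by induction.\<close>
      have "a 0 * b (Suc n) = - (\<Sum>j\<le>n. (a (Suc n - j) - R n * a (n - j)) * b j)"
      proof -
        have "(\<Sum>j\<le>n. (a (Suc n - j) - R n * a (n - j)) * b j) = (\<Sum>j\<le>n. a (Suc n - j) * b j) - R n * (\<Sum>j\<le>n. a (n - j) * b j)"
          by (simp add: left_diff_distrib sum_subtractf sum_distrib_left mult.assoc)
        then show ?thesis using e1 e2 by simp
      qed
      also have "\<dots> \<le> 0"
      proof -
        have "0 \<le> (a (Suc n - j) - R n * a (n - j)) * b j" if j: "j \<le> n" for j
        proof (cases j)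
          case 0
          then show ?thesis using apos[of n] by (simp add: R_def)
        next
          case (Suc i)
          then have "b j \<le> 0" using less[of i] j by simp
          moreover have "a (Suc n - j) \<le> R n * a (n - j)"
            using Rmono[of "n - j" n] apos[of "n - j"] j by (simp add: R_def[of "n - j"] Suc_diff_le field_simps)
          ultimately show ?thesis by (intro mult_nonpos_nonpos) auto
        qed
        then have "0 \<le> (\<Sum>j\<le>n. (a (Suc n - j) - R n * a (n - j)) * b j)"
          by (intro sum_nonneg) (simp only: atMost_iff)
        then show ?thesis by linarith
      qed
      finally show ?thesis using a0 by (simp add: mult_le_0_iff)
    qed
  qed
  have bneg': "0 \<le> - b n" if "n \<noteq> 0" for n using bneg[of "n - 1"] that by simp
  \<comment> \<open>Dropping the positive entry at index 0 leaves a nonnegative sequence, for which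
    bounded partial sums imply convergence.\<close>
  define d where "d n = (if n = 0 then 0 else - b n)" for n
  have d0: "0 \<le> d n" for n using bneg' by (simp add: d_def)
  have sa: "summable (\<lambda>n. norm (a n * z ^ n))" if z: "\<bar>z\<bar> < 1" for z
    using sums_summable[OF s[of "\<bar>z\<bar>"]] z apos by (simp add: abs_mult power_abs less_imp_le)
  have "\<exists>B. \<forall>N. (\<Sum>n\<le>N. d n * z ^ n) \<le> B" if z: "0 \<le> z" "z < 1" for z
  proof (intro exI allI)
    fix N
    have z': "\<bar>z\<bar> < 1" using z by simp
    define P where "P m = (\<Sum>i\<le>m. a i * z ^ i)" for m
    have P0: "a 0 \<le> P m" for m
      unfolding P_def using member_le_sum[of 0 "{..m}" "\<lambda>i. a i * z ^ i"] apos z by (simp add: less_imp_le)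
    have Pq: "P m \<le> q z" for m
      unfolding P_def sums_unique[OF s[OF z']]
      using apos z by (intro sum_le_suminf sums_summable[OF s[OF z']]) (auto simp: less_imp_le)
    \<comment> \<open>The truncations \<open>P\<close> lie between a 0 and q z. The upper bound is
      used for the term j = 0, the lower one for all others, which bounds the partial sums of
      \<open>d\<close>.\<close>
    have "1 = (\<Sum>j\<le>N. b j * z ^ j * P (N - j))"
      unfolding P_def convolution_partial_sum[symmetric] conv
      by (simp add: if_distrib[of "\<lambda>x. x * _"] cong: if_cong)
    also have "\<dots> = b 0 * P N - (\<Sum>j\<in>{..N} - {0}. d j * z ^ j * P (N - j))"
      by (subst sum.remove[of _ 0]) (auto simp: d_def sum_negf)
    finally have "(\<Sum>j\<in>{..N} - {0}. d j * z ^ j * P (N - j)) \<le> b 0 * P N" by simp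
    moreover have "(\<Sum>j\<in>{..N} - {0}. d j * z ^ j * a 0) \<le> (\<Sum>j\<in>{..N} - {0}. d j * z ^ j * P (N - j))"
      using d0 z P0 by (intro sum_mono mult_left_mono) auto
    moreover have "(\<Sum>j\<le>N. d j * z ^ j) = (\<Sum>j\<in>{..N} - {0}. d j * z ^ j)"
      by (subst sum.remove[of _ 0]) (auto simp: d_def)
    moreover have "b 0 * P N \<le> b 0 * q z" using Pq b0p by (intro mult_left_mono) auto
    ultimately have "(\<Sum>j\<le>N. d j * z ^ j) * a 0 \<le> b 0 * q z" by (simp add: sum_distrib_right)
    then show "(\<Sum>n\<le>N. d n * z ^ n) \<le> b 0 * q z / a 0" using a0 by (simp add: field_simps)
  qed
  then have sd: "summable (\<lambda>n. norm (d n * z ^ n))" if "\<bar>z\<bar> < 1" for z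
    by (rule summable_powser_if_bounded[of d, OF d0 _ that])
  have sb: "summable (\<lambda>n. norm (b n * z ^ n))" if "\<bar>z\<bar> < 1" for z
  proof -
    have "\<forall>\<^sub>F n in sequentially. norm (b n * z ^ n) = norm (d n * z ^ n)"
      using eventually_gt_at_top[of 0] by eventually_elim (simp add: d_def)
    then show ?thesis using sd[OF that] summable_cong by fast
  qed
  have "bernstein_series b (\<lambda>z. 1 / q z)"
    unfolding bernstein_series_def
  proof (intro conjI allI impI bneg)
    fix z :: real assume z: "\<bar>z\<bar> < 1"
    show "(\<lambda>n. b n * z ^ n) sums (1 / q z)"
      by (rule reciprocal_powser[where a = a and \<rho> = b, OF conv s[OF z] sa[OF z] sb[OF z]])
    show "0 < 1 / q z" using qpos[OF z] by simp
  qed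
  then show thesis by (rule that)
qed

section \<open>Laplace transforms as power series\<close>

lemma laplace_powser:
  fixes f :: "real \<Rightarrow> real"
  assumes [measurable]: "f \<in> borel_measurable borel" and f0: "\<And>t. t < 0 \<Longrightarrow> f t = 0"
    and int: "\<And>s. s0 < s \<Longrightarrow> integrable lborel (\<lambda>t. exp (- s * t) * f t)"
    and l: "0 \<le> l" "s0 < l" and z: "s0 < l * (1 - \<bar>z\<bar>)"
  shows "(\<lambda>n. l ^ n / fact n * (\<integral>t. exp (- l * t) * t ^ n * f t \<partial>lborel) * z ^ n) sums
    (\<integral>t. exp (- (l * (1 - z)) * t) * f t \<partial>lborel)"
proof -
  \<comment> \<open>The terms of exp(z l t), multiplied by the damped f, sum to exp(-l (1 - z) t)
    f(t). Their absolute values sum to exp(-l (1 - |z|) t) |f(t)|, integrable because l (1 - |z|) >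
    s0.\<close>
  define u where "u n t = (z * (l * t)) ^ n / fact n * (exp (- l * t) * f t)" for n t
  have usum: "(\<lambda>n. u n t) sums (exp (- (l * (1 - z)) * t) * f t)" for t
  proof -
    have "(\<lambda>n. u n t) sums (exp (z * (l * t)) * (exp (- l * t) * f t))"
      unfolding u_def by (intro sums_mult2 poisson_sums(1))
    also have "exp (z * (l * t)) * (exp (- l * t) * f t) = exp (- (l * (1 - z)) * t) * f t"
      by (simp add: algebra_simps flip: exp_add)
    finally show ?thesis .
  qed
  have nsum: "(\<lambda>n. norm (u n t)) sums (exp (- (l * (1 - \<bar>z\<bar>)) * t) * \<bar>f t\<bar>)" for t
  proof (cases "t < 0")
    case False
    have "(\<lambda>n. (\<bar>z\<bar> * (l * t)) ^ n / fact n * (exp (- l * t) * \<bar>f t\<bar>)) sums (exp (\<bar>z\<bar> * (l * t)) * (exp (- l * t) * \<bar>f t\<bar>))"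
      by (intro sums_mult2 poisson_sums(1))
    also have "exp (\<bar>z\<bar> * (l * t)) * (exp (- l * t) * \<bar>f t\<bar>) = exp (- (l * (1 - \<bar>z\<bar>)) * t) * \<bar>f t\<bar>"
      by (simp add: algebra_simps flip: exp_add)
    also have "(\<lambda>n. (\<bar>z\<bar> * (l * t)) ^ n / fact n * (exp (- l * t) * \<bar>f t\<bar>)) = (\<lambda>n. norm (u n t))"
      using False l by (simp add: u_def abs_mult power_abs fun_eq_iff)
    finally show ?thesis .
  qed (simp add: u_def f0)
  have uint: "integrable lborel (u n)" for n
  proof -
    obtain s where s: "s0 < s" "s < l" using dense[OF l(2)] by auto
    have u: "u n = (\<lambda>t. z ^ n * l ^ n / fact n * (exp (- l * t) * t ^ n * f t))"
      by (simp add: fun_eq_iff u_def power_mult_distrib)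
    show ?thesis
      unfolding u using integrable_power_exp[OF _ f0 int[OF s(1)] s(2), of n] by (intro integrable_mult_right) auto
  qed
  have intz: "integrable lborel (\<lambda>t. exp (- (l * (1 - \<bar>z\<bar>)) * t) * \<bar>f t\<bar>)"
    using integrable_abs[OF int[OF z]] by (simp add: abs_mult)
  have "(\<lambda>n. integral\<^sup>L lborel (u n)) sums (\<integral>t. (\<Sum>n. u n t) \<partial>lborel)"
  proof (rule sums_integral[OF uint])
    show "AE t in lborel. summable (\<lambda>n. norm (u n t))" using nsum by (auto intro: sums_summable)
    show "summable (\<lambda>n. \<integral>t. norm (u n t) \<partial>lborel)"
    proof (rule bounded_imp_summable)
      fix N
      have "(\<Sum>n\<le>N. \<integral>t. norm (u n t) \<partial>lborel) = (\<integral>t. (\<Sum>n\<le>N. norm (u n t)) \<partial>lborel)"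
        by (intro Bochner_Integration.integral_sum[symmetric] integrable_norm uint)
      also have "\<dots> \<le> (\<integral>t. exp (- (l * (1 - \<bar>z\<bar>)) * t) * \<bar>f t\<bar> \<partial>lborel)"
      proof (intro integral_mono Bochner_Integration.integrable_sum integrable_norm uint intz)
        fix t
        show "(\<Sum>n\<le>N. norm (u n t)) \<le> exp (- (l * (1 - \<bar>z\<bar>)) * t) * \<bar>f t\<bar>"
          unfolding sums_unique[OF nsum] by (intro sum_le_suminf sums_summable[OF nsum]) auto
      qed
      finally show "(\<Sum>n\<le>N. \<integral>t. norm (u n t) \<partial>lborel) \<le> (\<integral>t. exp (- (l * (1 - \<bar>z\<bar>)) * t) * \<bar>f t\<bar> \<partial>lborel)" .
    qed simp
  qed
  moreover have "integral\<^sup>L lborel (u n) = l ^ n / fact n * (\<integral>t. exp (- l * t) * t ^ n * f t \<partial>lborel) * z ^ n" for n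
  proof -
    have "integral\<^sup>L lborel (u n) = (\<integral>t. z ^ n * l ^ n / fact n * (exp (- l * t) * t ^ n * f t) \<partial>lborel)"
      by (intro Bochner_Integration.integral_cong) (simp_all add: u_def power_mult_distrib)
    then show ?thesis by simp
  qed
  ultimately show ?thesis by (simp add: sums_unique[OF usum, symmetric])
qed

lemma laplace_moments_eq:
  fixes f :: "real \<Rightarrow> real"
  assumes "f \<in> borel_measurable borel" "\<And>t. t < 0 \<Longrightarrow> f t = 0"
    and int: "\<And>s. s0 < s \<Longrightarrow> integrable lborel (\<lambda>t. exp (- s * t) * f t)"
    and F: "\<And>s. s0 < s \<Longrightarrow> (\<integral>t. exp (- s * t) * f t \<partial>lborel) = F s"
    and l: "0 \<le> s0" "s0 < l" and \<epsilon>: "0 < \<epsilon>" "\<And>z. \<bar>z\<bar> < \<epsilon> \<Longrightarrow> (\<lambda>n. \<rho> n * z ^ n) sums F (l * (1 - z))"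
  shows "l ^ n / fact n * (\<integral>t. exp (- l * t) * t ^ n * f t \<partial>lborel) = \<rho> n"
proof -
  \<comment> \<open>Within this radius l (1 - |z|) stays above s0, where the transform is known to
    be F; a neighbourhood of 0 suffices to identify the coefficients.\<close>
  define \<delta> where "\<delta> = min \<epsilon> ((l - s0) / l)"
  have \<delta>: "0 < \<delta>" using l \<epsilon> by (simp add: \<delta>_def)
  have "(\<lambda>n. l ^ n / fact n * (\<integral>t. exp (- l * t) * t ^ n * f t \<partial>lborel)) = \<rho>"
  proof (rule power_series_unique[OF \<delta>])
    fix z :: real assume z: "\<bar>z\<bar> < \<delta>"
    then have z': "s0 < l * (1 - \<bar>z\<bar>)" using l by (simp add: \<delta>_def field_simps)
    also have "\<dots> \<le> l * (1 - z)" using l by (intro mult_left_mono) auto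
    finally have "(\<integral>t. exp (- (l * (1 - z)) * t) * f t \<partial>lborel) = F (l * (1 - z))" by (rule F)
    then show "(\<lambda>n. l ^ n / fact n * (\<integral>t. exp (- l * t) * t ^ n * f t \<partial>lborel) * z ^ n) sums F (l * (1 - z))"
      using laplace_powser[OF assms(1,2) int, of s0 l z] l z' by simp
    show "(\<lambda>n. \<rho> n * z ^ n) sums F (l * (1 - z))" using z by (intro \<epsilon>(2)) (simp add: \<delta>_def)
  qed
  then show ?thesis by (simp add: fun_eq_iff)
qed

text \<open>The direction of Bernstein's theorem that is needed: a completely monotone transform
  comes from a nonnegative function. The threshold \<open>s0\<close> is there because the transform
  of the resolvent is at first known only far to the right.\<close>

lemma AE_nonneg_if_laplace_powser:
  fixes f :: "real \<Rightarrow> real"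
  assumes meas: "f \<in> borel_measurable borel" and f0: "\<And>t. t < 0 \<Longrightarrow> f t = 0"
    and int: "\<And>s. s0 < s \<Longrightarrow> integrable lborel (\<lambda>t. exp (- s * t) * f t)"
    and F: "\<And>s. s0 < s \<Longrightarrow> (\<integral>t. exp (- s * t) * f t \<partial>lborel) = F s"
    and s0: "0 \<le> s0"
    and cm: "\<And>l. s0 < l \<Longrightarrow> \<exists>\<rho>. (\<forall>n. 0 \<le> \<rho> n) \<and> (\<forall>z. \<bar>z\<bar> < 1 \<longrightarrow> (\<lambda>n. \<rho> n * z ^ n) sums F (l * (1 - z)))"
  shows "AE t in lborel. 0 \<le> f t"
proof (rule AE_nonneg_if_moments_nonneg[OF meas f0 int])
  fix l n assume l: "s0 < l"
  obtain \<rho> where \<rho>: "\<And>n. 0 \<le> \<rho> n" "\<And>z. \<bar>z\<bar> < 1 \<Longrightarrow> (\<lambda>n. \<rho> n * z ^ n) sums F (l * (1 - z))"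
    using cm[OF l] by blast
  have "l ^ n / fact n * (\<integral>t. exp (- l * t) * t ^ n * f t \<partial>lborel) = \<rho> n"
    by (rule laplace_moments_eq[OF meas f0 int F s0 l zero_less_one \<rho>(2)])
  then have "l ^ n / fact n * 0 \<le> l ^ n / fact n * (\<integral>t. exp (- l * t) * t ^ n * f t \<partial>lborel)" using \<rho>(1) by simp
  then show "0 \<le> (\<integral>t. exp (- l * t) * t ^ n * f t \<partial>lborel)"
    by (rule mult_left_le_imp_le) (use l s0 in auto)
qed

text \<open>The alternating series of convolution powers solves \<rho> + \<mu> \<kappa>*\<rho> =
  \<kappa> when \<mu> \<kappa> has mass below 1. It gives existence and the transform, but no
  sign.\<close>

lemma neumann_series:
  fixes \<kappa> :: "real \<Rightarrow> real"
  assumes \<kappa>: "integrable lborel \<kappa>" and \<kappa>0: "\<And>t. 0 \<le> \<kappa> t" and neg: "\<And>t. t < 0 \<Longrightarrow> \<kappa> t = 0"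
    and \<mu>: "0 \<le> \<mu>" and lt: "\<mu> * integral\<^sup>L lborel \<kappa> < 1"
  obtains \<rho> where "integrable lborel \<rho>" "\<And>t. t < 0 \<Longrightarrow> \<rho> t = 0"
    "\<And>s. 0 \<le> s \<Longrightarrow> (\<integral>t. exp (- s * t) * \<rho> t \<partial>lborel) =
        (\<integral>t. exp (- s * t) * \<kappa> t \<partial>lborel) / (1 + \<mu> * (\<integral>t. exp (- s * t) * \<kappa> t \<partial>lborel))"
proof -
  have [measurable]: "\<kappa> \<in> borel_measurable borel" using \<kappa> by auto
  define K where "K s = (\<integral>t. exp (- s * t) * \<kappa> t \<partial>lborel)" for s
  have e\<kappa>: "integrable lborel (\<lambda>t. exp (- s * t) * \<kappa> t)" if "0 \<le> s" for s
  proof (rule Bochner_Integration.integrable_bound[OF \<kappa>])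
    show "AE t in lborel. norm (exp (- s * t) * \<kappa> t) \<le> norm (\<kappa> t)"
    proof (rule AE_I2)
      fix t show "norm (exp (- s * t) * \<kappa> t) \<le> norm (\<kappa> t)"
        using that neg[of t] by (cases "t < 0") (auto simp: abs_mult intro!: mult_left_le_one_le)
    qed
  qed measurable
  have K0: "0 \<le> K s" for s unfolding K_def using \<kappa>0 by (intro Bochner_Integration.integral_nonneg) auto
  have Kle: "K s \<le> integral\<^sup>L lborel \<kappa>" if "0 \<le> s" for s
    unfolding K_def
  proof (rule integral_mono[OF e\<kappa>[OF that] \<kappa>])
    fix t show "exp (- s * t) * \<kappa> t \<le> \<kappa> t"
      using that neg[of t] \<kappa>0[of t] by (cases "t < 0") (auto intro!: mult_left_le_one_le)
  qed
  have \<mu>K: "\<mu> * K s < 1" if "0 \<le> s" for s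
    using mult_left_mono[OF Kle[OF that] \<mu>] lt by linarith
  \<comment> \<open>This is the convolution power with n + 1 factors, hence the exponent
    \<open>Suc n\<close> in its transform.\<close>
  define \<kappa>n where "\<kappa>n n = ((convolution \<kappa>) ^^ n) \<kappa>" for n
  have \<kappa>n_simps: "\<kappa>n 0 = \<kappa>" "\<kappa>n (Suc n) = convolution \<kappa> (\<kappa>n n)" for n by (simp_all add: \<kappa>n_def)
  have meas [measurable]: "\<kappa>n n \<in> borel_measurable borel" for n
    by (induction n) (auto simp: \<kappa>n_simps)
  have nonneg: "0 \<le> \<kappa>n n t" for n t
  proof (induction n arbitrary: t)
    case (Suc n)
    then show ?case unfolding \<kappa>n_simps convolution_def using \<kappa>0 by (intro Bochner_Integration.integral_nonneg) auto
  qed (simp add: \<kappa>n_simps \<kappa>0)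
  have \<kappa>neg: "\<kappa>n n t = 0" if "t < 0" for n t
    using that
  proof (induction n arbitrary: t)
    case (Suc n)
    have "\<kappa> (t - \<tau>) * \<kappa>n n \<tau> = 0" for \<tau>
      using Suc.IH[of \<tau>] neg[of "t - \<tau>"] Suc.prems by (cases "\<tau> < 0") auto
    then show ?case unfolding \<kappa>n_simps convolution_def by (simp only: integral_zero)
  qed (simp add: \<kappa>n_simps neg)
  have lap: "integrable lborel (\<lambda>t. exp (- s * t) * \<kappa>n n t) \<and> (\<integral>t. exp (- s * t) * \<kappa>n n t \<partial>lborel) = K s ^ Suc n" if "0 \<le> s" for n s
  proof (induction n)
    case (Suc n)
    then show ?case
      using convolution_L1[OF e\<kappa>[OF that], of "\<lambda>t. exp (- s * t) * \<kappa>n n t"] unfolding \<kappa>n_simps convolution_exp[abs_def] by (simp add: K_def)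
  qed (use e\<kappa>[OF that] in \<open>simp add: \<kappa>n_simps K_def\<close>)
  \<comment> \<open>The sum of the nonnegative terms has a finite integral, bounded by a geometric
    series of ratio \<mu> K(0) < 1, so it is finite almost everywhere.\<close>
  have AEs: "AE t in lborel. summable (\<lambda>n. \<mu> ^ n * \<kappa>n n t)"
  proof -
    have "(\<integral>\<^sup>+t. (\<Sum>n. ennreal (\<mu> ^ n * \<kappa>n n t)) \<partial>lborel) = (\<Sum>n. \<integral>\<^sup>+t. ennreal (\<mu> ^ n * \<kappa>n n t) \<partial>lborel)"
      by (rule nn_integral_suminf) measurable
    also have "\<dots> = (\<Sum>n. ennreal ((\<mu> * K 0) ^ n * K 0))"
    proof (intro arg_cong[of _ _ suminf] ext)
      fix n
      have "(\<integral>\<^sup>+t. ennreal (\<mu> ^ n * \<kappa>n n t) \<partial>lborel) = ennreal (\<integral>t. \<mu> ^ n * \<kappa>n n t \<partial>lborel)"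
        using lap[of 0 n] \<mu> nonneg by (intro nn_integral_eq_integral) auto
      also have "(\<integral>t. \<mu> ^ n * \<kappa>n n t \<partial>lborel) = (\<mu> * K 0) ^ n * K 0"
        using lap[of 0 n] by (simp add: power_mult_distrib)
      finally show "(\<integral>\<^sup>+t. ennreal (\<mu> ^ n * \<kappa>n n t) \<partial>lborel) = ennreal ((\<mu> * K 0) ^ n * K 0)" .
    qed
    also have "\<dots> \<noteq> \<infinity>"
    proof -
      have "summable (\<lambda>n. (\<mu> * K 0) ^ n * K 0)"
        using \<mu>K[of 0] \<mu> K0[of 0] by (intro summable_mult2 summable_geometric) auto
      then show ?thesis using \<mu> K0[of 0] by (subst suminf_ennreal2) auto
    qed
    finally have "AE t in lborel. (\<Sum>n. ennreal (\<mu> ^ n * \<kappa>n n t)) \<noteq> \<infinity>"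
      by (intro nn_integral_noteq_infinite) auto
    then show ?thesis
      by eventually_elim (rule summable_suminf_not_top, use nonneg \<mu> in auto)
  qed
  define \<rho> where "\<rho> t = (\<Sum>n. (- \<mu>) ^ n * \<kappa>n n t)" for t
  have main: "integrable lborel (\<lambda>t. exp (- s * t) * \<rho> t) \<and> (\<integral>t. exp (- s * t) * \<rho> t \<partial>lborel) = K s / (1 + \<mu> * K s)" if s: "0 \<le> s" for s
  proof -
    define u where "u n t = (- \<mu>) ^ n * (exp (- s * t) * \<kappa>n n t)" for n t
    have uint: "integrable lborel (u n)" for n unfolding u_def using lap[OF s, of n] by simp
    have unorm: "norm (u n t) = exp (- s * t) * (\<mu> ^ n * \<kappa>n n t)" for n t
      using nonneg[of n t] \<mu> by (simp add: u_def abs_mult power_abs)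
    have s1: "AE t in lborel. summable (\<lambda>n. norm (u n t))"
      using AEs by eventually_elim (simp only: unorm summable_mult)
    have s2: "summable (\<lambda>n. \<integral>t. norm (u n t) \<partial>lborel)"
    proof -
      have "(\<integral>t. norm (u n t) \<partial>lborel) = (\<mu> * K s) ^ n * K s" for n
      proof -
        have "(\<integral>t. norm (u n t) \<partial>lborel) = (\<integral>t. \<mu> ^ n * (exp (- s * t) * \<kappa>n n t) \<partial>lborel)"
          by (intro Bochner_Integration.integral_cong refl) (simp only: unorm mult.left_commute)
        then show ?thesis using lap[OF s, of n] by (simp add: power_mult_distrib)
      qed
      then show ?thesis using \<mu>K[OF s] \<mu> K0[of s] by (simp, intro summable_mult2 summable_geometric) auto
    qed
    have eq: "AE t in lborel. (\<Sum>n. u n t) = exp (- s * t) * \<rho> t"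
      using AEs
    proof eventually_elim
      case (elim t)
      have "summable (\<lambda>n. (- \<mu>) ^ n * \<kappa>n n t)"
        by (rule summable_rabs_cancel) (use elim nonneg \<mu> in \<open>simp add: abs_mult power_abs\<close>)
      then have "exp (- s * t) * \<rho> t = (\<Sum>n. exp (- s * t) * ((- \<mu>) ^ n * \<kappa>n n t))"
        unfolding \<rho>_def by (rule suminf_mult[symmetric])
      then show ?case by (simp add: u_def mult.left_commute)
    qed
    have [measurable]: "\<rho> \<in> borel_measurable borel" unfolding \<rho>_def by measurable
    have [measurable]: "u n \<in> borel_measurable borel" for n unfolding u_def by measurable
    have "integrable lborel (\<lambda>t. \<Sum>n. u n t)" by (rule integrable_suminf[OF uint s1 s2])
    then have i: "integrable lborel (\<lambda>t. exp (- s * t) * \<rho> t)"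
      by (rule integrable_cong_AE_imp[OF _ _ eq]) measurable
    have "(\<lambda>n. integral\<^sup>L lborel (u n)) sums (\<integral>t. (\<Sum>n. u n t) \<partial>lborel)" by (rule sums_integral[OF uint s1 s2])
    also have "(\<integral>t. (\<Sum>n. u n t) \<partial>lborel) = (\<integral>t. exp (- s * t) * \<rho> t \<partial>lborel)"
      by (rule integral_cong_AE) (use eq in auto)
    finally have a: "(\<lambda>n. integral\<^sup>L lborel (u n)) sums (\<integral>t. exp (- s * t) * \<rho> t \<partial>lborel)" .
    have "integral\<^sup>L lborel (u n) = (- (\<mu> * K s)) ^ n * K s" for n
      using lap[OF s, of n] unfolding u_def by (simp flip: power_mult_distrib)
    moreover have "(\<lambda>n. (- (\<mu> * K s)) ^ n * K s) sums (1 / (1 - (- (\<mu> * K s))) * K s)"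
      using \<mu>K[OF s] \<mu> K0[of s] by (intro sums_mult2 geometric_sums) auto
    ultimately have "(\<integral>t. exp (- s * t) * \<rho> t \<partial>lborel) = 1 / (1 - (- (\<mu> * K s))) * K s"
      using a sums_unique2 by simp
    then show ?thesis using i by simp
  qed
  show thesis
  proof (rule that[of \<rho>])
    show "integrable lborel \<rho>" using main[of 0] by simp
    show "\<rho> t = 0" if "t < 0" for t by (simp add: \<rho>_def \<kappa>neg[OF that])
  qed (use main in \<open>auto simp: K_def\<close>)
qed

text \<open>Stated through the Taylor series about every l > 0, valid for |z| < 1, that is on the
  whole interval 0 < s < 2 l. Thus no derivatives occur.\<close>

definition bernstein_function :: "(real \<Rightarrow> real) \<Rightarrow> bool" where
  "bernstein_function g \<longleftrightarrow> (\<forall>l>0. \<exists>b. bernstein_series b (\<lambda>z. g (l * (1 - z))))"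

lemma bernstein_function_pos: "bernstein_function g \<Longrightarrow> 0 < s \<Longrightarrow> 0 < g s"
  unfolding bernstein_function_def bernstein_series_def
  by (drule spec[of _ s]) (auto dest!: spec[of _ "0::real"])

lemma bernstein_function_cong:
  assumes "bernstein_function f" and eq: "\<And>s. 0 < s \<Longrightarrow> f s = g s"
  shows "bernstein_function g"
proof -
  have "f (l * (1 - z)) = g (l * (1 - z))" if "0 < l" "\<bar>z\<bar> < 1" for l z
    using that by (intro eq mult_pos_pos) auto
  then show ?thesis
    using assms(1) by (auto simp: bernstein_function_def bernstein_series_def)
qed

lemma bernstein_function_add_const:
  assumes g: "bernstein_function g" and \<mu>: "0 \<le> \<mu>"
  shows "bernstein_function (\<lambda>s. g s + \<mu>)"
  unfolding bernstein_function_def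
proof (intro allI impI)
  fix l :: real assume "0 < l"
  then obtain b where b: "bernstein_series b (\<lambda>z. g (l * (1 - z)))"
    using g by (auto simp: bernstein_function_def)
  have "(\<lambda>n. (if n = 0 then b 0 + \<mu> else b n) * z ^ n) sums (g (l * (1 - z)) + \<mu>)" if "\<bar>z\<bar> < 1" for z
  proof -
    have "(\<lambda>n. b n * z ^ n) sums g (l * (1 - z))" using b that by (simp add: bernstein_series_def)
    from sums_add[OF this sums_single[of 0 "\<lambda>_. \<mu>"]]
    have "(\<lambda>n. b n * z ^ n + (if n = 0 then \<mu> else 0)) sums (g (l * (1 - z)) + \<mu>)" .
    also have "(\<lambda>n. b n * z ^ n + (if n = 0 then \<mu> else 0)) = (\<lambda>n. (if n = 0 then b 0 + \<mu> else b n) * z ^ n)"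
      by (auto simp: fun_eq_iff)
    finally show ?thesis .
  qed
  then have "bernstein_series (\<lambda>n. if n = 0 then b 0 + \<mu> else b n) (\<lambda>z. g (l * (1 - z)) + \<mu>)"
    using b \<mu> by (auto simp: bernstein_series_def add_pos_nonneg)
  then show "\<exists>b. bernstein_series b (\<lambda>z. g (l * (1 - z)) + \<mu>)" by blast
qed

lemma bernstein_function_reciprocal:
  assumes g: "bernstein_function g" and l: "0 < l"
  obtains \<rho> where "\<And>n. 0 \<le> \<rho> n" "\<And>z. \<bar>z\<bar> < 1 \<Longrightarrow> (\<lambda>n. \<rho> n * z ^ n) sums (1 / g (l * (1 - z)))"
proof -
  obtain b where "bernstein_series b (\<lambda>z. g (l * (1 - z)))"
    using g l by (auto simp: bernstein_function_def)
  from bernstein_series_reciprocal[OF this] that show thesis by blast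
qed

section \<open>Existence of nonnegative resolvent kernels\<close>

lemma laplace_kernel_small:
  assumes k: "laplace_kernel k" and \<epsilon>: "0 < \<epsilon>"
  obtains L where "0 < L" "(\<integral>t. exp (- L * t) * k t \<partial>lborel) < \<epsilon>"
proof -
  note [measurable] = laplace_kernelD(1)[OF k]
  have "(\<lambda>n. \<integral>t. exp (- real (Suc n) * t) * k t \<partial>lborel) \<longlonglongrightarrow> (\<integral>t. 0 \<partial>(lborel::real measure))"
  proof (rule integral_dominated_convergence)
    show "integrable lborel (\<lambda>t. exp (- 1 * t) * k t)" by (rule laplace_kernelD(4)[OF k]) simp
    show "AE t in lborel. (\<lambda>n. exp (- real (Suc n) * t) * k t) \<longlonglongrightarrow> 0"
      using AE_lborel_singleton[of 0]
    proof eventually_elim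
      case (elim t)
      show ?case
      proof (cases "t < 0")
        case False
        have "exp (- real (Suc n) * t) = exp (- t) ^ Suc n" for n
          using exp_of_nat_mult[of "Suc n" "- t"] by (simp only: mult_minus_left mult_minus_right)
        moreover have "(\<lambda>n. exp (- t) ^ Suc n) \<longlonglongrightarrow> 0"
          using LIMSEQ_power_zero[of "exp (- t)"] False elim by (intro LIMSEQ_Suc) auto
        ultimately show ?thesis by (intro tendsto_mult_left_zero) simp
      qed (simp add: laplace_kernelD(3)[OF k])
    qed
    show "AE t in lborel. norm (exp (- real (Suc n) * t) * k t) \<le> exp (- 1 * t) * k t" for n
    proof (rule AE_I2)
      fix t show "norm (exp (- real (Suc n) * t) * k t) \<le> exp (- 1 * t) * k t"
        using laplace_kernelD(2)[OF k, of t] laplace_kernelD(3)[OF k, of t]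
        by (cases "t < 0") (auto simp: abs_mult algebra_simps intro!: mult_left_mono)
    qed
  qed measurable
  then have "\<forall>\<^sub>F n in sequentially. (\<integral>t. exp (- real (Suc n) * t) * k t \<partial>lborel) < \<epsilon>"
    using \<epsilon> by (intro order_tendstoD(2)) auto
  then obtain n where "(\<integral>t. exp (- real (Suc n) * t) * k t \<partial>lborel) < \<epsilon>"
    by (auto simp: eventually_sequentially)
  then show thesis by (rule that[rotated]) simp
qed

text \<open>Uniqueness of the Laplace transform: the sign criterion is applied to f and to -f, with
  all coefficients zero.\<close>

lemma AE_zero_if_laplace_zero:
  fixes f :: "real \<Rightarrow> real"
  assumes meas: "f \<in> borel_measurable borel" and f0: "\<And>t. t < 0 \<Longrightarrow> f t = 0"
    and int: "\<And>s. 0 < s \<Longrightarrow> integrable lborel (\<lambda>t. exp (- s * t) * f t)"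
    and F: "\<And>s. 0 < s \<Longrightarrow> (\<integral>t. exp (- s * t) * f t \<partial>lborel) = 0"
  shows "AE t in lborel. f t = 0"
proof -
  have "AE t in lborel. 0 \<le> f t"
    by (rule AE_nonneg_if_laplace_powser[of f 0 "\<lambda>_. 0"])
       (use F f0 int meas in \<open>auto intro!: exI[of _ "\<lambda>_. 0"]\<close>)
  moreover have "AE t in lborel. 0 \<le> - f t"
    by (rule AE_nonneg_if_laplace_powser[of "\<lambda>t. - f t" 0 "\<lambda>_. 0"])
       (use F f0 int meas in \<open>auto intro!: exI[of _ "\<lambda>_. 0"]\<close>)
  ultimately show ?thesis by eventually_elim simp
qed

text \<open>A Neumann series produces r with transform 1/(g + \<mu>), but only for large s. Since g
  + \<mu> is again Bernstein, r is nonnegative, and nonnegativity in turn extends the transform to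
  all s > 0. The resolvent identity then follows from uniqueness of transforms.\<close>

lemma resolvent_kernel_exists:
  assumes k: "laplace_kernel k" and g: "bernstein_function g"
    and lap: "\<And>s. 0 < s \<Longrightarrow> (\<integral>t. exp (- s * t) * k t \<partial>lborel) = 1 / g s" and \<mu>: "0 < \<mu>"
  shows "\<exists>r. resolvent_kernel \<mu> k r"
proof -
  note [measurable] = laplace_kernelD(1)[OF k]
  have gpos: "0 < g s" if "0 < s" for s by (rule bernstein_function_pos[OF g that])
  \<comment> \<open>Damping by exp(-L t) makes the mass of \<mu> k less than 1, so that the Neumann
    series converges.\<close>
  obtain L where L: "0 < L" "(\<integral>t. exp (- L * t) * k t \<partial>lborel) < 1 / \<mu>"
    using laplace_kernel_small[OF k, of "1 / \<mu>"] \<mu> by auto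
  define \<kappa> where "\<kappa> t = exp (- L * t) * k t" for t
  have e: "exp (- s * t) * \<kappa> t = exp (- (s + L) * t) * k t" for s t
    by (simp add: \<kappa>_def algebra_simps flip: exp_add)
  obtain \<rho> where \<rho>: "integrable lborel \<rho>" "\<And>t. t < 0 \<Longrightarrow> \<rho> t = 0"
    "\<And>s. 0 \<le> s \<Longrightarrow> (\<integral>t. exp (- s * t) * \<rho> t \<partial>lborel) =
        (\<integral>t. exp (- s * t) * \<kappa> t \<partial>lborel) / (1 + \<mu> * (\<integral>t. exp (- s * t) * \<kappa> t \<partial>lborel))"
  proof (rule neumann_series[of \<kappa> \<mu>])
    show "integrable lborel \<kappa>" unfolding \<kappa>_def by (rule laplace_kernelD(4)[OF k L(1)])
    show "\<mu> * integral\<^sup>L lborel \<kappa> < 1" using L(2) \<mu> by (simp add: \<kappa>_def[abs_def] field_simps)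
  qed (use laplace_kernelD(2,3)[OF k] \<mu> in \<open>auto simp: \<kappa>_def\<close>)
  have [measurable]: "\<rho> \<in> borel_measurable borel" using \<rho>(1) by auto
  \<comment> \<open>Undoing the damping shifts the transform back, so it is known only for s >
    L.\<close>
  define r0 where "r0 t = exp (L * t) * \<rho> t" for t
  have [measurable]: "r0 \<in> borel_measurable borel" unfolding r0_def by measurable
  have r00: "r0 t = 0" if "t < 0" for t using \<rho>(2)[OF that] by (simp add: r0_def)
  have er0: "exp (- s * t) * r0 t = exp (- (s - L) * t) * \<rho> t" for s t
    by (simp add: r0_def algebra_simps flip: exp_add)
  have r0int: "integrable lborel (\<lambda>t. exp (- s * t) * r0 t)" if "L < s" for s
    unfolding er0
  proof (rule Bochner_Integration.integrable_bound[OF \<rho>(1)])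
    show "AE t in lborel. norm (exp (- (s - L) * t) * \<rho> t) \<le> norm (\<rho> t)"
    proof (rule AE_I2)
      fix t show "norm (exp (- (s - L) * t) * \<rho> t) \<le> norm (\<rho> t)"
      proof (cases "t < 0")
        case False
        then have "exp (- (s - L) * t) \<le> 1" using that by (simp add: mult_nonpos_nonneg)
        then show ?thesis by (simp add: abs_mult mult_left_le_one_le)
      qed (simp add: \<rho>(2))
    qed
  qed measurable
  have r0lap: "(\<integral>t. exp (- s * t) * r0 t \<partial>lborel) = 1 / (g s + \<mu>)" if "L < s" for s
  proof -
    have \<kappa>lap: "(\<integral>t. exp (- (s - L) * t) * \<kappa> t \<partial>lborel) = 1 / g s"
      unfolding e using lap[of s] that L(1) by simp
    have "0 \<le> s - L" using that by simp
    then have "(\<integral>t. exp (- s * t) * r0 t \<partial>lborel) = (1 / g s) / (1 + \<mu> * (1 / g s))"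
      unfolding er0 by (subst \<rho>(3)) (simp_all only: \<kappa>lap)
    then show ?thesis using gpos[of s] that L(1) \<mu> by (simp add: field_simps)
  qed
  note g\<mu> = bernstein_function_add_const[OF g less_imp_le[OF \<mu>]]
  have r0nn: "AE t in lborel. 0 \<le> r0 t"
  proof (rule AE_nonneg_if_laplace_powser[OF _ r00 r0int r0lap])
    fix l assume "L < l"
    then show "\<exists>\<rho>. (\<forall>n. 0 \<le> \<rho> n) \<and> (\<forall>z. \<bar>z\<bar> < 1 \<longrightarrow> (\<lambda>n. \<rho> n * z ^ n) sums (1 / (g (l * (1 - z)) + \<mu>)))"
      using bernstein_function_reciprocal[OF g\<mu>, of l] L(1) by (metis less_trans)
  qed (use L(1) in auto)
  define r where "r t = max 0 (r0 t)" for t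
  have [measurable]: "r \<in> borel_measurable borel" unfolding r_def by measurable
  have r_AE: "AE t in lborel. r t = r0 t" using r0nn by eventually_elim (simp add: r_def)
  have r0': "0 \<le> r t" and rneg: "t < 0 \<Longrightarrow> r t = 0" for t by (auto simp: r_def r00)
  have rint_L: "integrable lborel (\<lambda>t. exp (- s * t) * r t)" if "L < s" for s
    by (rule integrable_cong_AE_imp[OF r0int[OF that]]) (use r_AE in \<open>auto elim: eventually_mono\<close>)
  have rlap_L: "(\<integral>t. exp (- s * t) * r t \<partial>lborel) = 1 / (g s + \<mu>)" if "L < s" for s
    unfolding r0lap[OF that, symmetric]
    by (rule integral_cong_AE) (use r_AE in \<open>auto elim: eventually_mono\<close>)
  \<comment> \<open>The series of 1/(g + \<mu>) about a point l > L converges for every |z| < 1 and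
    so reaches down to any s > 0. Its coefficients are moments of r; all terms being nonnegative,
    integration and summation may be exchanged without knowing integrability at s
    beforehand.\<close>
  have main: "integrable lborel (\<lambda>t. exp (- s * t) * r t) \<and> (\<integral>t. exp (- s * t) * r t \<partial>lborel) = 1 / (g s + \<mu>)" if s: "0 < s" for s
  proof -
    define l where "l = max L s + 1"
    have l: "0 < l" "L < l" "s < l" using L(1) by (auto simp: l_def)
    define z where "z = 1 - s / l"
    have z: "0 < z" "z < 1" "l * (1 - z) = s" using l s by (auto simp: z_def)
    obtain p where p: "\<And>n. 0 \<le> p n" "\<And>z. \<bar>z\<bar> < 1 \<Longrightarrow> (\<lambda>n. p n * z ^ n) sums (1 / (g (l * (1 - z)) + \<mu>))"
      using bernstein_function_reciprocal[OF g\<mu> l(1)] by blast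
    have pm: "l ^ n / fact n * (\<integral>t. exp (- l * t) * t ^ n * r t \<partial>lborel) = p n" for n
      by (rule laplace_moments_eq[OF _ rneg rint_L rlap_L _ l(2) zero_less_one p(2)]) (use L(1) in auto)
    have ssum: "(\<lambda>n. p n * z ^ n) sums (1 / (g s + \<mu>))" using p(2)[of z] z by simp
    obtain s' where s': "L < s'" "s' < l" using dense[OF l(2)] by auto
    have mi: "integrable lborel (\<lambda>t. exp (- l * t) * t ^ n * r t)" for n
      by (rule integrable_power_exp[OF _ rneg rint_L[OF s'(1)] s'(2)]) auto
    define u where "u n t = z ^ n * (l ^ n / fact n) * (exp (- l * t) * t ^ n * r t)" for n t
    have u0: "0 \<le> u n t" for n t
      using z(1) l(1) r0'[of t] rneg[of t] by (cases "t < 0") (auto simp: u_def)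
    have usum: "(\<lambda>n. u n t) sums (exp (- s * t) * r t)" for t
    proof -
      have "(\<lambda>n. (z * (l * t)) ^ n / fact n * (exp (- l * t) * r t)) sums (exp (z * (l * t)) * (exp (- l * t) * r t))"
        by (intro sums_mult2 poisson_sums(1))
      also have "exp (z * (l * t)) * (exp (- l * t) * r t) = exp (- (l * (1 - z)) * t) * r t"
        by (simp add: algebra_simps flip: exp_add)
      also have "(\<lambda>n. (z * (l * t)) ^ n / fact n * (exp (- l * t) * r t)) = (\<lambda>n. u n t)"
        by (simp add: u_def power_mult_distrib fun_eq_iff)
      finally show ?thesis unfolding z(3) .
    qed
    have "(\<integral>\<^sup>+t. ennreal (exp (- s * t) * r t) \<partial>lborel) = (\<integral>\<^sup>+t. (\<Sum>n. ennreal (u n t)) \<partial>lborel)"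
      by (intro nn_integral_cong) (simp add: suminf_ennreal2[OF u0 sums_summable[OF usum]] sums_unique[OF usum, symmetric])
    also have "\<dots> = (\<Sum>n. \<integral>\<^sup>+t. ennreal (u n t) \<partial>lborel)"
      by (rule nn_integral_suminf) (simp add: u_def)
    also have "\<dots> = (\<Sum>n. ennreal (p n * z ^ n))"
    proof (intro arg_cong[of _ _ suminf] ext)
      fix n
      have "(\<integral>\<^sup>+t. ennreal (u n t) \<partial>lborel) = ennreal (\<integral>t. u n t \<partial>lborel)"
        unfolding u_def using u0[unfolded u_def] mi by (intro nn_integral_eq_integral AE_I2 integrable_mult_right)
      also have "(\<integral>t. u n t \<partial>lborel) = p n * z ^ n"
        unfolding u_def integral_mult_right_zero pm[symmetric] by (simp only: mult_ac)
      finally show "(\<integral>\<^sup>+t. ennreal (u n t) \<partial>lborel) = ennreal (p n * z ^ n)" .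
    qed
    also have "\<dots> = ennreal (1 / (g s + \<mu>))"
      using p(1) z(1) by (subst suminf_ennreal2[OF _ sums_summable[OF ssum]]) (auto simp: sums_unique[OF ssum, symmetric])
    finally have nn: "(\<integral>\<^sup>+t. ennreal (exp (- s * t) * r t) \<partial>lborel) = ennreal (1 / (g s + \<mu>))" .
    have pos: "0 \<le> 1 / (g s + \<mu>)" using gpos[OF s] \<mu> by simp
    have "integrable lborel (\<lambda>t. exp (- s * t) * r t)"
      by (rule integrableI_nn_integral_finite[OF _ _ nn]) (auto simp: r0')
    moreover have "(\<integral>t. exp (- s * t) * r t \<partial>lborel) = 1 / (g s + \<mu>)"
      using nn pos by (subst integral_eq_nn_integral) (auto simp: r0')
    ultimately show ?thesis by blast
  qed
  have r: "laplace_kernel r" unfolding laplace_kernel_def using r0' rneg main by auto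
  note rlap = main[THEN conjunct2]
  have "AE t in lborel. k t - (r t + \<mu> * convolution r k t) = 0"
  proof (rule AE_zero_if_laplace_zero)
    note rk = laplace_kernel_convolution[OF r k]
    note [measurable] = laplace_kernelD(1)[OF rk]
    show "(\<lambda>t. k t - (r t + \<mu> * convolution r k t)) \<in> borel_measurable borel" by measurable
    show "k t - (r t + \<mu> * convolution r k t) = 0" if "t < 0" for t
      using laplace_kernelD(3)[OF k that] laplace_kernelD(3)[OF r that] laplace_kernelD(3)[OF rk that] by simp
    fix s :: real assume s: "0 < s"
    note i = laplace_kernelD(4)[OF k s] laplace_kernelD(4)[OF r s] integrable_mult_right[OF laplace_kernelD(4)[OF rk s], of \<mu>]
    have eq: "exp (- s * t) * (k t - (r t + \<mu> * convolution r k t)) = exp (- s * t) * k t - (exp (- s * t) * r t + \<mu> * (exp (- s * t) * convolution r k t))" for t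
      by (simp add: algebra_simps)
    show "integrable lborel (\<lambda>t. exp (- s * t) * (k t - (r t + \<mu> * convolution r k t)))"
      unfolding eq by (intro Bochner_Integration.integrable_diff Bochner_Integration.integrable_add i)
    have "(\<integral>t. exp (- s * t) * (k t - (r t + \<mu> * convolution r k t)) \<partial>lborel) =
      (\<integral>t. exp (- s * t) * k t \<partial>lborel) - ((\<integral>t. exp (- s * t) * r t \<partial>lborel) + (\<integral>t. \<mu> * (exp (- s * t) * convolution r k t) \<partial>lborel))"
      unfolding eq using i by (subst Bochner_Integration.integral_diff Bochner_Integration.integral_add; (intro Bochner_Integration.integrable_add)?)+ auto
    also have "\<dots> = 1 / g s - (1 / (g s + \<mu>) + \<mu> * (1 / (g s + \<mu>) * (1 / g s)))"
      using convolution_laplace[OF r k s] lap[OF s] rlap[OF s] by simp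
    also have "\<dots> = 0"
    proof -
      \<comment> \<open>The partial fraction identity 1/g = 1/(g + \<mu>) + \<mu> / (g (g +
        \<mu>)).\<close>
      have "1 / (g s + \<mu>) * (g s + \<mu>) = 1" "1 / g s * g s = 1" using gpos[OF s] \<mu> by auto
      then show ?thesis by algebra
    qed
    finally show "(\<integral>t. exp (- s * t) * (k t - (r t + \<mu> * convolution r k t)) \<partial>lborel) = 0" .
  qed
  then have "AE t in lborel. k t = r t + \<mu> * convolution r k t" by eventually_elim simp
  moreover have "\<mu> * volterra_conv r (\<lambda>_. 1) t \<le> 1" for t
  proof (cases "t < 0")
    case False
    \<comment> \<open>On \<open>{0..t}\<close> the factor exp(s (t - \<tau>)) is at least 1, so the
      mass of r there is at most exp(s t)/(g s + \<mu>). The claim follows as s tends to 0.\<close>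
    have est: "\<mu> * volterra_conv r (\<lambda>_. 1) t \<le> exp (s * t)" if s: "0 < s" for s
    proof -
      note i = laplace_kernelD(4)[OF r s]
      have "volterra_conv r (\<lambda>_. 1) t = convolution (\<lambda>\<tau>. indicator {0..} \<tau> * 1) r t"
        using volterra_conv_eq_convolution[OF r, of "\<lambda>_. 1" t 1] by (simp add: convolution_commute)
      also have "\<dots> \<le> (\<integral>\<tau>. exp (s * t) * (exp (- s * \<tau>) * r \<tau>) \<partial>lborel)"
        unfolding convolution_def
      proof (rule integral_mono_AE')
        show "integrable lborel (\<lambda>\<tau>. exp (s * t) * (exp (- s * \<tau>) * r \<tau>))" using i by simp
        show "AE \<tau> in lborel. indicator {0..} (t - \<tau>) * 1 * r \<tau> \<le> exp (s * t) * (exp (- s * \<tau>) * r \<tau>)"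
        proof (rule AE_I2)
          fix \<tau>
          show "indicator {0..} (t - \<tau>) * 1 * r \<tau> \<le> exp (s * t) * (exp (- s * \<tau>) * r \<tau>)"
          proof (cases "\<tau> \<le> t")
            case True
            then have "1 * r \<tau> \<le> exp (s * (t - \<tau>)) * r \<tau>" using s r0'[of \<tau>] by (intro mult_right_mono) auto
            then show ?thesis using True by (simp add: algebra_simps flip: exp_add)
          qed (use r0'[of \<tau>] in auto)
        qed
        show "AE \<tau> in lborel. 0 \<le> exp (s * t) * (exp (- s * \<tau>) * r \<tau>)" using r0' by auto
      qed
      also have "\<dots> = exp (s * t) * (1 / (g s + \<mu>))" using rlap[OF s] by simp
      also have "\<dots> \<le> exp (s * t) * (1 / \<mu>)"
        using gpos[OF s] \<mu> by (intro mult_left_mono divide_left_mono) auto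
      finally show ?thesis using \<mu> by (simp add: field_simps)
    qed
    have "((\<lambda>s. exp (s * t)) \<longlongrightarrow> exp (0 * t)) (at_right 0)" by (intro tendsto_intros)
    then have "\<mu> * volterra_conv r (\<lambda>_. 1) t \<le> exp (0 * t)"
    proof (rule tendsto_lowerbound)
      show "\<forall>\<^sub>F s in at_right 0. \<mu> * volterra_conv r (\<lambda>_. 1) t \<le> exp (s * t)"
        using eventually_at_right_less[of "0::real"] by eventually_elim (rule est)
    qed simp
    then show ?thesis by simp
  qed (simp add: volterra_conv_def)
  moreover have "\<mu> * (\<integral>t. exp (- t) * r t \<partial>lborel) < 1"
  proof -
    have "(\<integral>t. exp (- t) * r t \<partial>lborel) = 1 / (g 1 + \<mu>)" using rlap[of 1] by simp
    then show ?thesis using gpos[of 1] \<mu> by simp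
  qed
  ultimately show ?thesis using r unfolding resolvent_kernel_def by blast
qed

text \<open>The given kernel is only Lebesgue measurable and arbitrary at negative times. It is cut
  off there, replaced by a Borel version, and then by its positive part; the last change is on a
  null set because the reciprocal of a Bernstein function has nonnegative coefficients.\<close>

lemma laplace_kernel_representative:
  assumes li: "has_laplace_transform k0 (\<lambda>s. 1 / g s)" and g: "bernstein_function g"
  obtains k where "laplace_kernel k" "AE t in lebesgue. 0 \<le> t \<longrightarrow> k0 t = k t"
    "\<And>s. 0 < s \<Longrightarrow> (\<integral>t. exp (- s * t) * k t \<partial>lborel) = 1 / g s"
proof -
  have ai: "(\<lambda>t. exp (- s * t) * k0 t) absolutely_integrable_on {0..}"
    and il: "integral {0..} (\<lambda>t. exp (- s * t) * k0 t) = 1 / g s" if "0 < s" for s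
    using li that by (auto simp: has_laplace_transform_def)
  define f where "f t = indicator {0..} t * k0 t" for t
  have fint: "integrable lebesgue (\<lambda>t. exp (- s * t) * f t)" if "0 < s" for s
    using ai[OF that] unfolding set_integrable_def f_def by (simp add: mult.left_commute)
  \<comment> \<open>Integrability is given for the damped kernel; multiplying by exp t recovers
    measurability of \<open>f\<close> itself.\<close>
  have "(exp :: real \<Rightarrow> real) \<in> borel_measurable lebesgue" by (intro measurable_completion) simp
  from borel_measurable_times[OF this borel_measurable_integrable[OF fint[OF zero_less_one]]]
  have "(\<lambda>t. exp t * (exp (- 1 * t) * f t)) \<in> borel_measurable lebesgue" .
  moreover have "(\<lambda>t. exp t * (exp (- 1 * t) * f t)) = f" by (simp add: exp_minus field_simps)
  ultimately have "f \<in> borel_measurable lebesgue" by simp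
  then obtain f' where f': "f' \<in> borel_measurable lborel" "AE t in lborel. f t = f' t"
    using completion_ex_borel_measurable_real[of f lborel] by blast
  have [measurable]: "f' \<in> borel_measurable borel" using f'(1) by simp
  define k1 where "k1 t = indicator {0..} t * f' t" for t
  have [measurable]: "k1 \<in> borel_measurable borel" unfolding k1_def by measurable
  have k1AE: "AE t in lborel. f t = k1 t"
    using f'(2) by eventually_elim (auto simp: f_def k1_def indicator_def)
  have k1AE': "AE t in lebesgue. f t = k1 t" by (rule AE_completion[OF k1AE])
  have k1int: "integrable lborel (\<lambda>t. exp (- s * t) * k1 t)" if "0 < s" for s
  proof -
    have "integrable lebesgue (\<lambda>t. exp (- s * t) * k1 t)"
      by (rule integrable_cong_AE_imp[OF fint[OF that]])
         (use k1AE' in \<open>auto elim: eventually_mono intro: measurable_completion\<close>)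
    then show ?thesis by (subst (asm) integrable_completion) auto
  qed
  have k1lap: "(\<integral>t. exp (- s * t) * k1 t \<partial>lborel) = 1 / g s" if s: "0 < s" for s
  proof -
    have "(\<integral>t. exp (- s * t) * k1 t \<partial>lborel) = (\<integral>t. exp (- s * t) * k1 t \<partial>lebesgue)"
      by (rule integral_completion[symmetric]) simp
    also have "\<dots> = (\<integral>t. exp (- s * t) * f t \<partial>lebesgue)"
      by (rule integral_cong_AE)
         (use k1AE' fint[OF s] in \<open>auto elim: eventually_mono intro: measurable_completion\<close>)
    also have "\<dots> = integral {0..} (\<lambda>t. exp (- s * t) * k0 t)"
      using set_lebesgue_integral_eq_integral(2)[OF ai[OF s]]
      by (simp add: set_lebesgue_integral_def f_def mult.left_commute)
    finally show ?thesis unfolding il[OF s] .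
  qed
  have k1neg: "k1 t = 0" if "t < 0" for t using that by (simp add: k1_def)
  have nn: "AE t in lborel. 0 \<le> k1 t"
  proof (rule AE_nonneg_if_laplace_powser[OF _ k1neg k1int k1lap])
    fix l :: real assume "0 < l"
    then show "\<exists>\<rho>. (\<forall>n. 0 \<le> \<rho> n) \<and> (\<forall>z. \<bar>z\<bar> < 1 \<longrightarrow> (\<lambda>n. \<rho> n * z ^ n) sums (1 / g (l * (1 - z))))"
      using bernstein_function_reciprocal[OF g, of l] by metis
  qed auto
  define k where "k t = max 0 (k1 t)" for t
  have [measurable]: "k \<in> borel_measurable borel" unfolding k_def by measurable
  have kAE: "AE t in lborel. k1 t = k t" using nn by eventually_elim (simp add: k_def)
  show thesis
  proof (rule that[of k])
    show "laplace_kernel k" unfolding laplace_kernel_def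
    proof (intro conjI allI impI)
      show "integrable lborel (\<lambda>t. exp (- s * t) * k t)" if "0 < s" for s
        by (rule integrable_cong_AE_imp[OF k1int[OF that]]) (use kAE in \<open>auto elim: eventually_mono\<close>)
    qed (auto simp: k_def k1neg)
    have "AE t in lborel. f t = k t" using k1AE kAE by eventually_elim simp
    from AE_completion[OF this] show "AE t in lebesgue. 0 \<le> t \<longrightarrow> k0 t = k t"
      by eventually_elim (auto simp: f_def)
    show "(\<integral>t. exp (- s * t) * k t \<partial>lborel) = 1 / g s" if "0 < s" for s
      unfolding k1lap[OF that, symmetric]
      by (rule integral_cong_AE) (use kAE in \<open>auto elim: eventually_mono\<close>)
  qed
qed

section \<open>Weights\<close>

lemma signed_gbinomial_Suc:
  fixes a :: real
  shows "real (Suc n) * ((-1) ^ Suc n * (a gchoose Suc n)) = (real n - a) * ((-1) ^ n * (a gchoose n))"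
proof -
  have "real (Suc n) * (a gchoose Suc n) = (a - real n) * (a gchoose n)"
    using gbinomial_mult_1[of a n] by (simp add: algebra_simps)
  then have "(-1) ^ Suc n * (real (Suc n) * (a gchoose Suc n)) = (-1) ^ Suc n * ((a - real n) * (a gchoose n))"
    by simp
  then show ?thesis by (simp add: algebra_simps)
qed

lemma signed_gbinomial_sums:
  fixes a z :: real
  assumes "\<bar>z\<bar> < 1"
  shows "(\<lambda>n. (-1) ^ n * (a gchoose n) * z ^ n) sums (1 - z) powr a"
  using gen_binomial_real[of "- z" a] assms by (simp add: power_minus[of z] mult_ac)

lemma signed_gbinomial_nonpos:
  assumes "0 \<le> a" "a \<le> (1::real)" shows "(-1) ^ Suc n * (a gchoose Suc n) \<le> 0"
proof (induction n)
  case (Suc n)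
  have "real (Suc (Suc n)) * ((-1) ^ Suc (Suc n) * (a gchoose Suc (Suc n))) \<le> 0"
    unfolding signed_gbinomial_Suc by (rule mult_nonneg_nonpos[OF _ Suc]) (use assms in auto)
  then have "real (Suc (Suc n)) * ((-1) ^ Suc (Suc n) * (a gchoose Suc (Suc n))) \<le> real (Suc (Suc n)) * 0" by (simp only: mult_zero_right)
  then show ?case by (rule mult_left_le_imp_le) simp
qed (use assms in simp)

text \<open>A bound uniform in the exponent, used in \<open>series_integral\<close> to dominate the
  binomial series when exponents are integrated out.\<close>

lemma abs_gbinomial_le_1:
  assumes "-1 \<le> a" "a \<le> (1::real)" shows "\<bar>a gchoose n\<bar> \<le> 1"
proof (induction n)
  case (Suc n)
  have "real (Suc n) * \<bar>a gchoose Suc n\<bar> = \<bar>real n - a\<bar> * \<bar>a gchoose n\<bar>"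
    using arg_cong[OF signed_gbinomial_Suc[of n a], of abs] by (simp only: abs_mult power_abs abs_minus abs_one power_one mult_1_left abs_of_nat)
  also have "\<dots> \<le> real (Suc n) * 1" using assms Suc by (intro mult_mono) auto
  finally show ?case by (simp only: mult_le_cancel_left_pos of_nat_0_less_iff zero_less_Suc)
qed simp

text \<open>The Taylor coefficients of (1 - z)^(\<beta> - 1).\<close>

definition neg_coeff :: "real \<Rightarrow> nat \<Rightarrow> real" where
  "neg_coeff \<beta> n = (-1) ^ n * ((\<beta> - 1) gchoose n)"

lemma neg_coeff_Suc: "real (Suc n) * neg_coeff \<beta> (Suc n) = (real (Suc n) - \<beta>) * neg_coeff \<beta> n"
  using signed_gbinomial_Suc[of n "\<beta> - 1"] by (simp add: neg_coeff_def algebra_simps)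

lemma neg_coeff_nonneg: "\<beta> \<le> 1 \<Longrightarrow> 0 \<le> neg_coeff \<beta> n"
proof (induction n)
  case (Suc n)
  have "0 \<le> real (Suc n) * neg_coeff \<beta> (Suc n)"
    unfolding neg_coeff_Suc using Suc by (intro mult_nonneg_nonneg) auto
  then show ?case by (simp add: zero_le_mult_iff)
qed (simp add: neg_coeff_def)

text \<open>This is log-convexity, in a form that is linear in the coefficients and hence survives
  integration over \<beta>. It holds because the quotients (N - \<beta>)/N of consecutive
  coefficients increase with N.\<close>

lemma neg_coeff_quadratic:
  assumes "0 \<le> \<beta>" "\<beta> \<le> 1"
  shows "0 \<le> neg_coeff \<beta> n * x\<^sup>2 + 2 * neg_coeff \<beta> (Suc n) * x + neg_coeff \<beta> (Suc (Suc n))"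
proof -
  define N where "N = real n + 1"
  have N: "1 \<le> N" by (simp add: N_def)
  have p1: "neg_coeff \<beta> (Suc n) = (N - \<beta>) / N * neg_coeff \<beta> n"
    using neg_coeff_Suc[of n \<beta>] N by (simp add: N_def field_simps)
  have "(N + 1) * neg_coeff \<beta> (Suc (Suc n)) = (N + 1 - \<beta>) * neg_coeff \<beta> (Suc n)"
    using neg_coeff_Suc[of "Suc n" \<beta>] by (simp add: N_def algebra_simps)
  moreover have "neg_coeff \<beta> (Suc (Suc n)) = ((N + 1) * neg_coeff \<beta> (Suc (Suc n))) / (N + 1)" using N by simp
  ultimately have p2: "neg_coeff \<beta> (Suc (Suc n)) = (N + 1 - \<beta>) / (N + 1) * ((N - \<beta>) / N * neg_coeff \<beta> n)"
    by (simp add: p1)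
  have "((N - \<beta>) / N)\<^sup>2 \<le> (N + 1 - \<beta>) / (N + 1) * ((N - \<beta>) / N)"
  proof -
    have "(N - \<beta>) / N \<le> (N + 1 - \<beta>) / (N + 1)" using N assms by (simp add: field_simps)
    then show ?thesis using N assms unfolding power2_eq_square by (intro mult_right_mono) auto
  qed
  \<comment> \<open>Completing the square; the remainder is nonnegative by the monotonicity of the
    quotients.\<close>
  then have "0 \<le> (x + (N - \<beta>) / N)\<^sup>2 + ((N + 1 - \<beta>) / (N + 1) * ((N - \<beta>) / N) - ((N - \<beta>) / N)\<^sup>2)"
    by (intro add_nonneg_nonneg) auto
  then have "0 \<le> neg_coeff \<beta> n * ((x + (N - \<beta>) / N)\<^sup>2 + ((N + 1 - \<beta>) / (N + 1) * ((N - \<beta>) / N) - ((N - \<beta>) / N)\<^sup>2))"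
    using neg_coeff_nonneg[OF assms(2)] by (intro mult_nonneg_nonneg)
  also have "\<dots> = neg_coeff \<beta> n * x\<^sup>2 + 2 * neg_coeff \<beta> (Suc n) * x + neg_coeff \<beta> (Suc (Suc n))"
    unfolding p1 p2 by (simp only: power2_sum) algebra
  finally show ?thesis .
qed

lemma discriminant_le:
  fixes a b c :: real
  assumes q: "\<And>x. 0 \<le> a * x\<^sup>2 + 2 * b * x + c" and a: "0 \<le> a"
  shows "b\<^sup>2 \<le> a * c"
proof (cases "a = 0")
  case True
  have "b = 0"
  proof (rule ccontr)
    assume "b \<noteq> 0"
    \<comment> \<open>At this x the linear function takes the value -1.\<close>
    then show False using q[of "- (c + 1) / (2 * b)"] True by simp
  qed
  then show ?thesis using True by simp
next
  case False
  have "0 \<le> a * (a * (- b / a)\<^sup>2 + 2 * b * (- b / a) + c)" by (rule mult_nonneg_nonneg[OF a q])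
  also have "\<dots> = a * c - b\<^sup>2" using False by (simp add: field_simps power2_eq_square)
  finally show ?thesis by simp
qed

section \<open>Weights as finite measures on exponents\<close>

lemma powr_le_max:
  fixes l a :: real
  assumes "0 < l" "\<bar>a\<bar> \<le> 1" shows "l powr a \<le> max l (1 / l)" "min l (1 / l) \<le> l powr a"
proof -
  have "l powr a \<le> max l (1 / l) \<and> min l (1 / l) \<le> l powr a"
  proof (cases "1 \<le> l")
    case True
    have "l powr (-1) \<le> l powr a" by (rule powr_mono) (use assms True in auto)
    moreover have "l powr a \<le> l powr 1" by (rule powr_mono) (use assms True in auto)
    ultimately show ?thesis using assms by (auto simp: powr_minus_divide)
  next
    case False
    have "l powr a \<le> l powr (-1)" by (rule powr_mono') (use assms False in auto)
    moreover have "l powr 1 \<le> l powr a" by (rule powr_mono') (use assms False in auto)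
    ultimately show ?thesis using assms by (auto simp: powr_minus_divide)
  qed
  then show "l powr a \<le> max l (1 / l)" "min l (1 / l) \<le> l powr a" by auto
qed

text \<open>A common frame for both types of weight: \<nu> is a point measure on indices or a
  density on exponents, and \<open>e\<close> gives the exponent. Nondegeneracy makes
  \<open>h\<close> positive and, in Kaluza's theorem for h(s)/s, the coefficient \<open>a 1\<close>
  strictly positive.\<close>

locale weight_measure = finite_measure \<nu> for \<nu> :: "'i measure" +
  fixes e :: "'i \<Rightarrow> real"
  assumes e_measurable [measurable]: "e \<in> borel_measurable \<nu>"
    and e_AE: "AE i in \<nu>. 0 \<le> e i \<and> e i \<le> 1"
    and nondegenerate: "0 < (\<integral>i. 1 - e i \<partial>\<nu>)"
begin

definition h :: "real \<Rightarrow> real" where "h s = (\<integral>i. s powr e i \<partial>\<nu>)"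

lemma gbinomial_measurable [measurable]: "(\<lambda>i. (e i - d) gchoose n) \<in> borel_measurable \<nu>"
  unfolding gbinomial_prod_rev by measurable

lemma bounded_integrable:
  fixes f :: "'i \<Rightarrow> real"
  assumes [measurable]: "f \<in> borel_measurable \<nu>" and "AE i in \<nu>. \<bar>f i\<bar> \<le> B"
  shows "integrable \<nu> f"
  by (rule Bochner_Integration.integrable_bound[of \<nu> "\<lambda>_. B"]) (use assms in \<open>auto elim: eventually_mono\<close>)

text \<open>The case d = 0 is the series of h, the case d = 1 that of h(s)/s. Summation and
  integration are exchanged with the majorant max l (1/l) times |z|^n.\<close>

lemma series_integral:
  assumes l: "0 < l" and z: "\<bar>z\<bar> < 1" and d: "d = 0 \<or> d = 1"
  shows "integrable \<nu> (\<lambda>i. l powr (e i - d) * ((-1) ^ n * ((e i - d) gchoose n)))"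
    and "(\<lambda>n. (\<integral>i. l powr (e i - d) * ((-1) ^ n * ((e i - d) gchoose n)) \<partial>\<nu>) * z ^ n) sums
      (\<integral>i. (l * (1 - z)) powr (e i - d) \<partial>\<nu>)"
proof -
  define C where "C = max l (1 / l)"
  have C: "0 < C" using l by (simp add: C_def less_max_iff_disj)
  define c where "c n i = l powr (e i - d) * ((-1) ^ n * ((e i - d) gchoose n))" for n i
  have [measurable]: "c n \<in> borel_measurable \<nu>" for n unfolding c_def by measurable
  have ed: "AE i in \<nu>. \<bar>e i - d\<bar> \<le> 1" using e_AE by eventually_elim (use d in auto)
  have cb: "AE i in \<nu>. \<forall>n. \<bar>c n i\<bar> \<le> C"
    using ed
  proof eventually_elim
    case (elim i)
    show ?case
    proof
      fix n
      have "l powr (e i - d) * \<bar>(e i - d) gchoose n\<bar> \<le> C * 1"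
        using elim powr_le_max[OF l elim] C unfolding C_def by (intro mult_mono abs_gbinomial_le_1) auto
      then show "\<bar>c n i\<bar> \<le> C" by (simp add: c_def abs_mult power_abs)
    qed
  qed
  have cint: "integrable \<nu> (c n)" for n
    by (rule bounded_integrable[where B = C]) (use cb in \<open>auto elim: eventually_mono\<close>)
  then show "integrable \<nu> (\<lambda>i. l powr (e i - d) * ((-1) ^ n * ((e i - d) gchoose n)))"
    unfolding c_def .
  have zn: "norm z < 1" using z by simp
  have s1: "AE i in \<nu>. summable (\<lambda>n. norm (c n i * z ^ n))"
    using cb
  proof eventually_elim
    case (elim i)
    show ?case
    proof (rule summable_comparison_test'[where N = 0])
      show "summable (\<lambda>n. C * \<bar>z\<bar> ^ n)" using z by (intro summable_mult summable_geometric) auto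
      show "norm (norm (c n i * z ^ n)) \<le> C * \<bar>z\<bar> ^ n" for n
        using elim by (simp add: abs_mult power_abs mult_right_mono)
    qed
  qed
  have s2: "summable (\<lambda>n. \<integral>i. norm (c n i * z ^ n) \<partial>\<nu>)"
  proof (rule summable_comparison_test'[where N = 0])
    show "summable (\<lambda>n. (C * measure \<nu> (space \<nu>)) * \<bar>z\<bar> ^ n)" using z by (intro summable_mult summable_geometric) auto
    fix n
    have "(\<integral>i. norm (c n i * z ^ n) \<partial>\<nu>) \<le> (\<integral>i. C * \<bar>z\<bar> ^ n \<partial>\<nu>)"
    proof (rule integral_mono_AE)
      show "AE i in \<nu>. norm (c n i * z ^ n) \<le> C * \<bar>z\<bar> ^ n"
        using cb by eventually_elim (simp add: abs_mult power_abs mult_right_mono)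
    qed (use cint in auto)
    then show "norm (\<integral>i. norm (c n i * z ^ n) \<partial>\<nu>) \<le> (C * measure \<nu> (space \<nu>)) * \<bar>z\<bar> ^ n"
      by (simp add: mult_ac)
  qed
  have "(\<lambda>n. \<integral>i. c n i * z ^ n \<partial>\<nu>) sums (\<integral>i. (\<Sum>n. c n i * z ^ n) \<partial>\<nu>)"
    by (rule sums_integral[OF _ s1 s2]) (use cint in simp)
  moreover have "(\<integral>i. (\<Sum>n. c n i * z ^ n) \<partial>\<nu>) = (\<integral>i. (l * (1 - z)) powr (e i - d) \<partial>\<nu>)"
  proof (rule Bochner_Integration.integral_cong[OF refl])
    fix i
    have "(\<lambda>n. l powr (e i - d) * ((-1) ^ n * ((e i - d) gchoose n) * z ^ n)) sums (l powr (e i - d) * (1 - z) powr (e i - d))"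
      by (intro sums_mult signed_gbinomial_sums z)
    then have "(\<lambda>n. c n i * z ^ n) sums ((l * (1 - z)) powr (e i - d))"
      using l z by (simp add: c_def powr_mult mult_ac)
    then show "(\<Sum>n. c n i * z ^ n) = (l * (1 - z)) powr (e i - d)" by (rule sums_unique[symmetric])
  qed
  ultimately show "(\<lambda>n. (\<integral>i. l powr (e i - d) * ((-1) ^ n * ((e i - d) gchoose n)) \<partial>\<nu>) * z ^ n) sums
      (\<integral>i. (l * (1 - z)) powr (e i - d) \<partial>\<nu>)"
    by (simp add: c_def)
qed

lemma integral_powr_pos:
  assumes l: "0 < l" and that: "d = 0 \<or> d = 1" shows "0 < (\<integral>i. l powr (e i - d) * (1 - e i) \<partial>\<nu>)"
proof -
  define m where "m = min l (1 / l)"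
  have m: "0 < m" using l by (simp add: m_def)
  have "0 < m * (\<integral>i. 1 - e i \<partial>\<nu>)" using m nondegenerate by simp
  also have "\<dots> = (\<integral>i. m * (1 - e i) \<partial>\<nu>)" by simp
  also have "\<dots> \<le> (\<integral>i. l powr (e i - d) * (1 - e i) \<partial>\<nu>)"
  proof (rule integral_mono_AE)
    show "integrable \<nu> (\<lambda>i. m * (1 - e i))"
      proof (rule bounded_integrable[where B = m])
        show "AE i in \<nu>. \<bar>m * (1 - e i)\<bar> \<le> m"
          using e_AE by eventually_elim (use m in \<open>simp add: abs_mult\<close>)
      qed measurable
    show "integrable \<nu> (\<lambda>i. l powr (e i - d) * (1 - e i))"
    proof (rule bounded_integrable[where B = "max l (1 / l)"])
      show "AE i in \<nu>. \<bar>l powr (e i - d) * (1 - e i)\<bar> \<le> max l (1 / l)"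
        using e_AE
      proof eventually_elim
        case (elim i)
        then have "l powr (e i - d) * (1 - e i) \<le> max l (1 / l) * 1"
          using powr_le_max(1)[OF l, of "e i - d"] that l by (intro mult_mono) (auto simp: less_max_iff_disj less_imp_le)
        then show ?case using elim by (simp add: abs_mult)
      qed
    qed measurable
    show "AE i in \<nu>. m * (1 - e i) \<le> l powr (e i - d) * (1 - e i)"
      using e_AE
    proof eventually_elim
      case (elim i)
      then show ?case unfolding m_def using powr_le_max(2)[OF l, of "e i - d"] that by (intro mult_right_mono) auto
    qed
  qed
  finally show ?thesis .
qed

lemma h_pos: assumes s: "0 < s" shows "0 < h s"
proof -
  have i: "integrable \<nu> (\<lambda>i. s powr e i)" using series_integral(1)[OF s, of 0 0 0] by simp
  have "0 < (\<integral>i. s powr (e i - 0) * (1 - e i) \<partial>\<nu>)" by (rule integral_powr_pos[OF s]) simp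
  also have "\<dots> \<le> h s" unfolding h_def
  proof (rule integral_mono_AE')
    show "AE i in \<nu>. s powr (e i - 0) * (1 - e i) \<le> s powr e i"
      using e_AE by eventually_elim (simp add: mult_left_le)
  qed (use i in auto)
  finally show ?thesis .
qed

lemma bernstein_function_h: "bernstein_function h"
  unfolding bernstein_function_def
proof (intro allI impI exI)
  fix l :: real assume l: "0 < l"
  show "bernstein_series (\<lambda>n. \<integral>i. l powr (e i - 0) * ((-1) ^ n * ((e i - 0) gchoose n)) \<partial>\<nu>) (\<lambda>z. h (l * (1 - z)))"
    unfolding bernstein_series_def
  proof (intro conjI allI impI)
    fix n
    have "AE i in \<nu>. 0 \<le> - (l powr (e i - 0) * ((-1) ^ Suc n * ((e i - 0) gchoose Suc n)))"
      using e_AE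
    proof eventually_elim
      case (elim i)
      then show ?case using mult_nonneg_nonpos[OF powr_ge_zero signed_gbinomial_nonpos, of "e i" l "e i" n] by simp
    qed
    then have "0 \<le> (\<integral>i. - (l powr (e i - 0) * ((-1) ^ Suc n * ((e i - 0) gchoose Suc n))) \<partial>\<nu>)"
      by (rule integral_nonneg_AE)
    then show "(\<integral>i. l powr (e i - 0) * ((-1) ^ Suc n * ((e i - 0) gchoose Suc n)) \<partial>\<nu>) \<le> 0"
      by simp
  next
    fix z :: real assume z: "\<bar>z\<bar> < 1"
    show "(\<lambda>n. (\<integral>i. l powr (e i - 0) * ((-1) ^ n * ((e i - 0) gchoose n)) \<partial>\<nu>) * z ^ n) sums h (l * (1 - z))"
      using series_integral(2)[OF l z, of 0] by (simp add: h_def)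
    show "0 < h (l * (1 - z))" using l z by (intro h_pos mult_pos_pos) auto
  qed
qed

lemma h_divide: "0 < s \<Longrightarrow> (\<integral>i. s powr (e i - 1) \<partial>\<nu>) = h s / s"
  by (simp add: h_def powr_diff)

text \<open>The coefficients of h(s)/s average the sequences \<open>neg_coeff (e i)\<close> with the
  positive weights l^(e i - 1), so what remains is that averaging preserves log-convexity.\<close>

lemma bernstein_function_conjugate: "bernstein_function (\<lambda>s. s / h s)"
  unfolding bernstein_function_def
proof (intro allI impI)
  fix l :: real assume l: "0 < l"
  define a where "a n = (\<integral>i. l powr (e i - 1) * neg_coeff (e i) n \<partial>\<nu>)" for n
  have aint: "integrable \<nu> (\<lambda>i. l powr (e i - 1) * neg_coeff (e i) n)" for n
    using series_integral(1)[OF l, of 0 1 n] by (simp add: neg_coeff_def)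
  have n0: "neg_coeff \<beta> 0 = 1" and n1: "neg_coeff \<beta> 1 = 1 - \<beta>" "neg_coeff \<beta> (Suc 0) = 1 - \<beta>" for \<beta>
    by (simp_all add: neg_coeff_def)
  have a1: "0 < a 1" unfolding a_def n1 by (rule integral_powr_pos[OF l]) simp
  have "a 1 \<le> a 0"
    unfolding a_def
  proof (rule integral_mono_AE[OF aint aint])
    show "AE i in \<nu>. l powr (e i - 1) * neg_coeff (e i) 1 \<le> l powr (e i - 1) * neg_coeff (e i) 0"
      using e_AE by eventually_elim (simp add: n0 n1 mult_left_le)
  qed
  then have a0: "0 < a 0" using a1 by simp
  have an: "0 \<le> a n" for n
    unfolding a_def
  proof (rule integral_nonneg_AE)
    show "AE i in \<nu>. 0 \<le> l powr (e i - 1) * neg_coeff (e i) n"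
      using e_AE by eventually_elim (simp add: neg_coeff_nonneg)
  qed
  \<comment> \<open>The quadratic form in x is nonnegative for each exponent, hence also after
    integration; its discriminant then gives log-convexity back.\<close>
  have lc: "(a (Suc n))\<^sup>2 \<le> a n * a (Suc (Suc n))" for n
  proof (rule discriminant_le[OF _ an])
    fix x
    have "0 \<le> (\<integral>i. l powr (e i - 1) * neg_coeff (e i) n * x\<^sup>2 + l powr (e i - 1) * neg_coeff (e i) (Suc n) * (2 * x) + l powr (e i - 1) * neg_coeff (e i) (Suc (Suc n)) \<partial>\<nu>)"
    proof (rule integral_nonneg_AE)
      show "AE i in \<nu>. 0 \<le> l powr (e i - 1) * neg_coeff (e i) n * x\<^sup>2 + l powr (e i - 1) * neg_coeff (e i) (Suc n) * (2 * x) + l powr (e i - 1) * neg_coeff (e i) (Suc (Suc n))"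
        using e_AE
      proof eventually_elim
        case (elim i)
        then have "0 \<le> l powr (e i - 1) * (neg_coeff (e i) n * x\<^sup>2 + 2 * neg_coeff (e i) (Suc n) * x + neg_coeff (e i) (Suc (Suc n)))"
          by (intro mult_nonneg_nonneg neg_coeff_quadratic) auto
        then show ?case by (simp add: algebra_simps)
      qed
    qed
    also have "\<dots> = a n * x\<^sup>2 + a (Suc n) * (2 * x) + a (Suc (Suc n))"
      using aint by (simp add: a_def)
    finally show "0 \<le> a n * x\<^sup>2 + 2 * a (Suc n) * x + a (Suc (Suc n))" by (simp add: mult_ac)
  qed
  have pos: "0 < l * (1 - z)" if "\<bar>z\<bar> < 1" for z using l that by (intro mult_pos_pos) auto
  obtain b where b: "bernstein_series b (\<lambda>z. 1 / (h (l * (1 - z)) / (l * (1 - z))))"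
  proof (rule kaluza[of a, OF a0 a1 lc])
    fix z :: real assume z: "\<bar>z\<bar> < 1"
    show "(\<lambda>n. a n * z ^ n) sums (h (l * (1 - z)) / (l * (1 - z)))"
      using series_integral(2)[OF l z, of 1] unfolding h_divide[OF pos[OF z]] by (simp add: a_def neg_coeff_def)
    show "0 < h (l * (1 - z)) / (l * (1 - z))" using h_pos[OF pos[OF z]] pos[OF z] by simp
  qed
  then show "\<exists>b. bernstein_series b (\<lambda>z. l * (1 - z) / h (l * (1 - z)))" by auto
qed

end

lemma bernstein_function_weight_symbol:
  assumes w: "admissible_weight w"
  shows "bernstein_function (weight_symbol w)" "bernstein_function (\<lambda>s. s / weight_symbol w s)"
proof -
  have "bernstein_function (weight_symbol w) \<and> bernstein_function (\<lambda>s. s / weight_symbol w s)"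
  proof (cases w)
    case (Discrete \<alpha> m b \<alpha>s)
    \<comment> \<open>Index 0 stands for the leading term at \<alpha>, with weight 1; the other
      terms keep their indices.\<close>
    define e where "e j = (if j = 0 then \<alpha> else \<alpha>s j)" for j
    define p where "p j = (if j = 0 then 1 else b j)" for j
    have split: "{0..m} = insert 0 {1..m}" by auto
    have e: "0 \<le> e j \<and> e j < 1" "0 \<le> p j" if "j \<in> {0..m}" for j
    proof -
      have *: "0 < \<alpha>" "\<alpha> < 1" "\<And>i. i \<in> {1..m} \<Longrightarrow> 0 < \<alpha>s i \<and> \<alpha>s i < \<alpha> \<and> 0 < b i"
        using w by (auto simp: Discrete)
      have "j \<in> {1..m}" if "j \<noteq> 0" using that \<open>j \<in> {0..m}\<close> by simp
      with *(3)[of j] *(1,2) show "0 \<le> e j \<and> e j < 1" "0 \<le> p j" by (auto simp: e_def p_def)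
    qed
    have int: "(\<integral>j. f j \<partial>point_measure {0..m} (\<lambda>j. ennreal (p j))) = f 0 + (\<Sum>j=1..m. b j * f j)" for f :: "nat \<Rightarrow> real"
      using e(2) by (subst lebesgue_integral_point_measure_finite) (auto simp: split p_def intro!: sum.cong)
    have "finite_measure (point_measure {0..m} (\<lambda>j. ennreal (p j)))"
    proof (rule finite_measureI)
      show "emeasure (point_measure {0..m} (\<lambda>j. ennreal (p j))) (space (point_measure {0..m} (\<lambda>j. ennreal (p j)))) \<noteq> \<infinity>"
        by (simp add: space_point_measure emeasure_point_measure_finite)
    qed
    then interpret weight_measure "point_measure {0..m} (\<lambda>j. ennreal (p j))" e
    proof (rule weight_measure.intro[OF _ weight_measure_axioms.intro])
      show "AE j in point_measure {0..m} (\<lambda>j. ennreal (p j)). 0 \<le> e j \<and> e j \<le> 1"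
        using e(1) by (auto simp: AE_point_measure less_imp_le)
      have "0 < 1 - \<alpha>" using w by (simp add: Discrete)
      moreover have "0 \<le> (\<Sum>j=1..m. b j * (1 - e j))"
        using e(1) w by (intro sum_nonneg mult_nonneg_nonneg) (auto simp: Discrete less_imp_le)
      ultimately show "0 < (\<integral>j. 1 - e j \<partial>point_measure {0..m} (\<lambda>j. ennreal (p j)))"
        unfolding int by (simp add: e_def)
    qed (simp add: measurable_point_measure_eq1)
    have "h = weight_symbol w"
      unfolding Discrete by (intro ext) (simp add: h_def int e_def)
    then show ?thesis using bernstein_function_h bernstein_function_conjugate by simp
  next
    case (Continuous \<mu>)
    have \<mu>c: "continuous_on {0..1} \<mu>" and \<mu>0: "\<And>\<beta>. \<beta> \<in> {0..1} \<Longrightarrow> 0 \<le> \<mu> \<beta>"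
      and nz: "0 < emeasure lborel {\<beta>\<in>{0..1}. \<mu> \<beta> \<noteq> 0}"
      using w by (auto simp: Continuous)
    \<comment> \<open>Outside \<open>{0..1}\<close> the values of \<open>\<mu>\<close> are
      arbitrary; extension by 0 gives a Borel density on the line.\<close>
    define p where "p \<beta> = indicator {0..1} \<beta> * \<mu> \<beta>" for \<beta>
    have [measurable]: "p \<in> borel_measurable borel"
      using borel_measurable_continuous_on_indicator[OF _ \<mu>c] by (simp add: p_def[abs_def])
    have p0: "0 \<le> p \<beta>" for \<beta> using \<mu>0 by (auto simp: p_def indicator_def)
    have pint: "integrable lborel (\<lambda>\<beta>. p \<beta> * f \<beta>)" and pintegral: "(\<integral>\<beta>. p \<beta> * f \<beta> \<partial>lborel) = integral {0..1} (\<lambda>\<beta>. \<mu> \<beta> * f \<beta>)"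
      if f: "continuous_on {0..1} f" for f
    proof -
      have si: "set_integrable lborel {0..1} (\<lambda>\<beta>. \<mu> \<beta> * f \<beta>)"
        by (rule borel_integrable_atLeastAtMost') (intro continuous_intros \<mu>c f)
      then show "integrable lborel (\<lambda>\<beta>. p \<beta> * f \<beta>)" by (simp add: set_integrable_def p_def mult.assoc)
      show "(\<integral>\<beta>. p \<beta> * f \<beta> \<partial>lborel) = integral {0..1} (\<lambda>\<beta>. \<mu> \<beta> * f \<beta>)"
        using set_borel_integral_eq_integral(2)[OF si] by (simp add: set_lebesgue_integral_def p_def mult.assoc)
    qed
    have dens: "(\<integral>\<beta>. f \<beta> \<partial>density lborel (\<lambda>\<beta>. ennreal (p \<beta>))) = (\<integral>\<beta>. p \<beta> * f \<beta> \<partial>lborel)"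
      if "f \<in> borel_measurable borel" for f :: "real \<Rightarrow> real"
      using that p0 by (subst integral_density) auto
    have "finite_measure (density lborel (\<lambda>\<beta>. ennreal (p \<beta>)))"
    proof (rule finite_measureI)
      have "emeasure (density lborel (\<lambda>\<beta>. ennreal (p \<beta>))) (space (density lborel (\<lambda>\<beta>. ennreal (p \<beta>)))) = (\<integral>\<^sup>+\<beta>. ennreal (p \<beta>) \<partial>lborel)"
        by (subst emeasure_density) auto
      also have "\<dots> = ennreal (\<integral>\<beta>. p \<beta> \<partial>lborel)"
        using pint[of "\<lambda>_. 1"] p0 by (intro nn_integral_eq_integral) auto
      finally show "emeasure (density lborel (\<lambda>\<beta>. ennreal (p \<beta>))) (space (density lborel (\<lambda>\<beta>. ennreal (p \<beta>)))) \<noteq> \<infinity>"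
        by simp
    qed
    then interpret weight_measure "density lborel (\<lambda>\<beta>. ennreal (p \<beta>))" "\<lambda>\<beta>. \<beta>"
    proof (rule weight_measure.intro[OF _ weight_measure_axioms.intro])
      show "AE \<beta> in density lborel (\<lambda>\<beta>. ennreal (p \<beta>)). 0 \<le> \<beta> \<and> \<beta> \<le> 1"
        by (subst AE_density, measurable) (auto simp: p_def indicator_def)
      have nn: "0 \<le> p \<beta> * (1 - \<beta>)" for \<beta> using p0[of \<beta>] by (cases "\<beta> \<le> 1") (auto simp: p_def)
      have pi: "integrable lborel (\<lambda>\<beta>. p \<beta> * (1 - \<beta>))" by (intro pint continuous_intros)
      \<comment> \<open>If it vanished, \<open>\<mu>\<close> would be 0 almost everywhere on
        \<open>{0..1}\<close>, because the factor 1 - \<beta> vanishes only at the single point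
        1.\<close>
      have "(\<integral>\<beta>. p \<beta> * (1 - \<beta>) \<partial>lborel) \<noteq> 0"
      proof
        assume "(\<integral>\<beta>. p \<beta> * (1 - \<beta>) \<partial>lborel) = 0"
        then have "AE \<beta> in lborel. p \<beta> * (1 - \<beta>) = 0"
          using integral_nonneg_eq_0_iff_AE[OF pi] nn by simp
        then have "AE \<beta> in lborel. \<beta> \<notin> {\<beta>\<in>{0..1}. \<mu> \<beta> \<noteq> 0}"
          using AE_lborel_singleton[of 1] by eventually_elim (auto simp: p_def)
        moreover have "{\<beta>\<in>{0..1}. \<mu> \<beta> \<noteq> 0} = {\<beta>\<in>space lborel. p \<beta> \<noteq> 0}" by (auto simp: p_def indicator_def)
        then have "{\<beta>\<in>{0..1}. \<mu> \<beta> \<noteq> 0} \<in> sets lborel" by simp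
        ultimately have "{\<beta>\<in>{0..1}. \<mu> \<beta> \<noteq> 0} \<in> null_sets lborel"
          by (simp only: AE_iff_null_sets)
        then have "emeasure lborel {\<beta>\<in>{0..1}. \<mu> \<beta> \<noteq> 0} = 0" by (rule null_setsD1)
        then show False using nz by simp
      qed
      moreover have "0 \<le> (\<integral>\<beta>. p \<beta> * (1 - \<beta>) \<partial>lborel)" using nn by simp
      ultimately show "0 < (\<integral>\<beta>. 1 - \<beta> \<partial>density lborel (\<lambda>\<beta>. ennreal (p \<beta>)))"
        by (subst dens) auto
    qed simp
    have "h s = weight_symbol w s" if "0 < s" for s
      unfolding Continuous weight_symbol.simps h_def using that
      by (subst dens) (auto intro!: pintegral continuous_intros)
    then show ?thesis
      using bernstein_function_cong[OF bernstein_function_h] bernstein_function_cong[OF bernstein_function_conjugate] by simp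
  qed
  then show "bernstein_function (weight_symbol w)" "bernstein_function (\<lambda>s. s / weight_symbol w s)" by auto
qed

text \<open>The solution operator does not change when \<open>k0\<close> is replaced by its
  nonnegative representative \<open>k\<close>, as both define the same strong solutions. The cone of
  the order is then a closed convex cone invariant under the semigroup, to which
  \<open>S_cone\<close> applies.\<close>

lemma positive_solution_operator:
  fixes T :: "real \<Rightarrow> 'a::ordered_banach \<Rightarrow>\<^sub>L 'a"
  assumes g: "bernstein_function g" and k0: "has_laplace_transform k0 (\<lambda>s. 1 / g s)"
    and T: "C0_semigroup T" "\<And>t. 0 \<le> t \<Longrightarrow> norm (T t) \<le> M" and gen: "is_generator T D A"
    and pos: "positive_family (\<lambda>t. blinfun_apply (T t))"
  shows "positive_family (solution_operator D A k0)"
proof -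
  obtain k where ker: "laplace_kernel k" "AE t in lebesgue. 0 \<le> t \<longrightarrow> k0 t = k t"
    "\<And>s. 0 < s \<Longrightarrow> (\<integral>t. exp (- s * t) * k t \<partial>lborel) = 1 / g s"
    by (rule laplace_kernel_representative[OF k0 g], rule that)
  interpret volterra_semigroup T M D A k
    by unfold_locales (use T gen ker(1) resolvent_kernel_exists[OF ker(1) g ker(3)] in auto)
  have ss: "strong_solution D A k0 = strong_solution D A k"
    by (intro ext) (simp add: strong_solution_def has_integral_kernel_AE_cong[OF ker(2)])
  have tss: "the_strong_solution D A k0 = the_strong_solution D A k"
    by (intro ext) (simp only: the_strong_solution_def ss)
  have wp: "Defs.well_posed D A k0 = Defs.well_posed D A k"
    unfolding well_posed_def ss tss ..
  have "solution_operator D A k0 = solution_operator D A k"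
    by (intro ext) (simp only: solution_operator_def wp tss)
  moreover have "0 \<le> solution_operator D A k t a" if t: "0 \<le> t" and a: "0 \<le> a" for t a
  proof -
    have "S t a \<in> {x. 0 \<le> x}"
    proof (rule S_cone)
      show "convex_cone {x::'a. 0 \<le> x}" by (simp add: convex_cone_iff scaleR_nonneg_nonneg)
      show "closed {x::'a. 0 \<le> x}" by (rule closed_positive_cone)
    qed (use pos t a in \<open>auto simp: positive_family_def\<close>)
    then show ?thesis by (simp add: solution_operator_eq[OF t])
  qed
  ultimately show ?thesis by (simp add: positive_family_def)
qed

theorem corollary4p3:
  fixes w :: weight
    and k1 k2 :: "real \<Rightarrow> real"
    and T :: "real \<Rightarrow> 'a::ordered_banach \<Rightarrow>\<^sub>L 'a"
    and M :: real
    and D :: "'a set"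
    and A :: "'a \<Rightarrow> 'a"
  assumes "admissible_weight w"
    and "caputo_kernel w k1"
    and "riemann_liouville_kernel w k2"
    and "C0_semigroup T"
    and "\<And>t. 0 \<le> t \<Longrightarrow> norm (T t) \<le> M"
    and "is_generator T D A"
    and "positive_family (\<lambda>t. blinfun_apply (T t))"
  shows "positive_family (solution_operator D A k1) \<and>
         positive_family (solution_operator D A k2)"
proof
  show "positive_family (solution_operator D A k1)"
    by (rule positive_solution_operator[OF bernstein_function_weight_symbol(1)[OF assms(1)] _ assms(4-7)])
       (use assms(2) in \<open>simp add: caputo_kernel_def\<close>)
  \<comment> \<open>The transform h(s)/s is read as 1/g(s) with g(s) = s/h(s), the conjugate
    Bernstein function.\<close>
  show "positive_family (solution_operator D A k2)"
    by (rule positive_solution_operator[OF bernstein_function_weight_symbol(2)[OF assms(1)] _ assms(4-7)])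
       (use assms(3) in \<open>simp add: riemann_liouville_kernel_def\<close>)
qed

end
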